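(* Let $n\ge 3$ and let $\Omega_p\subset\mathbb{C}^n$ be a domain of the class $\Omega^{(n)}$. For any continuous functions $\phi$ and $\psi$ on $\partial\Omega_p$, the commutator $T_{\sigma_p,\phi}T_{\sigma_p,\psi}-T_{\sigma_p,\psi}T_{\sigma_p,\phi}$ of $M_{\sigma_p,z}$-Toeplitz operators is compact on $H^2(\sigma_p)$; in particular, the multiplication tuple $M_{\sigma_p,z}$ on $H^2(\sigma_p)$ is essentially normal.
   Context: Class $\Omega^{(n)}$: let $p=(p_1,\ldots,p_n)$, where for each $1\le i\le n$, $p_i=(p_{i,1},\ldots,p_{i,m_i})$ is an $m_i$-tuple of positive integers with $m_i\ge 2$ and $\gcd\{p_{i,1},\ldots,p_{i,m_i}\}=1$. Put $\Omega_p=\{z\in\mathbb{C}^n:\sum_{i=1}^n\sum_{j=1}^{m_i}|z_i|^{2p_{i,j}}<1\}$, with closure $\overline{\Omega}_p$ (defined by $\le 1$) and topological boundary $\partial\Omega_p$ (defined by $=1$). $\Omega^{(n)}$ is the class of all such $\Omega_p$. $A(\Omega_p)=\{f\in C(\overline{\Omega}_p): f \text{ is holomorphic on } \Omega_p\}$. $\sigma_p$ is the normalized surface area measure on $\partial\Omega_p$. The Hardy space $H^2(\sigma_p)$ is the closure of (the restrictions to $\partial\Omega_p$ of functions in) $A(\Omega_p)$ in $L^2(\sigma_p)$; $P_{\sigma_p}$ is the orthogonal projection of $L^2(\sigma_p)$ onto $H^2(\sigma_p)$. For $\phi\in L^\infty(\sigma_p)$, $N_{\sigma_p,\phi}$ is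 multiplication by $\phi$ on $L^2(\sigma_p)$, and the $M_{\sigma_p,z}$-Toeplitz operator is $T_{\sigma_p,\phi}=P_{\sigma_p}N_{\sigma_p,\phi}|_{H^2(\sigma_p)}$. $M_{\sigma_p,z}=(M_{\sigma_p,z_1},\ldots,M_{\sigma_p,z_n})$ is the tuple of multiplications by the coordinate functions $z_i$ on $H^2(\sigma_p)$. An $n$-tuple $T=(T_1,\ldots,T_n)$ of commuting bounded operators on a Hilbert space is essentially normal if $T_i^*T_j-T_jT_i^*$ is compact for all $i,j$. *)

theory Defs
  imports "HOL-Analysis.Analysis"
begin

section \<open>Surface measure\<close>

text \<open>
  Surface area on a smooth hypersurface of a \<open>d\<close>-dimensional Euclidean space is its
  \<open>(d - 1)\<close>-dimensional Hausdorff measure. The factor \<open>unit_ball_vol k / 2 ^ k\<close> is the usual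
  one, for which the \<open>k\<close>-dimensional Hausdorff measure in dimension \<open>k\<close> is Lebesgue measure.
  These definitions are meant for \<open>k > 0\<close>: for \<open>k = 0\<close> the empty set would count as a point.
\<close>

definition hausdorff_premeasure :: "nat \<Rightarrow> real \<Rightarrow> 'a::metric_space set \<Rightarrow> ennreal" where
  "hausdorff_premeasure k \<delta> A =
     (INF U \<in> {U :: nat \<Rightarrow> 'a set. A \<subseteq> (\<Union>i. U i) \<and> (\<forall>i. bounded (U i) \<and> diameter (U i) \<le> \<delta>)}.
        \<Sum>i. ennreal (unit_ball_vol (real k) * (diameter (U i) / 2) ^ k))"

definition hausdorff_outer :: "nat \<Rightarrow> 'a::metric_space set \<Rightarrow> ennreal" where
  "hausdorff_outer k A = (SUP \<delta>\<in>{0<..}. hausdorff_premeasure k \<delta> A)"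

definition hausdorff_measure :: "nat \<Rightarrow> 'a::metric_space measure" where
  "hausdorff_measure k = measure_of UNIV (sets borel) (hausdorff_outer k)"

definition surface_measure :: "'a::euclidean_space set \<Rightarrow> 'a measure" where
  "surface_measure S =
     uniform_measure (restrict_space (hausdorff_measure (DIM('a) - 1)) S) S"


section \<open>Square-integrable functions and operators on them\<close>

text \<open>
  Elements of \<open>L\<^sup>2(M)\<close> are represented by functions, so identities between elements of
  \<open>L\<^sup>2(M)\<close> hold almost everywhere, and vectors and operators obtained by choice
  (orthogonal projections, adjoints) are determined only up to null sets.
\<close>

definition L2 :: "'a measure \<Rightarrow> ('a \<Rightarrow> complex) set" where
  "L2 M = {f \<in> borel_measurable M. integrable M (\<lambda>x. (cmod (f x))\<^sup>2)}"

definition L2_inner :: "'a measure \<Rightarrow> ('a \<Rightarrow> complex) \<Rightarrow> ('a \<Rightarrow> complex) \<Rightarrow> complex" where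
  "L2_inner M f g = (\<integral>x. f x * cnj (g x) \<partial>M)"

definition L2_norm :: "'a measure \<Rightarrow> ('a \<Rightarrow> complex) \<Rightarrow> real" where
  "L2_norm M f = sqrt (\<integral>x. (cmod (f x))\<^sup>2 \<partial>M)"

text \<open>In the following, \<open>H\<close> stands for a closed subspace of \<open>L\<^sup>2(M)\<close>.\<close>

definition L2_proj ::
    "'a measure \<Rightarrow> ('a \<Rightarrow> complex) set \<Rightarrow> ('a \<Rightarrow> complex) \<Rightarrow> ('a \<Rightarrow> complex)" where
  "L2_proj M H f = (SOME g. g \<in> H \<and> (\<forall>h\<in>H. L2_inner M (\<lambda>x. f x - g x) h = 0))"

definition L2_adjoint ::
    "'a measure \<Rightarrow> ('a \<Rightarrow> complex) set \<Rightarrow> (('a \<Rightarrow> complex) \<Rightarrow> ('a \<Rightarrow> complex))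
       \<Rightarrow> ('a \<Rightarrow> complex) \<Rightarrow> ('a \<Rightarrow> complex)" where
  "L2_adjoint M H T g = (SOME h. h \<in> H \<and> (\<forall>f\<in>H. L2_inner M (T f) g = L2_inner M f h))"

definition bounded_operator_on ::
    "'a measure \<Rightarrow> ('a \<Rightarrow> complex) set \<Rightarrow> (('a \<Rightarrow> complex) \<Rightarrow> ('a \<Rightarrow> complex)) \<Rightarrow> bool" where
  "bounded_operator_on M H T \<longleftrightarrow>
     (\<forall>f\<in>H. T f \<in> H) \<and>
     (\<forall>f\<in>H. \<forall>g\<in>H. \<forall>a b. AE x in M. T (\<lambda>y. a * f y + b * g y) x = a * T f x + b * T g x) \<and>
     (\<exists>C. \<forall>f\<in>H. L2_norm M (T f) \<le> C * L2_norm M f)"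

definition compact_operator_on ::
    "'a measure \<Rightarrow> ('a \<Rightarrow> complex) set \<Rightarrow> (('a \<Rightarrow> complex) \<Rightarrow> ('a \<Rightarrow> complex)) \<Rightarrow> bool" where
  "compact_operator_on M H T \<longleftrightarrow>
     bounded_operator_on M H T \<and>
     (\<forall>F :: nat \<Rightarrow> 'a \<Rightarrow> complex. (\<forall>k. F k \<in> H) \<and> (\<exists>C. \<forall>k. L2_norm M (F k) \<le> C) \<longrightarrow>
        (\<exists>r g. strict_mono r \<and> g \<in> H \<and>
           (\<lambda>k. L2_norm M (\<lambda>x. T (F (r k)) x - g x)) \<longlonglongrightarrow> 0))"

definition essentially_normal_on ::
    "'a measure \<Rightarrow> ('a \<Rightarrow> complex) set \<Rightarrow> ('i \<Rightarrow> ('a \<Rightarrow> complex) \<Rightarrow> ('a \<Rightarrow> complex)) \<Rightarrow> bool" where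
  "essentially_normal_on M H T \<longleftrightarrow>
     (\<forall>i. bounded_operator_on M H (T i)) \<and>
     (\<forall>i j. \<forall>f\<in>H. AE x in M. T i (T j f) x = T j (T i f) x) \<and>
     (\<forall>i j. compact_operator_on M H
        (\<lambda>f x. L2_adjoint M H (T i) (T j f) x - T j (L2_adjoint M H (T i) f) x))"


section \<open>The domains and their Hardy spaces\<close>

definition admissible :: "('n::finite \<Rightarrow> nat list) \<Rightarrow> bool" where
  "admissible p \<longleftrightarrow>
     (\<forall>i. length (p i) \<ge> 2 \<and> (\<forall>q\<in>set (p i). q > 0) \<and> Gcd (set (p i)) = 1)"

definition Omega :: "('n::finite \<Rightarrow> nat list) \<Rightarrow> (complex ^ 'n) set" where
  "Omega p = {z. (\<Sum>i\<in>UNIV. \<Sum>j<length (p i). cmod (z $ i) ^ (2 * (p i ! j))) < 1}"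

text \<open>
  Holomorphy in several variables: real Frechet differentiability with a complex-linear
  derivative. The type \<open>complex ^ 'n\<close> is a real vector space; complex scaling is \<open>*s\<close>.
\<close>

definition holomorphic_several :: "(complex ^ 'n::finite \<Rightarrow> complex) \<Rightarrow> (complex ^ 'n) set \<Rightarrow> bool"
  where
  "holomorphic_several f S \<longleftrightarrow>
     (\<forall>z\<in>S. \<exists>D. (f has_derivative D) (at z) \<and> (\<forall>c v. D (c *s v) = c * D v))"

definition A_algebra :: "('n::finite \<Rightarrow> nat list) \<Rightarrow> (complex ^ 'n \<Rightarrow> complex) set" where
  "A_algebra p = {f. continuous_on (closure (Omega p)) f \<and> holomorphic_several f (Omega p)}"

definition sigma_p :: "('n::finite \<Rightarrow> nat list) \<Rightarrow> (complex ^ 'n) measure" where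
  "sigma_p p = surface_measure (frontier (Omega p))"

definition hardy :: "('n::finite \<Rightarrow> nat list) \<Rightarrow> (complex ^ 'n \<Rightarrow> complex) set" where
  "hardy p = {f \<in> L2 (sigma_p p).
     \<forall>e>0. \<exists>g\<in>A_algebra p. L2_norm (sigma_p p) (\<lambda>z. f z - g z) < e}"

definition toeplitz :: "('n::finite \<Rightarrow> nat list) \<Rightarrow> (complex ^ 'n \<Rightarrow> complex)
    \<Rightarrow> (complex ^ 'n \<Rightarrow> complex) \<Rightarrow> (complex ^ 'n \<Rightarrow> complex)" where
  "toeplitz p \<phi> f = L2_proj (sigma_p p) (hardy p) (\<lambda>z. \<phi> z * f z)"

definition coord_mult :: "'n::finite \<Rightarrow> (complex ^ 'n \<Rightarrow> complex) \<Rightarrow> (complex ^ 'n \<Rightarrow> complex)" where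
  "coord_mult i f = (\<lambda>z. z $ i * f z)"

end

theory Submission
  imports Defs "HOL-Complex_Analysis.Great_Picard"
begin

text \<open>
  A commutator of Toeplitz operators is built from Hankel operators \<open>(I - P) \<phi>\<close>, restricted to the
  Hardy space, so it suffices that these are compact for continuous \<open>\<phi>\<close>. The symbols with compact
  Hankel operator form a uniformly closed algebra which contains the coordinate functions; by the
  Stone--Weierstrass theorem only the symbols \<open>cnj z\<^sub>i\<close> are left.

  Rotating a single coordinate preserves the surface measure \<open>\<sigma>\<close>, so the monomials \<open>z\<^sup>\<alpha>\<close> are orthogonal,
  and by Cauchy's formula in each coordinate they span the Hardy space. The functions
  \<open>cnj z\<^sub>i z\<^sup>\<alpha> - d\<^sub>\<alpha> z\<^sup>\<beta>\<close> with \<open>\<beta>\<close> equal to \<open>\<alpha>\<close> lowered by one at \<open>i\<close> are orthogonal as well, hence compactness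
  follows once their norms, for a suitable choice of \<open>d\<^sub>\<alpha>\<close>, are \<open>o(\<parallel>z\<^sup>\<alpha>\<parallel>)\<close> as the degree tends to infinity.

  Up to the factor \<open>z\<^sup>\<beta>\<close> such a function is \<open>\<bar>z\<^sub>i\<bar>\<^sup>2 - d\<^sub>\<alpha>\<close>, and it is small because \<open>\<bar>z\<^sup>\<beta>\<bar>\<^sup>2 d\<sigma>\<close> concentrates where
  \<open>\<bar>z\<^sub>i\<bar>\<close> is close to its value at a maximum point of \<open>\<bar>z\<^sup>\<beta>\<bar>\<close> on the closed domain: by strict logarithmic
  convexity the monomial is exponentially smaller elsewhere, while near the maximum point a fixed
  amount of surface measure is available, since \<open>\<sigma>\<close> charges every ball centred on the surface.
\<close>

section \<open>Square-integrable functions\<close>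

text \<open>The delicate point is that \<open>\<bar>z_i\<bar>^2 - d\<close> must be small relative
  to \<open>\<bar>z_i\<bar>\<close> and not merely small, because
  \<open>z^\<alpha> = z_i z^\<beta>\<close> and \<open>z_i\<close> may be tiny exactly where
  \<open>z^\<beta>\<close> concentrates. Hence \<open>d\<close> is 0 if the maximum point has a
  small i-th coordinate, and the squared modulus of that coordinate otherwise. All bounds must be
  uniform in the multi-index, since only its degree is known to be large. The decay rate
  \<open>r\<close> away from the maximum depends on the tolerance alone, and the norm is bounded
  below on a ball whose radius and least mass are fixed while its centre may wander over the
  surface. An intermediate rate \<open>s\<close> with \<open>r < s < 1\<close> compares the two: the
  far part is of order at most \<open>r^N\<close>, the norm of order at least \<open>s^N\<close>.
  That \<sigma> charges balls comes from cones: a null patch of the surface would span a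
  Lebesgue-null cone, yet the cone over a patch contains a ball. If the surface had Hausdorff mass 0
  or infinity, \<sigma> would be the null measure by definition, and all norms would vanish; this
  case is treated separately.\<close>

lemma L2_measurable: "f \<in> L2 M \<Longrightarrow> f \<in> borel_measurable M"
  by (simp add: L2_def)

lemma L2_integrable_norm: "f \<in> L2 M \<Longrightarrow> integrable M (\<lambda>x. (cmod (f x))\<^sup>2)"
  by (simp add: L2_def)

lemma L2I_bound:
  assumes "f \<in> borel_measurable M" "integrable M g" "\<And>x. x \<in> space M \<Longrightarrow> (cmod (f x))\<^sup>2 \<le> g x"
  shows "f \<in> L2 M"
proof -
  have "integrable M (\<lambda>x. (cmod (f x))\<^sup>2)"
    using assms by (intro Bochner_Integration.integrable_bound[OF assms(2)]) (auto intro!: AE_I2 order_trans[OF _ abs_ge_self])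
  then show ?thesis using assms(1) by (simp add: L2_def)
qed

lemma L2_cmult: "f \<in> L2 M \<Longrightarrow> (\<lambda>x. c * f x) \<in> L2 M"
  by (auto simp: L2_def norm_mult power_mult_distrib)

lemma L2_zero [simp]: "(\<lambda>x. 0) \<in> L2 M"
  by (simp add: L2_def)

lemma borel_measurable_cnj [measurable]: "cnj \<in> borel_measurable borel"
  by (intro borel_measurable_continuous_onI continuous_intros)

lemma L2_add:
  assumes "f \<in> L2 M" "g \<in> L2 M" shows "(\<lambda>x. f x + g x) \<in> L2 M"
proof (rule L2I_bound)
  show "integrable M (\<lambda>x. 2 * (cmod (f x))\<^sup>2 + 2 * (cmod (g x))\<^sup>2)"
    using assms by (simp add: L2_def)
  show "(cmod (f x + g x))\<^sup>2 \<le> 2 * (cmod (f x))\<^sup>2 + 2 * (cmod (g x))\<^sup>2" for x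
  proof -
    have "(cmod (f x + g x))\<^sup>2 \<le> (cmod (f x) + cmod (g x))\<^sup>2"
      by (simp add: norm_triangle_ineq power_mono)
    also have "\<dots> \<le> 2 * (cmod (f x))\<^sup>2 + 2 * (cmod (g x))\<^sup>2"
      using sum_squares_bound[of "cmod (f x)" "cmod (g x)"] by (simp add: power2_sum)
    finally show ?thesis .
  qed
qed (use assms in \<open>auto simp: L2_def\<close>)

lemma L2_diff: "f \<in> L2 M \<Longrightarrow> g \<in> L2 M \<Longrightarrow> (\<lambda>x. f x - g x) \<in> L2 M"
  using L2_add[OF _ L2_cmult[of g M "-1"], of f] by simp

lemma L2_sum: "(\<And>i. i \<in> I \<Longrightarrow> f i \<in> L2 M) \<Longrightarrow> (\<lambda>x. \<Sum>i\<in>I. f i x) \<in> L2 M"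
  by (induction I rule: infinite_finite_induct) (auto intro: L2_add)

lemma L2_bounded_mult:
  assumes "f \<in> L2 M" "\<phi> \<in> borel_measurable M" "\<And>x. x \<in> space M \<Longrightarrow> cmod (\<phi> x) \<le> B"
  shows "(\<lambda>x. \<phi> x * f x) \<in> L2 M" "L2_norm M (\<lambda>x. \<phi> x * f x) \<le> B * L2_norm M f"
proof -
  have le: "(cmod (\<phi> x * f x))\<^sup>2 \<le> B\<^sup>2 * (cmod (f x))\<^sup>2" if "x \<in> space M" for x
    using assms(3)[OF that] by (auto simp: norm_mult power_mult_distrib intro!: mult_right_mono power_mono)
  have i: "integrable M (\<lambda>x. B\<^sup>2 * (cmod (f x))\<^sup>2)" using assms by (simp add: L2_def)
  show L: "(\<lambda>x. \<phi> x * f x) \<in> L2 M"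
    using assms(1,2) by (intro L2I_bound[OF _ i le]) (auto simp: L2_def)
  show "L2_norm M (\<lambda>x. \<phi> x * f x) \<le> B * L2_norm M f"
  \<comment> \<open>On an empty space the hypothesis puts no sign on \<open>B\<close>, but both
    sides are 0.\<close>
  proof (cases "space M = {}")
    case True
    then have "(\<integral>x. h x \<partial>M) = 0" for h :: "_ \<Rightarrow> real"
      by (simp add: Bochner_Integration.integral_empty)
    then show ?thesis by (simp add: L2_norm_def)
  next
    case False
    then have "B \<ge> 0" using assms(3) by (meson all_not_in_conv norm_ge_zero order_trans)
    have "(\<integral>x. (cmod (\<phi> x * f x))\<^sup>2 \<partial>M) \<le> (\<integral>x. B\<^sup>2 * (cmod (f x))\<^sup>2 \<partial>M)"
      by (rule integral_mono[OF L2_integrable_norm[OF L] i le])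
    then have "L2_norm M (\<lambda>x. \<phi> x * f x) \<le> sqrt (B\<^sup>2 * (\<integral>x. (cmod (f x))\<^sup>2 \<partial>M))"
      by (simp add: L2_norm_def)
    then show ?thesis using \<open>B \<ge> 0\<close> by (simp add: L2_norm_def real_sqrt_mult)
  qed
qed

lemma L2_integrable_mult:
  assumes "f \<in> L2 M" "g \<in> L2 M" shows "integrable M (\<lambda>x. f x * cnj (g x))"
proof (rule Bochner_Integration.integrable_bound)
  show "integrable M (\<lambda>x. (cmod (f x))\<^sup>2 + (cmod (g x))\<^sup>2)" using assms by (simp add: L2_def)
  show "(\<lambda>x. f x * cnj (g x)) \<in> borel_measurable M" using assms by (auto simp: L2_def)
  have "cmod (f x) * cmod (g x) \<le> (cmod (f x))\<^sup>2 + (cmod (g x))\<^sup>2" for x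
  proof -
    have "0 \<le> cmod (f x) * cmod (g x)" by simp
    then show ?thesis using sum_squares_bound[of "cmod (f x)" "cmod (g x)"] by linarith
  qed
  then show "AE x in M. norm (f x * cnj (g x)) \<le> norm ((cmod (f x))\<^sup>2 + (cmod (g x))\<^sup>2)"
    by (auto simp: norm_mult)
qed

lemma L2_inner_add_left:
  "f \<in> L2 M \<Longrightarrow> g \<in> L2 M \<Longrightarrow> h \<in> L2 M \<Longrightarrow>
    L2_inner M (\<lambda>x. f x + g x) h = L2_inner M f h + L2_inner M g h"
  unfolding L2_inner_def
  by (simp add: distrib_right Bochner_Integration.integral_add L2_integrable_mult)

lemma L2_inner_diff_left:
  "f \<in> L2 M \<Longrightarrow> g \<in> L2 M \<Longrightarrow> h \<in> L2 M \<Longrightarrow>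
    L2_inner M (\<lambda>x. f x - g x) h = L2_inner M f h - L2_inner M g h"
  unfolding L2_inner_def
  by (simp add: left_diff_distrib Bochner_Integration.integral_diff L2_integrable_mult)

lemma L2_inner_cmult_left: "L2_inner M (\<lambda>x. c * f x) h = c * L2_inner M f h"
  unfolding L2_inner_def by (simp add: mult.assoc)

lemma L2_inner_commute: "L2_inner M f g = cnj (L2_inner M g f)"
proof -
  have "(\<integral>x. cnj (g x * cnj (f x)) \<partial>M) = cnj (\<integral>x. g x * cnj (f x) \<partial>M)"
    by (rule Bochner_Integration.integral_cnj)
  then show ?thesis by (simp add: L2_inner_def mult.commute)
qed

lemma L2_inner_add_right:
  "f \<in> L2 M \<Longrightarrow> g \<in> L2 M \<Longrightarrow> h \<in> L2 M \<Longrightarrow>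
    L2_inner M h (\<lambda>x. f x + g x) = L2_inner M h f + L2_inner M h g"
  by (subst (1 2 3) L2_inner_commute) (simp add: L2_inner_add_left)

lemma L2_inner_cmult_right: "L2_inner M h (\<lambda>x. c * f x) = cnj c * L2_inner M h f"
  by (subst (1 2) L2_inner_commute) (simp add: L2_inner_cmult_left)

lemma L2_inner_zero_left [simp]: "L2_inner M (\<lambda>x. 0) h = 0"
  by (simp add: L2_inner_def)

lemma L2_inner_sum_left:
  "(\<And>i. i \<in> I \<Longrightarrow> f i \<in> L2 M) \<Longrightarrow> h \<in> L2 M \<Longrightarrow>
    L2_inner M (\<lambda>x. \<Sum>i\<in>I. f i x) h = (\<Sum>i\<in>I. L2_inner M (f i) h)"
  by (induction I rule: infinite_finite_induct) (auto simp: L2_inner_add_left L2_sum)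

lemma L2_inner_sum_right:
  "(\<And>i. i \<in> I \<Longrightarrow> f i \<in> L2 M) \<Longrightarrow> h \<in> L2 M \<Longrightarrow>
    L2_inner M h (\<lambda>x. \<Sum>i\<in>I. f i x) = (\<Sum>i\<in>I. L2_inner M h (f i))"
  by (subst L2_inner_commute) (simp add: L2_inner_sum_left L2_inner_commute[symmetric])

lemma L2_inner_mult_shift: "L2_inner M (\<lambda>x. \<phi> x * f x) g = L2_inner M f (\<lambda>x. cnj (\<phi> x) * g x)"
  unfolding L2_inner_def by (simp add: mult_ac)

lemma L2_norm_nonneg [simp]: "L2_norm M f \<ge> 0"
  by (simp add: L2_norm_def)

lemma L2_norm_sq: "(L2_norm M f)\<^sup>2 = (\<integral>x. (cmod (f x))\<^sup>2 \<partial>M)"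
  by (simp add: L2_norm_def)

lemma L2_inner_self: "L2_inner M f f = of_real ((L2_norm M f)\<^sup>2)"
  unfolding L2_norm_sq L2_inner_def complex_norm_square[symmetric] integral_complex_of_real ..

lemma L2_norm_cmult [simp]: "L2_norm M (\<lambda>x. c * f x) = cmod c * L2_norm M f"
  by (simp add: L2_norm_def norm_mult power_mult_distrib real_sqrt_mult)

lemma L2_norm_minus_commute: "L2_norm M (\<lambda>x. f x - g x) = L2_norm M (\<lambda>x. g x - f x)"
  by (simp add: L2_norm_def norm_minus_commute)

lemma L2_norm_zero [simp]: "L2_norm M (\<lambda>x. 0) = 0"
  by (simp add: L2_norm_def)

lemma L2_norm_add_sq:
  assumes "f \<in> L2 M" "g \<in> L2 M"
  shows "(L2_norm M (\<lambda>x. f x + g x))\<^sup>2 = (L2_norm M f)\<^sup>2 + 2 * Re (L2_inner M f g) + (L2_norm M g)\<^sup>2"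
proof -
  have "complex_of_real ((L2_norm M (\<lambda>x. f x + g x))\<^sup>2)
      = of_real ((L2_norm M f)\<^sup>2) + (L2_inner M f g + cnj (L2_inner M f g)) + of_real ((L2_norm M g)\<^sup>2)"
    unfolding L2_inner_self[symmetric] L2_inner_commute[of M g f, symmetric]
    using assms by (simp add: L2_inner_add_left L2_inner_add_right L2_add)
  also have "\<dots> = of_real ((L2_norm M f)\<^sup>2 + 2 * Re (L2_inner M f g) + (L2_norm M g)\<^sup>2)"
    by (simp add: complex_add_cnj)
  finally show ?thesis by (simp only: of_real_eq_iff)
qed

lemma L2_norm_diff_sq:
  assumes "f \<in> L2 M" "g \<in> L2 M"
  shows "(L2_norm M (\<lambda>x. f x - g x))\<^sup>2 = (L2_norm M f)\<^sup>2 - 2 * Re (L2_inner M f g) + (L2_norm M g)\<^sup>2"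
  using L2_norm_add_sq[OF assms(1) L2_cmult[OF assms(2), of "-1"]]
  by (simp only: L2_norm_cmult L2_inner_cmult_right) simp

lemma L2_Cauchy_Schwarz:
  assumes f: "f \<in> L2 M" and g: "g \<in> L2 M"
  shows "cmod (L2_inner M f g) \<le> L2_norm M f * L2_norm M g"
proof -
  define c where "c = L2_inner M f g"
  define a where "a = (L2_norm M f)\<^sup>2"
  define b where "b = (L2_norm M g)\<^sup>2"
  \<comment> \<open>The squared norm of \<open>f - t c g\<close>, a quadratic in the real variable
    \<open>t\<close>; its minimum is at \<open>t = 1 / b\<close>.\<close>
  have key: "0 \<le> a - 2 * t * (cmod c)\<^sup>2 + t\<^sup>2 * (cmod c)\<^sup>2 * b" for t :: real
  proof -
    have "0 \<le> (L2_norm M (\<lambda>x. f x - (of_real t * c) * g x))\<^sup>2" by simp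
    also have "\<dots> = a - 2 * Re (cnj (of_real t * c) * c) + (cmod (of_real t * c) * L2_norm M g)\<^sup>2"
      unfolding a_def c_def
      by (subst L2_norm_diff_sq[OF f L2_cmult[OF g]]) (simp only: L2_norm_cmult L2_inner_cmult_right)
    also have "Re (cnj (of_real t * c) * c) = t * (cmod c)\<^sup>2"
      by (simp add: cmod_power2) (simp add: power2_eq_square algebra_simps)
    finally show ?thesis by (simp add: b_def norm_mult power_mult_distrib)
  qed
  have "(cmod c)\<^sup>2 \<le> a * b"
  proof (cases "b = 0")
    case True
    have "(cmod c)\<^sup>2 = 0"
    proof (rule ccontr)
      assume "(cmod c)\<^sup>2 \<noteq> 0"
      \<comment> \<open>For \<open>b = 0\<close> the expression in \<open>key\<close> is affine in
        \<open>t\<close>, and this value of \<open>t\<close> makes it -1.\<close>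
      then show False using key[of "(a + 1) / (2 * (cmod c)\<^sup>2)"] True by (simp add: field_simps)
    qed
    then show ?thesis using True by simp
  next
    case False
    then have "b > 0" by (simp add: b_def)
    have "0 \<le> a - (cmod c)\<^sup>2 / b" using key[of "1 / b"] \<open>b > 0\<close>
      by (simp add: field_simps power2_eq_square)
    then show ?thesis using \<open>b > 0\<close> by (simp add: field_simps)
  qed
  then have "(cmod c)\<^sup>2 \<le> (L2_norm M f * L2_norm M g)\<^sup>2" by (simp add: a_def b_def power_mult_distrib)
  then show ?thesis unfolding c_def by (rule power2_le_imp_le) simp
qed

lemma L2_norm_triangle:
  assumes f: "f \<in> L2 M" and g: "g \<in> L2 M"
  shows "L2_norm M (\<lambda>x. f x + g x) \<le> L2_norm M f + L2_norm M g"
proof (rule power2_le_imp_le)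
  have "Re (L2_inner M f g) \<le> L2_norm M f * L2_norm M g"
    using L2_Cauchy_Schwarz[OF f g] complex_Re_le_cmod order_trans by blast
  then show "(L2_norm M (\<lambda>x. f x + g x))\<^sup>2 \<le> (L2_norm M f + L2_norm M g)\<^sup>2"
    by (simp add: L2_norm_add_sq[OF f g] power2_sum)
qed simp

lemma L2_norm_triangle_diff:
  assumes "f \<in> L2 M" "g \<in> L2 M"
  shows "L2_norm M (\<lambda>x. f x - g x) \<le> L2_norm M f + L2_norm M g"
  using L2_norm_triangle[OF assms(1) L2_cmult[OF assms(2), of "-1"]]
  by (simp only: L2_norm_cmult) simp

lemma L2_norm_triangle_mid:
  assumes "f \<in> L2 M" "g \<in> L2 M" "h \<in> L2 M"
  shows "L2_norm M (\<lambda>x. f x - h x) \<le> L2_norm M (\<lambda>x. f x - g x) + L2_norm M (\<lambda>x. g x - h x)"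
  using L2_norm_triangle[OF L2_diff[OF assms(1,2)] L2_diff[OF assms(2,3)]] by simp

lemma L2_norm_le_add:
  assumes "f \<in> L2 M" "g \<in> L2 M"
  shows "L2_norm M f \<le> L2_norm M g + L2_norm M (\<lambda>x. f x - g x)"
  using L2_norm_triangle[OF assms(2) L2_diff[OF assms]] by simp

lemma L2_norm_sum_le:
  "(\<And>i. i \<in> I \<Longrightarrow> f i \<in> L2 M) \<Longrightarrow> L2_norm M (\<lambda>x. \<Sum>i\<in>I. f i x) \<le> (\<Sum>i\<in>I. L2_norm M (f i))"
proof (induction I rule: infinite_finite_induct)
  case (insert i I)
  then show ?case using L2_norm_triangle[of "f i" M "\<lambda>x. \<Sum>i\<in>I. f i x"]
    by (simp add: L2_sum)
qed auto

lemma L2_norm_sum_orthogonal: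
  assumes "finite I" "\<And>i. i \<in> I \<Longrightarrow> f i \<in> L2 M"
    and "\<And>i j. i \<in> I \<Longrightarrow> j \<in> I \<Longrightarrow> i \<noteq> j \<Longrightarrow> L2_inner M (f i) (f j) = 0"
  shows "(L2_norm M (\<lambda>x. \<Sum>i\<in>I. f i x))\<^sup>2 = (\<Sum>i\<in>I. (L2_norm M (f i))\<^sup>2)"
  using assms
proof (induction I)
  case (insert i I)
  have "L2_inner M (f i) (\<lambda>x. \<Sum>i\<in>I. f i x) = 0"
    using insert by (subst L2_inner_sum_right) (auto intro!: sum.neutral)
  then show ?case using insert by (simp add: L2_norm_add_sq L2_sum)
qed simp

lemma L2_norm_AE_cong:
  assumes "AE x in M. f x = g x" "f \<in> borel_measurable M" "g \<in> borel_measurable M"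
  shows "L2_norm M f = L2_norm M g"
  unfolding L2_norm_def
  by (rule arg_cong[where f = sqrt], rule integral_cong_AE) (use assms in auto)

lemma L2_norm_eq_0_AE:
  assumes "f \<in> L2 M" "L2_norm M f = 0" shows "AE x in M. f x = 0"
proof -
  have "(\<integral>x. (cmod (f x))\<^sup>2 \<partial>M) = 0" using assms(2) by (simp add: L2_norm_def)
  then have "AE x in M. (cmod (f x))\<^sup>2 = 0"
    using integral_nonneg_eq_0_iff_AE[OF L2_integrable_norm[OF assms(1)]] by simp
  then show ?thesis by simp
qed

lemma L2_norm_nn:
  assumes "f \<in> L2 M" shows "(\<integral>\<^sup>+x. ennreal ((cmod (f x))\<^sup>2) \<partial>M) = ennreal ((L2_norm M f)\<^sup>2)"
  unfolding L2_norm_sq by (rule nn_integral_eq_integral[OF L2_integrable_norm[OF assms]]) simp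

lemma L2_norm_nn_le:
  assumes "f \<in> borel_measurable M" "(\<integral>\<^sup>+x. ennreal ((cmod (f x))\<^sup>2) \<partial>M) \<le> ennreal (B\<^sup>2)" "B \<ge> 0"
  shows "f \<in> L2 M" "L2_norm M f \<le> B"
proof -
  have "integrable M (\<lambda>x. (cmod (f x))\<^sup>2)"
    by (rule integrableI_bounded) (use assms in \<open>auto intro: le_less_trans\<close>)
  then show L: "f \<in> L2 M" using assms by (simp add: L2_def)
  have "(L2_norm M f)\<^sup>2 \<le> B\<^sup>2" using assms(2) by (simp add: L2_norm_nn[OF L])
  then show "L2_norm M f \<le> B" using assms(3) power2_le_imp_le by blast
qed

text \<open>Riesz-Fischer. A fast subsequence has increments with summable norms, so by monotone
  convergence it converges almost everywhere. Fatou's lemma then carries the Cauchy estimate over to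
  the pointwise limit.\<close>

theorem L2_complete:
  assumes F: "\<And>k. F k \<in> L2 M"
    and Cau: "\<And>e. e > 0 \<Longrightarrow> \<exists>N. \<forall>m\<ge>N. \<forall>n\<ge>N. L2_norm M (\<lambda>x. F m x - F n x) < e"
  shows "\<exists>g\<in>L2 M. (\<lambda>k. L2_norm M (\<lambda>x. F k x - g x)) \<longlonglongrightarrow> 0"
proof -
  have "\<forall>k. \<exists>N. \<forall>m\<ge>N. \<forall>n\<ge>N. L2_norm M (\<lambda>x. F m x - F n x) < (1/2)^k"
    using Cau by simp
  then obtain N where N: "\<And>k m n. m \<ge> N k \<Longrightarrow> n \<ge> N k \<Longrightarrow> L2_norm M (\<lambda>x. F m x - F n x) < (1/2)^k"
    by metis
  \<comment> \<open>The recursion forces both strict monotonicity and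
    \<open>r k \<ge> N k\<close>.\<close>
  define r where "r = rec_nat (N 0) (\<lambda>k m. max (Suc m) (N (Suc k)))"
  have r0: "r 0 = N 0" and rS: "r (Suc k) = max (Suc (r k)) (N (Suc k))" for k by (simp_all add: r_def)
  have sm: "strict_mono r" by (rule strict_monoI_Suc) (simp add: rS)
  have rN: "r k \<ge> N k" for k by (cases k) (simp_all add: r0 rS)
  define D where "D k x = cmod (F (r (Suc k)) x - F (r k) x)" for k x
  have DL: "(\<lambda>x. complex_of_real (D k x)) \<in> L2 M" for k
    using L2_diff[OF F[of "r (Suc k)"] F[of "r k"]] unfolding L2_def D_def by (auto)
  have Dn: "L2_norm M (\<lambda>x. complex_of_real (D k x)) \<le> (1/2)^k" for k
  proof -
    have "L2_norm M (\<lambda>x. complex_of_real (D k x)) = L2_norm M (\<lambda>x. F (r (Suc k)) x - F (r k) x)"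
      by (simp add: L2_norm_def D_def)
    also have "\<dots> \<le> (1/2)^k"
      by (rule less_imp_le, rule N) (use rN[of k] rS in auto)
    finally show ?thesis .
  qed
  have meas: "F k \<in> borel_measurable M" for k using F L2_measurable by blast
  have Dm: "D k \<in> borel_measurable M" for k unfolding D_def using meas by measurable
  \<comment> \<open>By Minkowski: the norms of the \<open>D k\<close> sum to at most 2, and 4 is its
    square.\<close>
  have part: "(\<integral>\<^sup>+x. ennreal ((\<Sum>k<n. D k x)\<^sup>2) \<partial>M) \<le> 4" for n
  proof -
    have L: "(\<lambda>x. \<Sum>k<n. complex_of_real (D k x)) \<in> L2 M" by (rule L2_sum) (rule DL)
    have "L2_norm M (\<lambda>x. \<Sum>k<n. complex_of_real (D k x)) \<le> (\<Sum>k<n. (1/2)^k)"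
      by (rule order_trans[OF L2_norm_sum_le]) (auto intro: DL sum_mono Dn)
    also have "\<dots> \<le> 2" by (simp add: sum_gp_strict)
    finally have "(L2_norm M (\<lambda>x. \<Sum>k<n. complex_of_real (D k x)))\<^sup>2 \<le> 2\<^sup>2"
      by (rule power_mono) simp
    then have "ennreal ((L2_norm M (\<lambda>x. \<Sum>k<n. complex_of_real (D k x)))\<^sup>2) \<le> ennreal 4"
      by (intro ennreal_leI) simp
    moreover have "(cmod (\<Sum>k<n. complex_of_real (D k x)))\<^sup>2 = (\<Sum>k<n. D k x)\<^sup>2" for x
      unfolding of_real_sum[symmetric] norm_of_real power2_abs ..
    ultimately show ?thesis using L2_norm_nn[OF L] by simp
  qed
  have mono: "incseq (\<lambda>n x. ennreal ((\<Sum>k<n. D k x)\<^sup>2))"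
    by (auto simp: incseq_def le_fun_def D_def intro!: ennreal_leI power_mono sum_mono2 sum_nonneg)
  have "(\<integral>\<^sup>+x. (SUP n. ennreal ((\<Sum>k<n. D k x)\<^sup>2)) \<partial>M) = (SUP n. \<integral>\<^sup>+x. ennreal ((\<Sum>k<n. D k x)\<^sup>2) \<partial>M)"
    by (rule nn_integral_monotone_convergence_SUP[OF mono]) (use Dm in measurable)
  also have "\<dots> \<le> 4" by (rule SUP_least) (rule part)
  finally have "(\<integral>\<^sup>+x. (SUP n. ennreal ((\<Sum>k<n. D k x)\<^sup>2)) \<partial>M) \<noteq> \<infinity>"
    by (auto simp: top_unique)
  then have "AE x in M. (SUP n. ennreal ((\<Sum>k<n. D k x)\<^sup>2)) \<noteq> \<infinity>"
    by (intro nn_integral_PInf_AE) (use Dm in measurable)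
  then have conv: "AE x in M. convergent (\<lambda>k. F (r k) x)"
  proof eventually_elim
    case (elim x)
    then obtain B where B: "B \<ge> 0" "(SUP n. ennreal ((\<Sum>k<n. D k x)\<^sup>2)) = ennreal B"
      by (cases "(SUP n. ennreal ((\<Sum>k<n. D k x)\<^sup>2))") auto
    have "(\<Sum>k<n. D k x) \<le> sqrt B" for n
    proof -
      have "ennreal ((\<Sum>k<n. D k x)\<^sup>2) \<le> ennreal B" unfolding B(2)[symmetric] by (rule SUP_upper) simp
      then have "(\<Sum>k<n. D k x)\<^sup>2 \<le> B" using B(1) by (simp)
      then show ?thesis using real_le_rsqrt by blast
    qed
    then have "summable (\<lambda>k. D k x)"
      by (intro summableI_nonneg_bounded[where x = "sqrt B"]) (auto simp: D_def)
    then have "summable (\<lambda>k. F (r (Suc k)) x - F (r k) x)"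
      unfolding D_def by (rule summable_norm_cancel)
    then have "convergent (\<lambda>n. \<Sum>k<n. F (r (Suc k)) x - F (r k) x)"
      by (simp add: summable_iff_convergent)
    then have "convergent (\<lambda>n. F (r n) x - F (r 0) x)"
      unfolding sum_lessThan_telescope[of "\<lambda>k. F (r k) x"] .
    from convergent_add[OF this convergent_const[of "F (r 0) x"]] show ?case by simp
  qed
  define g where "g x = lim (\<lambda>k. F (r k) x)" for x
  have gm: "g \<in> borel_measurable M" unfolding g_def using meas by (intro borel_measurable_lim_metric)
  have gl: "AE x in M. (\<lambda>k. F (r k) x) \<longlonglongrightarrow> g x"
    using conv unfolding g_def by (simp add: convergent_LIMSEQ_iff)
  \<comment> \<open>Square-integrability of the difference is part of the conclusion, because
    nothing is known about \<open>g\<close> yet beyond measurability.\<close>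
  have Fatou: "(\<lambda>x. F m x - g x) \<in> L2 M \<and> L2_norm M (\<lambda>x. F m x - g x) \<le> e"
    if e: "e > 0" and m: "\<And>n. n \<ge> N1 \<Longrightarrow> L2_norm M (\<lambda>x. F m x - F n x) \<le> e" for e m N1
  proof -
    have "(\<integral>\<^sup>+x. ennreal ((cmod (F m x - g x))\<^sup>2) \<partial>M)
        = (\<integral>\<^sup>+x. liminf (\<lambda>k. ennreal ((cmod (F m x - F (r k) x))\<^sup>2)) \<partial>M)"
    proof (rule nn_integral_cong_AE, use gl in eventually_elim)
      case (elim x)
      then have "(\<lambda>k. ennreal ((cmod (F m x - F (r k) x))\<^sup>2)) \<longlonglongrightarrow> ennreal ((cmod (F m x - g x))\<^sup>2)"
        by (intro tendsto_intros)
      then show ?case by (metis lim_imp_Liminf sequentially_bot)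
    qed
    also have "\<dots> \<le> liminf (\<lambda>k. \<integral>\<^sup>+x. ennreal ((cmod (F m x - F (r k) x))\<^sup>2) \<partial>M)"
      by (rule nn_integral_liminf) (use meas in measurable)
    also have "\<dots> \<le> ennreal (e\<^sup>2)"
    proof (rule Liminf_le)
      show "\<forall>\<^sub>F k in sequentially. (\<integral>\<^sup>+x. ennreal ((cmod (F m x - F (r k) x))\<^sup>2) \<partial>M) \<le> ennreal (e\<^sup>2)"
        using eventually_ge_at_top[of N1]
      proof eventually_elim
        case (elim k)
        then have "r k \<ge> N1" using seq_suble[OF sm, of k] by simp
        then show ?case unfolding L2_norm_nn[OF L2_diff[OF F F]]
          by (intro ennreal_leI power_mono m) auto
      qed
    qed simp
    finally show ?thesis using L2_norm_nn_le[of "\<lambda>x. F m x - g x" M e] e gm meas by auto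
  qed
  have lim: "\<exists>N1. \<forall>m\<ge>N1. (\<lambda>x. F m x - g x) \<in> L2 M \<and> L2_norm M (\<lambda>x. F m x - g x) \<le> e" if e: "e > 0" for e
  proof -
    obtain N1 where "\<forall>m\<ge>N1. \<forall>n\<ge>N1. L2_norm M (\<lambda>x. F m x - F n x) < e" using Cau[OF e] by blast
    then show ?thesis using Fatou[OF e, of N1] by (meson less_imp_le)
  qed
  obtain N1 where "(\<lambda>x. F N1 x - g x) \<in> L2 M" using lim[of 1] by auto
  from L2_diff[OF F[of N1] this] have "g \<in> L2 M" by simp
  moreover have "(\<lambda>k. L2_norm M (\<lambda>x. F k x - g x)) \<longlonglongrightarrow> 0"
  proof (rule LIMSEQ_I)
    fix e :: real assume "e > 0"
    then obtain N1 where "\<forall>m\<ge>N1. L2_norm M (\<lambda>x. F m x - g x) \<le> e/2" using lim[of "e/2"] by auto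
    then show "\<exists>no. \<forall>n\<ge>no. norm (L2_norm M (\<lambda>x. F n x - g x) - 0) < e"
      using \<open>e > 0\<close> by (intro exI[of _ N1]) fastforce
  qed
  ultimately show ?thesis by blast
qed

section \<open>Projections and compactness\<close>

text \<open>\<open>closed\<close> is stated by approximation, which suits a space defined as a
  closure. It also makes \<open>H\<close> stable under measurable changes on null sets, as such a
  change has norm 0.\<close>

locale L2_closed_subspace =
  fixes M :: "'a measure" and H :: "('a \<Rightarrow> complex) set"
  assumes subset_L2: "f \<in> H \<Longrightarrow> f \<in> L2 M"
    and zero_mem: "(\<lambda>x. 0) \<in> H"
    and add_mem: "f \<in> H \<Longrightarrow> g \<in> H \<Longrightarrow> (\<lambda>x. f x + g x) \<in> H"
    and cmult_mem: "f \<in> H \<Longrightarrow> (\<lambda>x. c * f x) \<in> H"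
    and closed: "f \<in> L2 M \<Longrightarrow> (\<And>e. e > 0 \<Longrightarrow> \<exists>h\<in>H. L2_norm M (\<lambda>x. f x - h x) < e) \<Longrightarrow> f \<in> H"
begin

lemma diff_mem: "f \<in> H \<Longrightarrow> g \<in> H \<Longrightarrow> (\<lambda>x. f x - g x) \<in> H"
  using add_mem[OF _ cmult_mem[of g "-1"], of f] by simp

lemma lincomb_mem: "f \<in> H \<Longrightarrow> g \<in> H \<Longrightarrow> (\<lambda>x. a * f x + b * g x) \<in> H"
  by (intro add_mem cmult_mem)

lemma limit_mem:
  assumes "\<And>k. F k \<in> H" "g \<in> L2 M" "(\<lambda>k. L2_norm M (\<lambda>x. F k x - g x)) \<longlonglongrightarrow> 0"
  shows "g \<in> H"
proof (rule closed[OF assms(2)])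
  fix e :: real assume "e > 0"
  then obtain k where "norm (L2_norm M (\<lambda>x. F k x - g x) - 0) < e"
    using LIMSEQ_D[OF assms(3)] by blast
  then show "\<exists>h\<in>H. L2_norm M (\<lambda>x. g x - h x) < e"
    using assms(1) by (intro bexI[of _ "F k"]) (simp add: L2_norm_minus_commute)
qed

text \<open>A minimizing sequence for the squared distance is Cauchy by the parallelogram law,
  because midpoints stay in \<open>H\<close>. The residual of the minimizer is orthogonal to
  \<open>H\<close>, as otherwise a short step in \<open>H\<close> would reduce the distance.\<close>

lemma projection_exists:
  assumes f: "f \<in> L2 M"
  shows "\<exists>g\<in>H. \<forall>h\<in>H. L2_inner M (\<lambda>x. f x - g x) h = 0"
proof -
  define D where "D h = (L2_norm M (\<lambda>x. f x - h x))\<^sup>2" for h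
  define d where "d = (INF h\<in>H. D h)"
  have bdd: "bdd_below (D ` H)" by (rule bdd_belowI[of _ 0]) (auto simp: D_def)
  have d_le: "d \<le> D h" if "h \<in> H" for h
    unfolding d_def by (rule cINF_lower[OF bdd that])
  have "\<exists>h\<in>H. D h < d + 1 / real (Suc k)" for k
    using cINF_less_iff[of H D "d + 1 / real (Suc k)"] bdd zero_mem unfolding d_def by auto
  then obtain h where h: "\<And>k. h k \<in> H" "\<And>k. D (h k) < d + 1 / real (Suc k)" by metis
  have par: "(L2_norm M (\<lambda>x. h m x - h n x))\<^sup>2 \<le> 2 * (1 / real (Suc m)) + 2 * (1 / real (Suc n))" for m n
  proof -
    define u where "u = (\<lambda>x. f x - h m x)"
    define v where "v = (\<lambda>x. f x - h n x)"
    have uv: "u \<in> L2 M" "v \<in> L2 M" unfolding u_def v_def using f h subset_L2 by (auto intro: L2_diff)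
    have "(\<lambda>x. (1/2) * h m x + (1/2) * h n x) \<in> H" by (intro lincomb_mem h)
    then have "d \<le> D (\<lambda>x. (1/2) * h m x + (1/2) * h n x)" by (rule d_le)
    also have "\<dots> = (L2_norm M (\<lambda>x. (1/2) * (u x + v x)))\<^sup>2"
      unfolding D_def u_def v_def by (simp add: field_simps)
    also have "\<dots> = (1/4) * (L2_norm M (\<lambda>x. u x + v x))\<^sup>2"
      unfolding L2_norm_cmult by (simp add: power_mult_distrib power2_eq_square)
    finally have s: "4 * d \<le> (L2_norm M (\<lambda>x. u x + v x))\<^sup>2" by simp
    have "(L2_norm M (\<lambda>x. h m x - h n x)) = L2_norm M (\<lambda>x. u x - v x)"
      by (subst L2_norm_minus_commute) (simp add: u_def v_def)
    then have "(L2_norm M (\<lambda>x. h m x - h n x))\<^sup>2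
        = 2 * D (h m) + 2 * D (h n) - (L2_norm M (\<lambda>x. u x + v x))\<^sup>2"
      by (simp add: L2_norm_add_sq[OF uv] L2_norm_diff_sq[OF uv] D_def u_def[symmetric] v_def[symmetric])
    then show ?thesis using s h(2)[of m] h(2)[of n] by linarith
  qed
  have "\<exists>g\<in>L2 M. (\<lambda>k. L2_norm M (\<lambda>x. h k x - g x)) \<longlonglongrightarrow> 0"
  proof (rule L2_complete)
    fix e :: real assume e: "e > 0"
    obtain N where N: "4 / e\<^sup>2 < real (Suc N)"
      using reals_Archimedean2[of "4 / e\<^sup>2"] by (metis less_trans of_nat_less_iff lessI)
    have "L2_norm M (\<lambda>x. h m x - h n x) < e" if "m \<ge> N" "n \<ge> N" for m n
    proof -
      have "1 / real (Suc m) \<le> 1 / real (Suc N)" "1 / real (Suc n) \<le> 1 / real (Suc N)"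
        using that by (auto intro!: divide_left_mono)
      then have "(L2_norm M (\<lambda>x. h m x - h n x))\<^sup>2 \<le> 4 / real (Suc N)" using par[of m n] by simp
      also have "\<dots> < e\<^sup>2" using N e by (simp add: field_simps)
      finally show ?thesis using e by (simp add: power_less_imp_less_base)
    qed
    then show "\<exists>N. \<forall>m\<ge>N. \<forall>n\<ge>N. L2_norm M (\<lambda>x. h m x - h n x) < e" by blast
  qed (use h subset_L2 in auto)
  then obtain g where g: "g \<in> L2 M" "(\<lambda>k. L2_norm M (\<lambda>x. h k x - g x)) \<longlonglongrightarrow> 0" by blast
  have gH: "g \<in> H" by (rule limit_mem[OF _ g]) (rule h)
  have "(\<lambda>k. (sqrt (d + 1 / real (Suc k)) + L2_norm M (\<lambda>x. h k x - g x))) \<longlonglongrightarrow> sqrt (d + 0) + 0"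
    by (intro tendsto_intros g(2) LIMSEQ_Suc[OF lim_1_over_n])
  moreover have "L2_norm M (\<lambda>x. f x - g x) \<le> sqrt (d + 1 / real (Suc k)) + L2_norm M (\<lambda>x. h k x - g x)" for k
  proof -
    have "L2_norm M (\<lambda>x. f x - g x) \<le> L2_norm M (\<lambda>x. f x - h k x) + L2_norm M (\<lambda>x. h k x - g x)"
      using f g h subset_L2 by (intro L2_norm_triangle_mid) auto
    moreover have "L2_norm M (\<lambda>x. f x - h k x) \<le> sqrt (d + 1 / real (Suc k))"
      using h(2)[of k] by (intro real_le_rsqrt) (simp add: D_def)
    ultimately show ?thesis by simp
  qed
  ultimately have "L2_norm M (\<lambda>x. f x - g x) \<le> sqrt d"
    by (intro LIMSEQ_le_const[where X = "\<lambda>k. sqrt (d + 1 / real (Suc k)) + L2_norm M (\<lambda>x. h k x - g x)"]) auto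
  moreover have "d \<ge> 0" unfolding d_def using zero_mem by (intro cINF_greatest) (auto simp: D_def)
  ultimately have Dg: "D g \<le> d" unfolding D_def by (metis L2_norm_nonneg power_mono real_sqrt_pow2)
  have "L2_inner M (\<lambda>x. f x - g x) k = 0" if k: "k \<in> H" for k
  proof -
    define u where "u = (\<lambda>x. f x - g x)"
    have uL: "u \<in> L2 M" unfolding u_def by (rule L2_diff[OF f g(1)])
    define c where "c = L2_inner M u k"
    define b where "b = (L2_norm M k)\<^sup>2"
    \<comment> \<open>A step length with \<open>s * b \<le> 1\<close>: the quadratic term of the
      perturbation is then at most half of the linear gain.\<close>
    define s where "s = 1 / (1 + b)"
    have b: "b \<ge> 0" by (simp add: b_def)
    have "d \<le> D (\<lambda>x. g x + (of_real s * c) * k x)"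
      by (intro d_le add_mem gH cmult_mem k)
    also have "\<dots> = (L2_norm M (\<lambda>x. u x - (of_real s * c) * k x))\<^sup>2"
      by (simp add: D_def u_def algebra_simps)
    also have "\<dots> = D g - 2 * Re (cnj (of_real s * c) * c) + (cmod (of_real s * c) * L2_norm M k)\<^sup>2"
      unfolding D_def c_def u_def[symmetric]
      by (subst L2_norm_diff_sq[OF uL L2_cmult[OF subset_L2[OF k]]])
         (simp only: L2_norm_cmult L2_inner_cmult_right)
    also have "Re (cnj (of_real s * c) * c) = s * (cmod c)\<^sup>2"
      by (simp add: cmod_power2) (simp add: power2_eq_square algebra_simps)
    also have "(cmod (of_real s * c) * L2_norm M k)\<^sup>2 = s\<^sup>2 * (cmod c)\<^sup>2 * b"
      by (simp add: b_def norm_mult power_mult_distrib)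
    finally have "2 * (s * (cmod c)\<^sup>2) \<le> s\<^sup>2 * (cmod c)\<^sup>2 * b" using Dg by linarith
    also have "s\<^sup>2 * (cmod c)\<^sup>2 * b = (s * (cmod c)\<^sup>2) * (s * b)" by (simp add: power2_eq_square)
    also have "\<dots> \<le> (s * (cmod c)\<^sup>2) * 1"
      using b by (intro mult_left_mono) (auto simp: s_def)
    finally have "s * (cmod c)\<^sup>2 \<le> 0" by simp
    moreover have "s > 0" using b by (simp add: s_def)
    ultimately have "(cmod c)\<^sup>2 \<le> 0" by (simp add: mult_le_0_iff)
    then show ?thesis by (simp add: c_def u_def)
  qed
  then show ?thesis using gH by blast
qed

abbreviation P where "P \<equiv> L2_proj M H"

lemma proj_mem: "f \<in> L2 M \<Longrightarrow> P f \<in> H"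
  and proj_orth: "f \<in> L2 M \<Longrightarrow> h \<in> H \<Longrightarrow> L2_inner M (\<lambda>x. f x - P f x) h = 0"
  using someI_ex[of "\<lambda>g. g \<in> H \<and> (\<forall>h\<in>H. L2_inner M (\<lambda>x. f x - g x) h = 0)"] projection_exists[of f]
  unfolding L2_proj_def[symmetric] by blast+

lemma proj_L2: "f \<in> L2 M \<Longrightarrow> P f \<in> L2 M"
  using proj_mem subset_L2 by blast

lemma proj_inner: "f \<in> L2 M \<Longrightarrow> h \<in> H \<Longrightarrow> L2_inner M (P f) h = L2_inner M f h"
  using proj_orth[of f h] L2_inner_diff_left[of f M "P f" h] by (simp add: proj_L2 subset_L2)

text \<open>\<open>L2_proj\<close> chooses a representative, so uniqueness can only say that the
  difference has norm 0.\<close>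

lemma proj_unique:
  assumes f: "f \<in> L2 M" and u: "u \<in> H" and "\<And>h. h \<in> H \<Longrightarrow> L2_inner M u h = L2_inner M f h"
  shows "L2_norm M (\<lambda>x. u x - P f x) = 0"
proof -
  have d: "(\<lambda>x. u x - P f x) \<in> H" using u proj_mem[OF f] by (rule diff_mem)
  have "L2_inner M (\<lambda>x. u x - P f x) (\<lambda>x. u x - P f x) = 0"
    using assms(3)[OF d] proj_inner[OF f d] subset_L2[OF u] proj_L2[OF f] subset_L2[OF d]
    by (subst L2_inner_diff_left) auto
  then show ?thesis by (simp add: L2_inner_self)
qed

text \<open>Pythagoras. All later bounds on \<open>(I - P) u\<close> rest on this: any convenient
  element of \<open>H\<close> may stand in for the projection.\<close>

lemma proj_best:
  assumes f: "f \<in> L2 M" and h: "h \<in> H"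
  shows "L2_norm M (\<lambda>x. f x - P f x) \<le> L2_norm M (\<lambda>x. f x - h x)"
proof (rule power2_le_imp_le)
  have d: "(\<lambda>x. P f x - h x) \<in> H" using proj_mem[OF f] h by (rule diff_mem)
  have "(L2_norm M (\<lambda>x. (f x - P f x) + (P f x - h x)))\<^sup>2
      = (L2_norm M (\<lambda>x. f x - P f x))\<^sup>2 + (L2_norm M (\<lambda>x. P f x - h x))\<^sup>2"
    using proj_orth[OF f d] by (subst L2_norm_add_sq) (auto intro: L2_diff f proj_L2 subset_L2 h)
  then show "(L2_norm M (\<lambda>x. f x - P f x))\<^sup>2 \<le> (L2_norm M (\<lambda>x. f x - h x))\<^sup>2" by simp
qed simp

lemma proj_norm_le:
  assumes f: "f \<in> L2 M" shows "L2_norm M (P f) \<le> L2_norm M f"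
proof (rule power2_le_imp_le)
  have "(L2_norm M (\<lambda>x. (f x - P f x) + P f x))\<^sup>2
      = (L2_norm M (\<lambda>x. f x - P f x))\<^sup>2 + (L2_norm M (P f))\<^sup>2"
    using proj_orth[OF f proj_mem[OF f]] by (subst L2_norm_add_sq) (auto intro: L2_diff f proj_L2)
  then show "(L2_norm M (P f))\<^sup>2 \<le> (L2_norm M f)\<^sup>2" by simp
qed simp

lemma proj_lincomb:
  assumes f: "f \<in> L2 M" and g: "g \<in> L2 M"
  shows "L2_norm M (\<lambda>x. (a * P f x + b * P g x) - P (\<lambda>x. a * f x + b * g x) x) = 0"
proof (rule proj_unique)
  show "L2_inner M (\<lambda>x. a * P f x + b * P g x) h = L2_inner M (\<lambda>x. a * f x + b * g x) h" if "h \<in> H" for h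
    using that f g
    by (simp add: L2_inner_add_left L2_inner_cmult_left L2_cmult proj_L2 subset_L2 proj_inner)
qed (use f g in \<open>auto intro!: L2_add L2_cmult lincomb_mem proj_mem\<close>)

lemma proj_AE_lincomb:
  assumes f: "f \<in> L2 M" and g: "g \<in> L2 M"
  shows "AE x in M. P (\<lambda>x. a * f x + b * g x) x = a * P f x + b * P g x"
proof -
  have "AE x in M. (a * P f x + b * P g x) - P (\<lambda>x. a * f x + b * g x) x = 0"
    by (rule L2_norm_eq_0_AE[OF _ proj_lincomb[OF f g]])
       (use f g in \<open>auto intro!: L2_diff L2_add L2_cmult proj_L2\<close>)
  then show ?thesis by eventually_elim simp
qed

lemma proj_diff_norm_le:
  assumes f: "f \<in> L2 M" and g: "g \<in> L2 M"
  shows "L2_norm M (\<lambda>x. P f x - P g x) \<le> L2_norm M (\<lambda>x. f x - g x)"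
proof -
  have "L2_norm M (\<lambda>x. P f x - P g x) = L2_norm M (P (\<lambda>x. f x - g x))"
    using proj_AE_lincomb[OF f g, of 1 "-1"] f g
    by (intro L2_norm_AE_cong) (auto intro!: L2_measurable L2_diff proj_L2)
  also have "\<dots> \<le> L2_norm M (\<lambda>x. f x - g x)" by (intro proj_norm_le L2_diff f g)
  finally show ?thesis .
qed

text \<open>
  Compactness of an operator \<open>T\<close> is expressed through the seminorm \<open>f \<mapsto> \<parallel>T f\<parallel>\<close>: up to an
  arbitrarily small multiple of \<open>\<parallel>f\<parallel>\<close> it is controlled by finitely many functionals.
  In this form all permanence properties become inequalities.
\<close>

definition compact_seminorm :: "(('a \<Rightarrow> complex) \<Rightarrow> real) \<Rightarrow> bool" where
  "compact_seminorm N \<longleftrightarrow> (\<forall>e>0. \<exists>gs. set gs \<subseteq> L2 M \<and>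
     (\<forall>f\<in>H. N f \<le> e * L2_norm M f + (\<Sum>g\<leftarrow>gs. cmod (L2_inner M f g))))"

lemma compact_seminorm_mono:
  "compact_seminorm N \<Longrightarrow> (\<And>f. f \<in> H \<Longrightarrow> N' f \<le> N f) \<Longrightarrow> compact_seminorm N'"
  unfolding compact_seminorm_def by (meson order_trans)

lemma compact_seminorm_zero: "compact_seminorm (\<lambda>f. 0)"
  unfolding compact_seminorm_def by (auto intro!: exI[of _ "[]"])

lemma compact_seminorm_add:
  assumes "compact_seminorm N" "compact_seminorm N'" shows "compact_seminorm (\<lambda>f. N f + N' f)"
  unfolding compact_seminorm_def
proof (intro allI impI)
  fix e :: real assume "e > 0"
  then have "e / 2 > 0" by simp
  then obtain gs gs' where
    "set gs \<subseteq> L2 M" "\<forall>f\<in>H. N f \<le> e/2 * L2_norm M f + (\<Sum>g\<leftarrow>gs. cmod (L2_inner M f g))"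
    "set gs' \<subseteq> L2 M" "\<forall>f\<in>H. N' f \<le> e/2 * L2_norm M f + (\<Sum>g\<leftarrow>gs'. cmod (L2_inner M f g))"
    using assms unfolding compact_seminorm_def by meson
  then show "\<exists>gs. set gs \<subseteq> L2 M \<and>
     (\<forall>f\<in>H. N f + N' f \<le> e * L2_norm M f + (\<Sum>g\<leftarrow>gs. cmod (L2_inner M f g)))"
    by (intro exI[of _ "gs @ gs'"]) force
qed

lemma compact_seminorm_cmult:
  assumes "compact_seminorm N" "c \<ge> 0" shows "compact_seminorm (\<lambda>f. c * N f)"
  unfolding compact_seminorm_def
proof (intro allI impI)
  fix e :: real assume "e > 0"
  then have "e / (c + 1) > 0" using assms(2) by simp
  then obtain gs where gs: "set gs \<subseteq> L2 M"
    "\<And>f. f\<in>H \<Longrightarrow> N f \<le> e / (c + 1) * L2_norm M f + (\<Sum>g\<leftarrow>gs. cmod (L2_inner M f g))"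
    using assms(1) unfolding compact_seminorm_def by meson
  define gs' where "gs' = map (\<lambda>g x. of_real c * g x) gs"
  have "c * N f \<le> e * L2_norm M f + (\<Sum>g\<leftarrow>gs'. cmod (L2_inner M f g))" if "f \<in> H" for f
  proof -
    have "(\<Sum>g\<leftarrow>gs'. cmod (L2_inner M f g)) = c * (\<Sum>g\<leftarrow>gs. cmod (L2_inner M f g))"
      using assms(2) by (simp add: gs'_def o_def L2_inner_cmult_right norm_mult sum_list_const_mult)
    moreover have "c * N f \<le> c * (e / (c + 1) * L2_norm M f) + c * (\<Sum>g\<leftarrow>gs. cmod (L2_inner M f g))"
      unfolding distrib_left[symmetric] by (rule mult_left_mono[OF gs(2)[OF that] assms(2)])
    moreover have "c * (e / (c + 1) * L2_norm M f) \<le> e * L2_norm M f"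
    proof -
      have "c * (e / (c + 1)) \<le> e" using \<open>e > 0\<close> assms(2) by (simp add: field_simps)
      then have "c * (e / (c + 1)) * L2_norm M f \<le> e * L2_norm M f" by (rule mult_right_mono) simp
      then show ?thesis by (simp add: mult.assoc)
    qed
    ultimately show ?thesis by linarith
  qed
  moreover have "set gs' \<subseteq> L2 M" using gs(1) by (auto simp: gs'_def intro: L2_cmult)
  ultimately show "\<exists>gs. set gs \<subseteq> L2 M \<and>
     (\<forall>f\<in>H. c * N f \<le> e * L2_norm M f + (\<Sum>g\<leftarrow>gs. cmod (L2_inner M f g)))" by blast
qed

text \<open>The counterpart of the fact that compact operators are closed in operator norm.\<close>

lemma compact_seminorm_limit:
  assumes "\<And>e. e > 0 \<Longrightarrow> \<exists>N'. compact_seminorm N' \<and> (\<forall>f\<in>H. N f \<le> N' f + e * L2_norm M f)"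
  shows "compact_seminorm N"
  unfolding compact_seminorm_def
proof (intro allI impI)
  fix e :: real assume "e > 0"
  then have e2: "e / 2 > 0" by simp
  obtain N' where N': "compact_seminorm N'" "\<forall>f\<in>H. N f \<le> N' f + e / 2 * L2_norm M f"
    using assms[OF e2] by blast
  then obtain gs where
    "set gs \<subseteq> L2 M" "\<forall>f\<in>H. N' f \<le> e/2 * L2_norm M f + (\<Sum>g\<leftarrow>gs. cmod (L2_inner M f g))"
    using e2 unfolding compact_seminorm_def by meson
  with N'(2) show "\<exists>gs. set gs \<subseteq> L2 M \<and>
     (\<forall>f\<in>H. N f \<le> e * L2_norm M f + (\<Sum>g\<leftarrow>gs. cmod (L2_inner M f g)))"
    by (intro exI[of _ gs]) force
qed

text \<open>Composition with a bounded operator. The test functionals are pulled back along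
  \<open>A\<close>, and \<open>adj\<close> guarantees that they are again inner products with
  square-integrable functions.\<close>

lemma compact_seminorm_comp:
  assumes N: "compact_seminorm N" and A: "\<And>f. f \<in> H \<Longrightarrow> A f \<in> H"
    and bd: "\<And>f. f \<in> H \<Longrightarrow> L2_norm M (A f) \<le> B * L2_norm M f"
    and adj: "\<And>g. g \<in> L2 M \<Longrightarrow> \<exists>g'\<in>L2 M. \<forall>f\<in>H. L2_inner M (A f) g = L2_inner M f g'"
  shows "compact_seminorm (\<lambda>f. N (A f))"
  unfolding compact_seminorm_def
proof (intro allI impI)
  fix e :: real assume "e > 0"
  then have "e / (\<bar>B\<bar> + 1) > 0" by simp
  then obtain gs where gs: "set gs \<subseteq> L2 M"
    "\<And>f. f\<in>H \<Longrightarrow> N f \<le> e / (\<bar>B\<bar> + 1) * L2_norm M f + (\<Sum>g\<leftarrow>gs. cmod (L2_inner M f g))"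
    using N unfolding compact_seminorm_def by meson
  obtain a where a: "\<And>g. g \<in> L2 M \<Longrightarrow> a g \<in> L2 M"
    "\<And>g f. g \<in> L2 M \<Longrightarrow> f \<in> H \<Longrightarrow> L2_inner M (A f) g = L2_inner M f (a g)"
    using adj by metis
  have "N (A f) \<le> e * L2_norm M f + (\<Sum>g\<leftarrow>map a gs. cmod (L2_inner M f g))" if f: "f \<in> H" for f
  proof -
    have "(\<Sum>g\<leftarrow>map a gs. cmod (L2_inner M f g)) = (\<Sum>g\<leftarrow>gs. cmod (L2_inner M (A f) g))"
      unfolding map_map o_def using gs(1) a(2)[OF _ f]
      by (intro arg_cong[where f = sum_list] map_cong) auto
    moreover have "N (A f) \<le> e / (\<bar>B\<bar> + 1) * L2_norm M (A f) + (\<Sum>g\<leftarrow>gs. cmod (L2_inner M (A f) g))"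
      by (rule gs(2)[OF A[OF f]])
    moreover have "e / (\<bar>B\<bar> + 1) * L2_norm M (A f) \<le> e * L2_norm M f"
    proof -
      have "L2_norm M (A f) \<le> (\<bar>B\<bar> + 1) * L2_norm M f"
        using bd[OF f] by (rule order_trans) (auto intro!: mult_right_mono)
      then have "e / (\<bar>B\<bar> + 1) * L2_norm M (A f) \<le> e / (\<bar>B\<bar> + 1) * ((\<bar>B\<bar> + 1) * L2_norm M f)"
        using \<open>e > 0\<close> by (intro mult_left_mono) auto
      also have "e / (\<bar>B\<bar> + 1) * ((\<bar>B\<bar> + 1) * L2_norm M f) = e / (\<bar>B\<bar> + 1) * (\<bar>B\<bar> + 1) * L2_norm M f"
        by (rule mult.assoc[symmetric])
      also have "e / (\<bar>B\<bar> + 1) * (\<bar>B\<bar> + 1) = e"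
        by (rule nonzero_divide_eq_eq[THEN iffD1, OF _ refl, symmetric]) linarith
      finally show ?thesis .
    qed
    ultimately show ?thesis by linarith
  qed
  then show "\<exists>gs. set gs \<subseteq> L2 M \<and>
     (\<forall>f\<in>H. N (A f) \<le> e * L2_norm M f + (\<Sum>g\<leftarrow>gs. cmod (L2_inner M f g)))"
    using gs(1) a(1) by (intro exI[of _ "map a gs"]) auto
qed

text \<open>Diagonal argument: only countably many test functions occur for the tolerances
  \<open>1 / Suc m\<close>. Along a subsequence all their inner products converge, so the seminorm
  bound makes the images Cauchy.\<close>

lemma compact_operatorI:
  assumes T: "bounded_operator_on M H T" and N: "compact_seminorm (\<lambda>f. L2_norm M (T f))"
  shows "compact_operator_on M H T"
  unfolding compact_operator_on_def
proof (intro conjI T allI impI)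
  fix F :: "nat \<Rightarrow> 'a \<Rightarrow> complex"
  assume "(\<forall>k. F k \<in> H) \<and> (\<exists>C. \<forall>k. L2_norm M (F k) \<le> C)"
  then obtain C where F: "\<And>k. F k \<in> H" and C: "\<And>k. L2_norm M (F k) \<le> C" by blast
  have TH: "\<And>f. f \<in> H \<Longrightarrow> T f \<in> H"
    and lin: "\<And>f g a b. f \<in> H \<Longrightarrow> g \<in> H \<Longrightarrow> AE x in M. T (\<lambda>y. a * f y + b * g y) x = a * T f x + b * T g x"
    using T unfolding bounded_operator_on_def by blast+
  have Cpos: "C \<ge> 0" using C[of 0] L2_norm_nonneg order_trans by blast
  have "\<forall>m. \<exists>gs. set gs \<subseteq> L2 M \<and>
     (\<forall>f\<in>H. L2_norm M (T f) \<le> 1 / real (Suc m) * L2_norm M f + (\<Sum>g\<leftarrow>gs. cmod (L2_inner M f g)))"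
  proof
    fix m show "\<exists>gs. set gs \<subseteq> L2 M \<and>
     (\<forall>f\<in>H. L2_norm M (T f) \<le> 1 / real (Suc m) * L2_norm M f + (\<Sum>g\<leftarrow>gs. cmod (L2_inner M f g)))"
      by (rule N[unfolded compact_seminorm_def, THEN spec, THEN mp]) simp
  qed
  then obtain gs where gs: "\<And>m. set (gs m) \<subseteq> L2 M"
    "\<And>m f. f \<in> H \<Longrightarrow> L2_norm M (T f) \<le> 1 / real (Suc m) * L2_norm M f + (\<Sum>g\<leftarrow>gs m. cmod (L2_inner M f g))"
    by metis
  define G where "G = (\<Union>m. set (gs m))"
  have cG: "countable G" unfolding G_def by (intro countable_UN) (auto intro: countable_finite)
  have GL: "g \<in> L2 M" if "g \<in> G" for g using that gs(1) by (auto simp: G_def)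
  \<comment> \<open>The diagonal extraction wants one bound for all \<open>g\<close>; dividing by
    the norm gives it, and adding 1 avoids division by zero.\<close>
  define w where "w k g = L2_inner M (F k) g / of_real (L2_norm M g + 1)" for k g
  have wb: "norm (w k g) \<le> C" if "g \<in> G" for k g
  proof -
    have "cmod (L2_inner M (F k) g) \<le> L2_norm M (F k) * L2_norm M g"
      by (intro L2_Cauchy_Schwarz subset_L2 F GL that)
    also have "\<dots> \<le> C * (L2_norm M g + 1)" by (intro mult_mono C Cpos) auto
    finally have "cmod (L2_inner M (F k) g) \<le> C * (L2_norm M g + 1)" .
    moreover have "L2_norm M g + 1 > 0" by (simp add: add_nonneg_pos)
    moreover have "norm (w k g) = cmod (L2_inner M (F k) g) / (L2_norm M g + 1)"
      unfolding w_def norm_divide norm_of_real by simp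
    ultimately show ?thesis by (simp add: pos_divide_le_eq)
  qed
  have "\<exists>r :: nat \<Rightarrow> nat. strict_mono r \<and> (\<forall>g\<in>G. \<exists>l. (\<lambda>k. w (r k) g) \<longlonglongrightarrow> l)"
  proof (rule function_convergent_subsequence[of G w C])
    show "countable G" by (rule cG)
    show "norm (w k g) \<le> C" if "g \<in> G" for k g by (rule wb[OF that])
    show "\<exists>r :: nat \<Rightarrow> nat. strict_mono r \<and> (\<forall>g\<in>G. \<exists>l. (\<lambda>k. w (r k) g) \<longlonglongrightarrow> l)"
      if "strict_mono r" "\<And>g. g \<in> G \<Longrightarrow> \<exists>l. (\<lambda>k. w (r k) g) \<longlonglongrightarrow> l" for r :: "nat \<Rightarrow> nat"
      using that by blast
  qed
  then obtain r where r: "strict_mono (r :: nat \<Rightarrow> nat)"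
    and wl: "\<And>g. g \<in> G \<Longrightarrow> \<exists>l. (\<lambda>k. w (r k) g) \<longlonglongrightarrow> l"
    by blast
  have conv: "Cauchy (\<lambda>k. L2_inner M (F (r k)) g)" if g: "g \<in> G" for g
  proof -
    obtain l where "(\<lambda>k. w (r k) g) \<longlonglongrightarrow> l" using wl[OF g] by blast
    then have "(\<lambda>k. w (r k) g * of_real (L2_norm M g + 1)) \<longlonglongrightarrow> l * of_real (L2_norm M g + 1)"
      by (intro tendsto_intros)
    moreover have "w k g * of_real (L2_norm M g + 1) = L2_inner M (F k) g" for k
    proof -
      have "L2_norm M g + 1 \<noteq> 0" using L2_norm_nonneg[of M g] by linarith
      then have "complex_of_real (L2_norm M g + 1) \<noteq> 0" unfolding of_real_eq_0_iff .
      then show ?thesis unfolding w_def by (metis nonzero_eq_divide_eq)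
    qed
    ultimately have "(\<lambda>k. L2_inner M (F (r k)) g) \<longlonglongrightarrow> l * of_real (L2_norm M g + 1)"
      by (simp only:)
    then show ?thesis by (rule LIMSEQ_imp_Cauchy)
  qed
  have sub: "L2_norm M (\<lambda>x. T (F j) x - T (F k) x) = L2_norm M (T (\<lambda>x. F j x - F k x))" for j k
  proof (rule L2_norm_AE_cong)
    show "AE x in M. T (F j) x - T (F k) x = T (\<lambda>x. F j x - F k x) x"
      using lin[OF F[of j] F[of k], of 1 "-1"] by (simp add: eq_commute)
  qed (auto intro!: L2_measurable L2_diff subset_L2 TH F diff_mem)
  have "\<exists>g\<in>L2 M. (\<lambda>k. L2_norm M (\<lambda>x. T (F (r k)) x - g x)) \<longlonglongrightarrow> 0"
  proof (rule L2_complete)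
    fix e :: real assume e: "e > 0"
    \<comment> \<open>Differences of members of the sequence have norm at most \<open>2 * C\<close>,
      so this \<open>m\<close> keeps the first term of the seminorm bound below
      \<open>e / 2\<close>.\<close>
    obtain m where m: "4 * (C + 1) / e < real (Suc m)"
      using reals_Archimedean2[of "4 * (C + 1) / e"] by (metis less_trans of_nat_less_iff lessI)
    have tail: "\<exists>N. \<forall>j\<ge>N. \<forall>k\<ge>N. (\<Sum>g\<leftarrow>hs. cmod (L2_inner M (F (r j)) g - L2_inner M (F (r k)) g)) < \<epsilon>"
      if "set hs \<subseteq> G" "\<epsilon> > 0" for hs \<epsilon>
      using that
    proof (induction hs arbitrary: \<epsilon>)
      case (Cons h hs)
      then obtain N1 where N1: "\<forall>j\<ge>N1. \<forall>k\<ge>N1.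
          (\<Sum>g\<leftarrow>hs. cmod (L2_inner M (F (r j)) g - L2_inner M (F (r k)) g)) < \<epsilon> / 2"
        using Cons.IH[of "\<epsilon>/2"] by auto
      obtain N2 where N2: "\<forall>j\<ge>N2. \<forall>k\<ge>N2. cmod (L2_inner M (F (r j)) h - L2_inner M (F (r k)) h) < \<epsilon> / 2"
        using conv[of h, unfolded Cauchy_def dist_norm, rule_format, of "\<epsilon>/2"] Cons.prems by auto
      have "(\<Sum>g\<leftarrow>h # hs. cmod (L2_inner M (F (r j)) g - L2_inner M (F (r k)) g)) < \<epsilon>"
        if "j \<ge> max N1 N2" "k \<ge> max N1 N2" for j k
        using add_strict_mono[OF N2[rule_format, of j k] N1[rule_format, of j k]] that by simp
      then show ?case by blast
    qed auto
    have "set (gs m) \<subseteq> G" by (auto simp: G_def)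
    then obtain N where N: "\<And>j k. j \<ge> N \<Longrightarrow> k \<ge> N \<Longrightarrow>
        (\<Sum>g\<leftarrow>gs m. cmod (L2_inner M (F (r j)) g - L2_inner M (F (r k)) g)) < e / 2"
      using tail[OF _ half_gt_zero[OF e]] by blast
    have "L2_norm M (\<lambda>x. T (F (r j)) x - T (F (r k)) x) < e" if "j \<ge> N" "k \<ge> N" for j k
    proof -
      have "L2_norm M (T (\<lambda>x. F (r j) x - F (r k) x))
          \<le> 1 / real (Suc m) * L2_norm M (\<lambda>x. F (r j) x - F (r k) x)
            + (\<Sum>g\<leftarrow>gs m. cmod (L2_inner M (\<lambda>x. F (r j) x - F (r k) x) g))"
        by (intro gs diff_mem F)
      also have "(\<Sum>g\<leftarrow>gs m. cmod (L2_inner M (\<lambda>x. F (r j) x - F (r k) x) g))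
          = (\<Sum>g\<leftarrow>gs m. cmod (L2_inner M (F (r j)) g - L2_inner M (F (r k)) g))"
        using gs(1)[of m] F subset_L2
        by (intro arg_cong[where f = sum_list] map_cong) (auto simp: L2_inner_diff_left subset_iff)
      also have "\<dots> < e / 2" by (rule N[OF that])
      also have "1 / real (Suc m) * L2_norm M (\<lambda>x. F (r j) x - F (r k) x) \<le> 1 / real (Suc m) * (2 * (C + 1))"
        using L2_norm_triangle_diff[OF subset_L2[OF F[of "r j"]] subset_L2[OF F[of "r k"]]] C[of "r j"] C[of "r k"]
        by (intro mult_left_mono) auto
      also have "\<dots> < e / 2" using m e by (simp add: field_simps)
      finally show ?thesis unfolding sub by simp
    qed
    then show "\<exists>N. \<forall>m\<ge>N. \<forall>n\<ge>N. L2_norm M (\<lambda>x. T (F (r m)) x - T (F (r n)) x) < e" by blast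
  qed (auto intro: subset_L2 TH F)
  then obtain g where g: "g \<in> L2 M" "(\<lambda>k. L2_norm M (\<lambda>x. T (F (r k)) x - g x)) \<longlonglongrightarrow> 0" by blast
  moreover have "g \<in> H" by (rule limit_mem[OF _ g]) (auto intro: TH F)
  ultimately show "\<exists>r g. strict_mono r \<and> g \<in> H \<and> (\<lambda>k. L2_norm M (\<lambda>x. T (F (r k)) x - g x)) \<longlonglongrightarrow> 0"
    using r by blast
qed

section \<open>Bounded symbols and their Hankel operators\<close>

definition bounded_symbol :: "('a \<Rightarrow> complex) \<Rightarrow> bool" where
  "bounded_symbol \<phi> \<longleftrightarrow> \<phi> \<in> borel_measurable M \<and> (\<exists>B. \<forall>x\<in>space M. cmod (\<phi> x) \<le> B)"

lemma bounded_symbolE: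
  assumes "bounded_symbol \<phi>"
  obtains B where "B \<ge> 0" "\<And>f. f \<in> L2 M \<Longrightarrow> (\<lambda>x. \<phi> x * f x) \<in> L2 M"
    "\<And>f. f \<in> L2 M \<Longrightarrow> L2_norm M (\<lambda>x. \<phi> x * f x) \<le> B * L2_norm M f"
proof -
  obtain B where B: "\<phi> \<in> borel_measurable M" "\<And>x. x \<in> space M \<Longrightarrow> cmod (\<phi> x) \<le> B"
    using assms by (auto simp: bounded_symbol_def)
  then have "\<And>x. x \<in> space M \<Longrightarrow> cmod (\<phi> x) \<le> \<bar>B\<bar>" by (meson abs_ge_self order_trans)
  then show ?thesis using that[of "\<bar>B\<bar>"] L2_bounded_mult[of _ M \<phi> "\<bar>B\<bar>"] B(1) by simp
qed

lemma bounded_symbol_mult_L2: "bounded_symbol \<phi> \<Longrightarrow> f \<in> L2 M \<Longrightarrow> (\<lambda>x. \<phi> x * f x) \<in> L2 M"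
  by (erule bounded_symbolE) blast

lemma bounded_symbol_cnj: "bounded_symbol \<phi> \<Longrightarrow> bounded_symbol (\<lambda>x. cnj (\<phi> x))"
  by (auto simp: bounded_symbol_def)

lemma bounded_symbol_mult:
  assumes "bounded_symbol \<phi>" "bounded_symbol \<psi>" shows "bounded_symbol (\<lambda>x. \<phi> x * \<psi> x)"
proof -
  obtain B C where "\<And>x. x \<in> space M \<Longrightarrow> cmod (\<phi> x) \<le> B" "\<And>x. x \<in> space M \<Longrightarrow> cmod (\<psi> x) \<le> C"
    using assms by (auto simp: bounded_symbol_def)
  then have "\<forall>x\<in>space M. cmod (\<phi> x * \<psi> x) \<le> B * C"
    by (auto simp: norm_mult intro!: mult_mono' )
  then show ?thesis using assms by (auto simp: bounded_symbol_def)
qed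

lemma bounded_symbol_add:
  assumes "bounded_symbol \<phi>" "bounded_symbol \<psi>" shows "bounded_symbol (\<lambda>x. \<phi> x + \<psi> x)"
proof -
  obtain B C where "\<And>x. x \<in> space M \<Longrightarrow> cmod (\<phi> x) \<le> B" "\<And>x. x \<in> space M \<Longrightarrow> cmod (\<psi> x) \<le> C"
    using assms by (auto simp: bounded_symbol_def)
  then have "\<forall>x\<in>space M. cmod (\<phi> x + \<psi> x) \<le> B + C"
    by (auto intro!: norm_triangle_le add_mono)
  then show ?thesis using assms by (auto simp: bounded_symbol_def)
qed

lemma bounded_symbol_const: "bounded_symbol (\<lambda>x. c)"
  by (auto simp: bounded_symbol_def)

abbreviation hankel_norm :: "('a \<Rightarrow> complex) \<Rightarrow> ('a \<Rightarrow> complex) \<Rightarrow> real" where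
  "hankel_norm \<phi> f \<equiv> L2_norm M (\<lambda>x. \<phi> x * f x - P (\<lambda>x. \<phi> x * f x) x)"

definition compact_hankel :: "('a \<Rightarrow> complex) \<Rightarrow> bool" where
  "compact_hankel \<phi> \<longleftrightarrow> bounded_symbol \<phi> \<and> compact_seminorm (hankel_norm \<phi>)"

text \<open>If multiplication by \<phi> preserves \<open>H\<close>, the product is its own best
  approximation and the Hankel operator vanishes.\<close>

lemma compact_hankel_multiplier:
  assumes \<phi>: "bounded_symbol \<phi>" and mem: "\<And>f. f \<in> H \<Longrightarrow> (\<lambda>x. \<phi> x * f x) \<in> H"
  shows "compact_hankel \<phi>"
  unfolding compact_hankel_def
proof (intro conjI \<phi> compact_seminorm_mono[OF compact_seminorm_zero])
  fix f assume "f \<in> H"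
  from proj_best[OF subset_L2[OF mem[OF this]] mem[OF this]]
  show "hankel_norm \<phi> f \<le> 0" by simp
qed

lemma compact_hankel_const: "compact_hankel (\<lambda>x. c)"
  by (intro compact_hankel_multiplier bounded_symbol_const cmult_mem)

lemma compact_hankel_add:
  assumes "compact_hankel \<phi>" "compact_hankel \<psi>" shows "compact_hankel (\<lambda>x. \<phi> x + \<psi> x)"
proof -
  have b: "bounded_symbol \<phi>" "bounded_symbol \<psi>" using assms by (auto simp: compact_hankel_def)
  have "compact_seminorm (hankel_norm (\<lambda>x. \<phi> x + \<psi> x))"
  proof (rule compact_seminorm_mono)
    show "compact_seminorm (\<lambda>f. hankel_norm \<phi> f + hankel_norm \<psi> f)"
      using assms by (intro compact_seminorm_add) (auto simp: compact_hankel_def)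
    fix f assume f: "f \<in> H"
    let ?u = "\<lambda>x. \<phi> x * f x" and ?v = "\<lambda>x. \<psi> x * f x"
    have uv: "?u \<in> L2 M" "?v \<in> L2 M" using b f by (auto intro: bounded_symbol_mult_L2 subset_L2)
    have "hankel_norm (\<lambda>x. \<phi> x + \<psi> x) f
        \<le> L2_norm M (\<lambda>x. (\<phi> x + \<psi> x) * f x - (P ?u x + P ?v x))"
      by (intro proj_best add_mem proj_mem uv bounded_symbol_mult_L2[OF bounded_symbol_add[OF b] subset_L2[OF f]])
    also have "\<dots> = L2_norm M (\<lambda>x. (?u x - P ?u x) + (?v x - P ?v x))"
      by (simp add: algebra_simps)
    also have "\<dots> \<le> hankel_norm \<phi> f + hankel_norm \<psi> f"
      using uv by (intro L2_norm_triangle L2_diff proj_L2)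
    finally show "hankel_norm (\<lambda>x. \<phi> x + \<psi> x) f \<le> hankel_norm \<phi> f + hankel_norm \<psi> f" .
  qed
  then show ?thesis using b by (simp add: compact_hankel_def bounded_symbol_add)
qed

text \<open>With \<open>Q = I - P\<close>, the competitor \<open>P \<phi> P \<psi> f\<close> leaves
  the error \<open>Q \<phi> (P \<psi> f) + \<phi> Q \<psi> f\<close>: the Hankel operator of \<phi>
  after a Toeplitz operator, plus a bounded multiplier after the Hankel operator of \<psi>.\<close>

lemma compact_hankel_mult:
  assumes "compact_hankel \<phi>" "compact_hankel \<psi>" shows "compact_hankel (\<lambda>x. \<phi> x * \<psi> x)"
proof -
  have b: "bounded_symbol \<phi>" "bounded_symbol \<psi>" using assms by (auto simp: compact_hankel_def)
  obtain B where B: "B \<ge> 0" "\<And>f. f \<in> L2 M \<Longrightarrow> L2_norm M (\<lambda>x. \<phi> x * f x) \<le> B * L2_norm M f"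
    using bounded_symbolE[OF b(1)] by metis
  obtain C where C: "C \<ge> 0" "\<And>f. f \<in> L2 M \<Longrightarrow> L2_norm M (\<lambda>x. \<psi> x * f x) \<le> C * L2_norm M f"
    using bounded_symbolE[OF b(2)] by metis
  let ?T = "\<lambda>f. P (\<lambda>x. \<psi> x * f x)"
  have "compact_seminorm (\<lambda>f. hankel_norm \<phi> (?T f))"
  proof (rule compact_seminorm_comp[where B = C and N = "hankel_norm \<phi>" and A = ?T])
    fix f assume f: "f \<in> H"
    then have fL: "(\<lambda>x. \<psi> x * f x) \<in> L2 M" by (intro bounded_symbol_mult_L2 b subset_L2)
    show "?T f \<in> H" by (rule proj_mem[OF fL])
    show "L2_norm M (?T f) \<le> C * L2_norm M f"
      using proj_norm_le[OF fL] C(2)[OF subset_L2[OF f]] by linarith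
  next
    fix g assume g: "g \<in> L2 M"
    \<comment> \<open>The projection is self-adjoint, so the adjoint of
      \<open>f \<mapsto> P (\<psi> f)\<close> is
      \<open>g \<mapsto> cnj \<psi> * P g\<close>.\<close>
    have "L2_inner M (?T f) g = L2_inner M f (\<lambda>x. cnj (\<psi> x) * P g x)" if f: "f \<in> H" for f
    proof -
      have fL: "(\<lambda>x. \<psi> x * f x) \<in> L2 M" using f by (intro bounded_symbol_mult_L2 b subset_L2)
      have "L2_inner M (?T f) g = cnj (L2_inner M g (?T f))" by (rule L2_inner_commute)
      also have "\<dots> = cnj (L2_inner M (P g) (?T f))" by (simp add: proj_inner[OF g proj_mem[OF fL]])
      also have "\<dots> = L2_inner M (?T f) (P g)" by (rule L2_inner_commute[symmetric])
      also have "\<dots> = L2_inner M (\<lambda>x. \<psi> x * f x) (P g)" by (rule proj_inner[OF fL proj_mem[OF g]])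
      finally show ?thesis by (simp add: L2_inner_mult_shift)
    qed
    then show "\<exists>g'\<in>L2 M. \<forall>f\<in>H. L2_inner M (?T f) g = L2_inner M f g'"
      by (intro bexI[of _ "\<lambda>x. cnj (\<psi> x) * P g x"])
         (auto intro!: bounded_symbol_mult_L2 bounded_symbol_cnj b proj_L2 g)
  qed (use assms in \<open>simp add: compact_hankel_def\<close>)
  moreover have "compact_seminorm (\<lambda>f. B * hankel_norm \<psi> f)"
    using assms B by (intro compact_seminorm_cmult) (auto simp: compact_hankel_def)
  ultimately have "compact_seminorm (\<lambda>f. hankel_norm \<phi> (?T f) + B * hankel_norm \<psi> f)"
    by (rule compact_seminorm_add)
  then have "compact_seminorm (hankel_norm (\<lambda>x. \<phi> x * \<psi> x))"
  proof (rule compact_seminorm_mono)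
    fix f assume f: "f \<in> H"
    let ?u = "\<lambda>x. \<psi> x * f x"
    let ?v = "\<lambda>x. \<phi> x * P ?u x"
    have u: "?u \<in> L2 M" using f by (intro bounded_symbol_mult_L2 b subset_L2)
    have v: "?v \<in> L2 M" by (intro bounded_symbol_mult_L2 b proj_L2 u)
    have "hankel_norm (\<lambda>x. \<phi> x * \<psi> x) f \<le> L2_norm M (\<lambda>x. \<phi> x * \<psi> x * f x - P ?v x)"
      by (intro proj_best proj_mem v) (intro bounded_symbol_mult_L2 bounded_symbol_mult b subset_L2 f)
    also have "\<dots> = L2_norm M (\<lambda>x. (?v x - P ?v x) + \<phi> x * (?u x - P ?u x))"
      by (simp add: algebra_simps)
    also have "\<dots> \<le> L2_norm M (\<lambda>x. ?v x - P ?v x) + L2_norm M (\<lambda>x. \<phi> x * (?u x - P ?u x))"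
      by (intro L2_norm_triangle L2_diff proj_L2 v bounded_symbol_mult_L2 b u)
    also have "L2_norm M (\<lambda>x. \<phi> x * (?u x - P ?u x)) \<le> B * L2_norm M (\<lambda>x. ?u x - P ?u x)"
      by (intro B L2_diff u proj_L2)
    finally show "hankel_norm (\<lambda>x. \<phi> x * \<psi> x) f \<le> hankel_norm \<phi> (?T f) + B * hankel_norm \<psi> f"
      by simp
  qed
  then show ?thesis using b by (simp add: compact_hankel_def bounded_symbol_mult)
qed

text \<open>Changing the symbol by at most \<open>e\<close> in the supremum norm changes the Hankel
  operator by at most \<open>e\<close> in operator norm.\<close>

lemma compact_hankel_limit:
  assumes \<phi>: "bounded_symbol \<phi>"
    and lim: "\<And>e. e > 0 \<Longrightarrow> \<exists>\<psi>. compact_hankel \<psi> \<and> (\<forall>x\<in>space M. cmod (\<phi> x - \<psi> x) \<le> e)"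
  shows "compact_hankel \<phi>"
  unfolding compact_hankel_def
proof (intro conjI \<phi> compact_seminorm_limit)
  fix e :: real assume "e > 0"
  then obtain \<psi> where \<psi>: "compact_hankel \<psi>" "\<And>x. x \<in> space M \<Longrightarrow> cmod (\<phi> x - \<psi> x) \<le> e"
    using lim by meson
  have b: "bounded_symbol \<psi>" using \<psi> by (auto simp: compact_hankel_def)
  have "hankel_norm \<phi> f \<le> hankel_norm \<psi> f + e * L2_norm M f" if f: "f \<in> H" for f
  proof -
    let ?u = "\<lambda>x. \<psi> x * f x"
    have u: "?u \<in> L2 M" using f by (intro bounded_symbol_mult_L2 b subset_L2)
    have w: "(\<lambda>x. (\<phi> x - \<psi> x) * f x) \<in> L2 M"
      and wn: "L2_norm M (\<lambda>x. (\<phi> x - \<psi> x) * f x) \<le> e * L2_norm M f"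
      using \<psi>(2) b \<phi> L2_bounded_mult[OF subset_L2[OF f], of "\<lambda>x. \<phi> x - \<psi> x" e]
      by (simp_all add: bounded_symbol_def borel_measurable_diff)
    have "hankel_norm \<phi> f \<le> L2_norm M (\<lambda>x. \<phi> x * f x - P ?u x)"
      by (intro proj_best proj_mem u) (intro bounded_symbol_mult_L2 \<phi> subset_L2 f)
    also have "\<dots> = L2_norm M (\<lambda>x. (?u x - P ?u x) + (\<phi> x - \<psi> x) * f x)"
      by (simp add: algebra_simps)
    also have "\<dots> \<le> hankel_norm \<psi> f + L2_norm M (\<lambda>x. (\<phi> x - \<psi> x) * f x)"
      by (intro L2_norm_triangle L2_diff proj_L2 u w)
    finally show ?thesis using wn by linarith
  qed
  then show "\<exists>N'. compact_seminorm N' \<and> (\<forall>f\<in>H. hankel_norm \<phi> f \<le> N' f + e * L2_norm M f)"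
    using \<psi>(1) by (intro exI[of _ "hankel_norm \<psi>"]) (auto simp: compact_hankel_def)
qed

section \<open>Toeplitz operators: boundedness, commutators, adjoints\<close>

lemma bounded_operator_toeplitz:
  assumes \<phi>: "bounded_symbol \<phi>"
  shows "bounded_operator_on M H (\<lambda>f. P (\<lambda>x. \<phi> x * f x))"
  unfolding bounded_operator_on_def
proof (intro conjI ballI allI)
  obtain B where B: "B \<ge> 0" "\<And>f. f \<in> L2 M \<Longrightarrow> L2_norm M (\<lambda>x. \<phi> x * f x) \<le> B * L2_norm M f"
    using bounded_symbolE[OF \<phi>] by metis
  have L: "(\<lambda>x. \<phi> x * f x) \<in> L2 M" if "f \<in> H" for f
    using that by (intro bounded_symbol_mult_L2 \<phi> subset_L2)
  show "P (\<lambda>x. \<phi> x * f x) \<in> H" if "f \<in> H" for f by (intro proj_mem L that)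
  show "AE x in M. P (\<lambda>x. \<phi> x * (a * f x + b * g x)) x
      = a * P (\<lambda>x. \<phi> x * f x) x + b * P (\<lambda>x. \<phi> x * g x) x" if "f \<in> H" "g \<in> H" for f g a b
    using proj_AE_lincomb[OF L[OF that(1)] L[OF that(2)], of a b] by (simp add: algebra_simps)
  show "\<exists>C. \<forall>f\<in>H. L2_norm M (P (\<lambda>x. \<phi> x * f x)) \<le> C * L2_norm M f"
    using proj_norm_le[OF L] B(2)[OF subset_L2] by (intro exI[of _ B]) (meson order_trans)
qed

lemma bounded_operator_onE:
  assumes "bounded_operator_on M H T"
  obtains C where "\<And>f. f \<in> H \<Longrightarrow> L2_norm M (T f) \<le> C * L2_norm M f" "\<And>f. f \<in> H \<Longrightarrow> T f \<in> H"
  using assms unfolding bounded_operator_on_def by metis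

text \<open>Operators built by choice act on representatives and are linear only almost everywhere,
  so compatibility with equality almost everywhere has to be derived. It follows from the norm bound
  applied to \<open>f - g\<close>.\<close>

lemma bounded_operator_AE:
  assumes T: "bounded_operator_on M H T" and f: "f \<in> H" and g: "g \<in> H" and eq: "AE x in M. f x = g x"
  shows "AE x in M. T f x = T g x"
proof -
  obtain C where C: "\<And>f. f \<in> H \<Longrightarrow> L2_norm M (T f) \<le> C * L2_norm M f" and TH: "\<And>f. f \<in> H \<Longrightarrow> T f \<in> H"
    using bounded_operator_onE[OF T] by metis
  have d: "(\<lambda>x. 1 * f x + (-1) * g x) \<in> H" by (intro lincomb_mem f g)
  have "L2_norm M (\<lambda>x. 1 * f x + (-1) * g x) = L2_norm M (\<lambda>x. 0)"
    by (rule L2_norm_AE_cong) (use eq L2_measurable[OF subset_L2[OF d]] in auto)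
  then have "L2_norm M (T (\<lambda>x. 1 * f x + (-1) * g x)) = 0"
    using C[OF d] L2_norm_nonneg[of M "T (\<lambda>x. 1 * f x + (-1) * g x)"] L2_norm_zero[of M]
    by (simp only: mult_zero_right)
  from L2_norm_eq_0_AE[OF subset_L2[OF TH[OF d]] this]
  have "AE x in M. T (\<lambda>x. 1 * f x + (-1) * g x) x = 0" .
  moreover have "AE x in M. T (\<lambda>x. 1 * f x + (-1) * g x) x = 1 * T f x + (-1) * T g x"
    using T f g unfolding bounded_operator_on_def by blast
  ultimately show ?thesis by eventually_elim simp
qed

lemma bounded_operator_comp:
  assumes S: "bounded_operator_on M H S" and T: "bounded_operator_on M H T"
  shows "bounded_operator_on M H (\<lambda>f. S (T f))"
  unfolding bounded_operator_on_def
proof (intro conjI ballI allI)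
  obtain C where C: "\<And>f. f \<in> H \<Longrightarrow> L2_norm M (T f) \<le> C * L2_norm M f"
    and TH: "\<And>f. f \<in> H \<Longrightarrow> T f \<in> H" using bounded_operator_onE[OF T] by metis
  obtain B where B: "\<And>f. f \<in> H \<Longrightarrow> L2_norm M (S f) \<le> B * L2_norm M f"
    and SH: "\<And>f. f \<in> H \<Longrightarrow> S f \<in> H" using bounded_operator_onE[OF S] by metis
  show "S (T f) \<in> H" if "f \<in> H" for f by (intro SH TH that)
  show "AE x in M. S (T (\<lambda>y. a * f y + b * g y)) x = a * S (T f) x + b * S (T g) x"
    if f: "f \<in> H" and g: "g \<in> H" for f g a b
  proof -
    have "AE x in M. S (T (\<lambda>y. a * f y + b * g y)) x = S (\<lambda>y. a * T f y + b * T g y) x"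
      by (intro bounded_operator_AE[OF S] TH lincomb_mem f g)
         (use T f g in \<open>auto simp: bounded_operator_on_def\<close>)
    moreover have "AE x in M. S (\<lambda>y. a * T f y + b * T g y) x = a * S (T f) x + b * S (T g) x"
      using S TH[OF f] TH[OF g] by (auto simp: bounded_operator_on_def)
    ultimately show ?thesis by eventually_elim simp
  qed
  have "L2_norm M (S (T f)) \<le> \<bar>B\<bar> * C * L2_norm M f" if "f \<in> H" for f
  proof -
    have "L2_norm M (S (T f)) \<le> \<bar>B\<bar> * L2_norm M (T f)"
      using B[OF TH[OF that]] by (rule order_trans) (auto intro!: mult_right_mono)
    also have "\<dots> \<le> \<bar>B\<bar> * (C * L2_norm M f)" by (intro mult_left_mono C that) simp
    finally show ?thesis by (simp add: mult.assoc)
  qed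
  then show "\<exists>C. \<forall>f\<in>H. L2_norm M (S (T f)) \<le> C * L2_norm M f" by blast
qed

lemma bounded_operator_diff:
  assumes S: "bounded_operator_on M H S" and T: "bounded_operator_on M H T"
  shows "bounded_operator_on M H (\<lambda>f x. S f x - T f x)"
  unfolding bounded_operator_on_def
proof (intro conjI ballI allI)
  obtain C where C: "\<And>f. f \<in> H \<Longrightarrow> L2_norm M (T f) \<le> C * L2_norm M f"
    and TH: "\<And>f. f \<in> H \<Longrightarrow> T f \<in> H" using bounded_operator_onE[OF T] by metis
  obtain B where B: "\<And>f. f \<in> H \<Longrightarrow> L2_norm M (S f) \<le> B * L2_norm M f"
    and SH: "\<And>f. f \<in> H \<Longrightarrow> S f \<in> H" using bounded_operator_onE[OF S] by metis
  show "(\<lambda>x. S f x - T f x) \<in> H" if "f \<in> H" for f by (intro diff_mem SH TH that)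
  show "AE x in M. S (\<lambda>y. a * f y + b * g y) x - T (\<lambda>y. a * f y + b * g y) x
      = a * (S f x - T f x) + b * (S g x - T g x)" if f: "f \<in> H" and g: "g \<in> H" for f g a b
  proof -
    have "AE x in M. S (\<lambda>y. a * f y + b * g y) x = a * S f x + b * S g x"
      "AE x in M. T (\<lambda>y. a * f y + b * g y) x = a * T f x + b * T g x"
      using S T f g by (auto simp: bounded_operator_on_def)
    then show ?thesis by eventually_elim (simp add: algebra_simps)
  qed
  show "\<exists>C. \<forall>f\<in>H. L2_norm M (\<lambda>x. S f x - T f x) \<le> C * L2_norm M f"
  proof (intro exI[of _ "B + C"] ballI)
    fix f assume f: "f \<in> H"
    show "L2_norm M (\<lambda>x. S f x - T f x) \<le> (B + C) * L2_norm M f"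
      using L2_norm_triangle_diff[OF subset_L2[OF SH[OF f]] subset_L2[OF TH[OF f]]] B[OF f] C[OF f]
      by (simp add: distrib_right)
  qed
qed

text \<open>The commutator is a combination of the two Hankel operators, since
  \<open>T\<^bsub>\<phi>\<^esub> T\<^bsub>\<psi>\<^esub> - T\<^bsub>\<phi>\<psi>\<^esub> = - P \<phi> (I - P) \<psi>\<close>.\<close>

lemma compact_toeplitz_commutator:
  assumes \<phi>: "compact_hankel \<phi>" and \<psi>: "compact_hankel \<psi>"
  shows "compact_operator_on M H
    (\<lambda>f x. P (\<lambda>x. \<phi> x * P (\<lambda>x. \<psi> x * f x) x) x - P (\<lambda>x. \<psi> x * P (\<lambda>x. \<phi> x * f x) x) x)"
proof (rule compact_operatorI)
  have b: "bounded_symbol \<phi>" "bounded_symbol \<psi>" using assms by (auto simp: compact_hankel_def)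
  show "bounded_operator_on M H
    (\<lambda>f x. P (\<lambda>x. \<phi> x * P (\<lambda>x. \<psi> x * f x) x) x - P (\<lambda>x. \<psi> x * P (\<lambda>x. \<phi> x * f x) x) x)"
    using bounded_operator_diff[OF
        bounded_operator_comp[OF bounded_operator_toeplitz[OF b(1)] bounded_operator_toeplitz[OF b(2)]]
        bounded_operator_comp[OF bounded_operator_toeplitz[OF b(2)] bounded_operator_toeplitz[OF b(1)]]] .
  have half: "\<exists>B\<ge>0. \<forall>f\<in>H. L2_norm M (\<lambda>x. P (\<lambda>x. \<phi> x * P (\<lambda>x. \<psi> x * f x) x) x - P (\<lambda>x. \<phi> x * \<psi> x * f x) x)
      \<le> B * hankel_norm \<psi> f" if \<phi>: "bounded_symbol \<phi>" and \<psi>: "bounded_symbol \<psi>" for \<phi> \<psi>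
  proof -
    obtain B where B: "B \<ge> 0" "\<And>f. f \<in> L2 M \<Longrightarrow> L2_norm M (\<lambda>x. \<phi> x * f x) \<le> B * L2_norm M f"
      using bounded_symbolE[OF \<phi>] by metis
    have "L2_norm M (\<lambda>x. P (\<lambda>x. \<phi> x * P (\<lambda>x. \<psi> x * f x) x) x - P (\<lambda>x. \<phi> x * \<psi> x * f x) x)
        \<le> B * hankel_norm \<psi> f" if f: "f \<in> H" for f
    proof -
      let ?u = "\<lambda>x. \<psi> x * f x"
      have u: "?u \<in> L2 M" using f by (intro bounded_symbol_mult_L2 \<psi> subset_L2)
      have "L2_norm M (\<lambda>x. P (\<lambda>x. \<phi> x * P ?u x) x - P (\<lambda>x. \<phi> x * \<psi> x * f x) x)
          \<le> L2_norm M (\<lambda>x. \<phi> x * P ?u x - \<phi> x * \<psi> x * f x)"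
        by (intro proj_diff_norm_le bounded_symbol_mult_L2 bounded_symbol_mult \<phi> \<psi> proj_L2 u subset_L2 f)
      also have "\<dots> = L2_norm M (\<lambda>x. \<phi> x * (?u x - P ?u x))"
        by (subst L2_norm_minus_commute) (simp add: algebra_simps)
      also have "\<dots> \<le> B * hankel_norm \<psi> f" by (intro B L2_diff u proj_L2)
      finally show ?thesis .
    qed
    then show ?thesis using B(1) by blast
  qed
  from half[OF b] obtain B where B: "B \<ge> 0"
    "\<And>f. f\<in>H \<Longrightarrow> L2_norm M (\<lambda>x. P (\<lambda>x. \<phi> x * P (\<lambda>x. \<psi> x * f x) x) x - P (\<lambda>x. \<phi> x * \<psi> x * f x) x)
      \<le> B * hankel_norm \<psi> f" by blast
  from half[OF b(2) b(1)] obtain C where C: "C \<ge> 0"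
    "\<And>f. f\<in>H \<Longrightarrow> L2_norm M (\<lambda>x. P (\<lambda>x. \<psi> x * P (\<lambda>x. \<phi> x * f x) x) x - P (\<lambda>x. \<psi> x * \<phi> x * f x) x)
      \<le> C * hankel_norm \<phi> f" by blast
  have "compact_seminorm (\<lambda>f. B * hankel_norm \<psi> f + C * hankel_norm \<phi> f)"
    using assms B(1) C(1) by (intro compact_seminorm_add compact_seminorm_cmult) (auto simp: compact_hankel_def)
  then show "compact_seminorm (\<lambda>f. L2_norm M
    (\<lambda>x. P (\<lambda>x. \<phi> x * P (\<lambda>x. \<psi> x * f x) x) x - P (\<lambda>x. \<psi> x * P (\<lambda>x. \<phi> x * f x) x) x))"
  proof (rule compact_seminorm_mono)
    fix f assume f: "f \<in> H"
    let ?a = "P (\<lambda>x. \<phi> x * P (\<lambda>x. \<psi> x * f x) x)" and ?b = "P (\<lambda>x. \<psi> x * P (\<lambda>x. \<phi> x * f x) x)"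
      and ?c = "P (\<lambda>x. \<phi> x * \<psi> x * f x)"
    \<comment> \<open>Both products are compared with the Toeplitz operator of the product symbol,
      which does not depend on the order of the factors.\<close>
    have "L2_norm M (\<lambda>x. ?a x - ?b x) \<le> L2_norm M (\<lambda>x. ?a x - ?c x) + L2_norm M (\<lambda>x. ?c x - ?b x)"
      by (intro L2_norm_triangle_mid proj_L2 bounded_symbol_mult_L2 bounded_symbol_mult b subset_L2 f)
    then show "L2_norm M (\<lambda>x. ?a x - ?b x) \<le> B * hankel_norm \<psi> f + C * hankel_norm \<phi> f"
      using B(2)[OF f] C(2)[OF f] by (simp add: L2_norm_minus_commute[of M ?c] mult.commute[of "\<psi> _"])
  qed
qed

text \<open>The adjoint of multiplication by \<phi> on \<open>H\<close> is the Toeplitz operator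
  with symbol \<open>cnj \<phi>\<close>. Both are chosen representatives, hence the agreement up to
  norm 0.\<close>

lemma adjoint_multiplier:
  assumes \<phi>: "bounded_symbol \<phi>" and g: "g \<in> H"
  shows "L2_adjoint M H (\<lambda>f x. \<phi> x * f x) g \<in> H"
    and "L2_norm M (\<lambda>x. L2_adjoint M H (\<lambda>f x. \<phi> x * f x) g x - P (\<lambda>x. cnj (\<phi> x) * g x) x) = 0"
proof -
  have u: "(\<lambda>x. cnj (\<phi> x) * g x) \<in> L2 M"
    by (intro bounded_symbol_mult_L2 bounded_symbol_cnj \<phi> subset_L2 g)
  let ?Q = "\<lambda>h. h \<in> H \<and> (\<forall>f\<in>H. L2_inner M (\<lambda>x. \<phi> x * f x) g = L2_inner M f h)"
  have "L2_inner M (\<lambda>x. \<phi> x * f x) g = L2_inner M f (P (\<lambda>x. cnj (\<phi> x) * g x))" if "f \<in> H" for f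
    unfolding L2_inner_mult_shift
    by (subst (1 2) L2_inner_commute) (simp add: proj_inner[OF u that])
  then have "?Q (P (\<lambda>x. cnj (\<phi> x) * g x))" using proj_mem[OF u] by blast
  then have "?Q (L2_adjoint M H (\<lambda>f x. \<phi> x * f x) g)" unfolding L2_adjoint_def by (rule someI[where P = ?Q])
  then have h: "L2_adjoint M H (\<lambda>f x. \<phi> x * f x) g \<in> H"
    and h': "\<And>f. f \<in> H \<Longrightarrow> L2_inner M (\<lambda>x. \<phi> x * f x) g = L2_inner M f (L2_adjoint M H (\<lambda>f x. \<phi> x * f x) g)"
    by auto
  show "L2_adjoint M H (\<lambda>f x. \<phi> x * f x) g \<in> H" by (rule h)
  show "L2_norm M (\<lambda>x. L2_adjoint M H (\<lambda>f x. \<phi> x * f x) g x - P (\<lambda>x. cnj (\<phi> x) * g x) x) = 0"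
  proof (rule proj_unique[OF u h])
    fix f assume "f \<in> H"
    from h'[OF this]
    have "L2_inner M f (L2_adjoint M H (\<lambda>f x. \<phi> x * f x) g) = L2_inner M f (\<lambda>x. cnj (\<phi> x) * g x)"
      by (simp only: L2_inner_mult_shift)
    then show "L2_inner M (L2_adjoint M H (\<lambda>f x. \<phi> x * f x) g) f = L2_inner M (\<lambda>x. cnj (\<phi> x) * g x) f"
      by (simp only: L2_inner_commute[of M _ f])
  qed
qed

text \<open>Moves compactness between two choices of representatives, such as the one made by
  \<open>L2_adjoint\<close> and the one made by \<open>L2_proj\<close>.\<close>

lemma compact_operator_AE_cong:
  assumes T: "compact_operator_on M H T" and T': "\<And>f. f \<in> H \<Longrightarrow> T' f \<in> H"
    and eq: "\<And>f. f \<in> H \<Longrightarrow> AE x in M. T f x = T' f x"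
  shows "compact_operator_on M H T'"
proof -
  have bT: "bounded_operator_on M H T" using T by (simp add: compact_operator_on_def)
  have TH: "T f \<in> H" if "f \<in> H" for f using bT that by (simp add: bounded_operator_on_def)
  have n: "L2_norm M (T f) = L2_norm M (T' f)" if "f \<in> H" for f
    by (rule L2_norm_AE_cong[OF eq[OF that]]) (auto intro: L2_measurable subset_L2 TH T' that)
  have n': "L2_norm M (\<lambda>x. T f x - g x) = L2_norm M (\<lambda>x. T' f x - g x)" if "f \<in> H" "g \<in> H" for f g
  proof (rule L2_norm_AE_cong)
    show "AE x in M. T f x - g x = T' f x - g x" using eq[OF that(1)] by eventually_elim simp
  qed (intro L2_measurable L2_diff subset_L2 TH T' that)+
  have "bounded_operator_on M H T'"
    unfolding bounded_operator_on_def
  proof (intro conjI ballI allI)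
    show "AE x in M. T' (\<lambda>y. a * f y + b * g y) x = a * T' f x + b * T' g x"
      if f: "f \<in> H" and g: "g \<in> H" for f g a b
    proof -
      have "AE x in M. T (\<lambda>y. a * f y + b * g y) x = a * T f x + b * T g x"
        using bT f g by (simp add: bounded_operator_on_def)
      with eq[OF f] eq[OF g] eq[OF lincomb_mem[OF f g, of a b]] show ?thesis by eventually_elim simp
    qed
    show "\<exists>C. \<forall>f\<in>H. L2_norm M (T' f) \<le> C * L2_norm M f"
      using bT n by (simp add: bounded_operator_on_def)
  qed (rule T')
  moreover have "\<exists>r g. strict_mono r \<and> g \<in> H \<and> (\<lambda>k. L2_norm M (\<lambda>x. T' (F (r k)) x - g x)) \<longlonglongrightarrow> 0"
    if F: "\<forall>k. F k \<in> H" "\<exists>C. \<forall>k. L2_norm M (F k) \<le> C"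
    for F :: "nat \<Rightarrow> 'a \<Rightarrow> complex"
  proof -
    obtain r :: "nat \<Rightarrow> nat" and g where rg: "strict_mono r" "g \<in> H" "(\<lambda>k. L2_norm M (\<lambda>x. T (F (r k)) x - g x)) \<longlonglongrightarrow> 0"
      using T F unfolding compact_operator_on_def by meson
    then have "(\<lambda>k. L2_norm M (\<lambda>x. T' (F (r k)) x - g x)) \<longlonglongrightarrow> 0"
      using F(1) n'[OF _ rg(2)] by simp
    then show ?thesis using rg by blast
  qed
  ultimately show ?thesis by (simp add: compact_operator_on_def)
qed

text \<open>Up to null sets the commutator of the adjoint of the i-th multiplier with the j-th one
  is a Toeplitz commutator with symbols \<open>cnj (\<phi> i)\<close> and \<open>\<phi> j\<close>;
  the first has compact Hankel operator by hypothesis, the second has Hankel operator 0.\<close>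

theorem essentially_normal_multipliers:
  assumes b: "\<And>i. bounded_symbol (\<phi> i)" and mem: "\<And>i f. f \<in> H \<Longrightarrow> (\<lambda>x. \<phi> i x * f x) \<in> H"
    and cnj: "\<And>i. compact_hankel (\<lambda>x. cnj (\<phi> i x))"
  shows "essentially_normal_on M H (\<lambda>i f x. \<phi> i x * f x)"
  unfolding essentially_normal_on_def
proof (intro conjI allI ballI)
  have P\<phi>: "AE x in M. P (\<lambda>x. \<phi> i x * f x) x = \<phi> i x * f x" if f: "f \<in> H" for i f
  proof -
    have "L2_norm M (\<lambda>x. \<phi> i x * f x - P (\<lambda>x. \<phi> i x * f x) x) = 0"
      by (rule proj_unique) (auto intro: subset_L2 mem f)
    from L2_norm_eq_0_AE[OF _ this]
    have "AE x in M. \<phi> i x * f x - P (\<lambda>x. \<phi> i x * f x) x = 0"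
      by (simp add: L2_diff subset_L2 proj_L2 mem f)
    then show ?thesis by eventually_elim simp
  qed
  show "bounded_operator_on M H (\<lambda>f x. \<phi> i x * f x)" for i
  proof -
    obtain B where B: "B \<ge> 0" "\<And>f. f \<in> L2 M \<Longrightarrow> L2_norm M (\<lambda>x. \<phi> i x * f x) \<le> B * L2_norm M f"
      using bounded_symbolE[OF b[of i]] by metis
    then show ?thesis using mem subset_L2
      by (auto simp: bounded_operator_on_def algebra_simps intro!: exI[of _ B])
  qed
  show "AE x in M. \<phi> i x * (\<phi> j x * f x) = \<phi> j x * (\<phi> i x * f x)" for i j f
    by (simp add: mult.left_commute)
  fix i j
  let ?A = "L2_adjoint M H (\<lambda>f x. \<phi> i x * f x)"
  have A: "AE x in M. ?A g x = P (\<lambda>x. cnj (\<phi> i x) * g x) x" if g: "g \<in> H" for g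
  proof -
    have "AE x in M. ?A g x - P (\<lambda>x. cnj (\<phi> i x) * g x) x = 0"
      by (rule L2_norm_eq_0_AE[OF _ adjoint_multiplier(2)[OF b g]])
         (intro L2_diff proj_L2 subset_L2[OF adjoint_multiplier(1)] bounded_symbol_mult_L2
            bounded_symbol_cnj b g subset_L2[OF g])
    then show ?thesis by eventually_elim simp
  qed
  have T: "P (\<lambda>x. cnj (\<phi> i x) * g x) \<in> H" if "g \<in> H" for g
    by (intro proj_mem bounded_symbol_mult_L2 bounded_symbol_cnj b subset_L2 that)
  show "compact_operator_on M H (\<lambda>f x. ?A (\<lambda>x. \<phi> j x * f x) x - \<phi> j x * ?A f x)"
  proof (rule compact_operator_AE_cong)
    show "compact_operator_on M H (\<lambda>f x. P (\<lambda>x. cnj (\<phi> i x) * P (\<lambda>x. \<phi> j x * f x) x) x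
        - P (\<lambda>x. \<phi> j x * P (\<lambda>x. cnj (\<phi> i x) * f x) x) x)"
      by (intro compact_toeplitz_commutator cnj compact_hankel_multiplier b mem)
    fix f assume f: "f \<in> H"
    show "(\<lambda>x. ?A (\<lambda>x. \<phi> j x * f x) x - \<phi> j x * ?A f x) \<in> H"
      by (intro diff_mem mem adjoint_multiplier b f)
    \<comment> \<open>The inner projection is removed under the outer operator, where equality
      almost everywhere suffices only thanks to boundedness.\<close>
    have "AE x in M. P (\<lambda>x. cnj (\<phi> i x) * P (\<lambda>x. \<phi> j x * f x) x) x = P (\<lambda>x. cnj (\<phi> i x) * (\<phi> j x * f x)) x"
      by (rule bounded_operator_AE[OF bounded_operator_toeplitz[OF bounded_symbol_cnj[OF b[of i]]]])
         (auto intro: P\<phi> f mem proj_mem subset_L2)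
    with A[OF mem[OF f, of j]] A[OF f] P\<phi>[OF T[OF f], of j]
    show "AE x in M. P (\<lambda>x. cnj (\<phi> i x) * P (\<lambda>x. \<phi> j x * f x) x) x
        - P (\<lambda>x. \<phi> j x * P (\<lambda>x. cnj (\<phi> i x) * f x) x) x = ?A (\<lambda>x. \<phi> j x * f x) x - \<phi> j x * ?A f x"
      by eventually_elim simp
  qed
qed

end

section \<open>The domains\<close>

definition rho :: "('n::finite \<Rightarrow> nat list) \<Rightarrow> complex ^ 'n \<Rightarrow> real" where
  "rho p z = (\<Sum>i\<in>UNIV. \<Sum>j<length (p i). cmod (z $ i) ^ (2 * (p i ! j)))"

text \<open>No restriction on \<open>u\<close>: unimodular values give isometries of the surface,
  values inside the disc shrink one coordinate, which Cauchy's formula and the homogeneity arguments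
  need.\<close>

definition rot :: "'n::finite \<Rightarrow> complex \<Rightarrow> complex ^ 'n \<Rightarrow> complex ^ 'n" where
  "rot i u z = (\<chi> k. if k = i then u * z $ k else z $ k)"

lemma rot_nth [simp]: "rot i u z $ k = (if k = i then u * z $ k else z $ k)"
  by (simp add: rot_def)

lemma rot_commute: "rot i u (rot j v z) = rot j v (rot i u z)"
  by (simp add: vec_eq_iff)

lemma rot_rot: "rot i u (rot i v z) = rot i (u * v) z"
  by (simp add: vec_eq_iff)

lemma rot_1 [simp]: "rot i 1 z = z"
  by (simp add: vec_eq_iff)

lemma continuous_on_rot [continuous_intros]:
  "continuous_on A f \<Longrightarrow> continuous_on A g \<Longrightarrow> continuous_on A (\<lambda>x. rot i (f x) (g x))"
  unfolding continuous_on_def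
proof (intro ballI vec_tendstoI)
  fix x k assume "\<forall>x\<in>A. (f \<longlongrightarrow> f x) (at x within A)" "\<forall>x\<in>A. (g \<longlongrightarrow> g x) (at x within A)" "x \<in> A"
  then have "(f \<longlongrightarrow> f x) (at x within A)" "((\<lambda>x. g x $ k) \<longlongrightarrow> g x $ k) (at x within A)"
    by (auto intro: tendsto_vec_nth)
  then show "((\<lambda>x. rot i (f x) (g x) $ k) \<longlongrightarrow> rot i (f x) (g x) $ k) (at x within A)"
    by (cases "k = i") (auto intro: tendsto_mult)
qed

lemma continuous_on_rho: "continuous_on A (rho p)"
  unfolding rho_def by (intro continuous_intros)

lemma Omega_eq: "Omega p = {z. rho p z < 1}"
  by (simp add: Omega_def rho_def)

lemma rho_mono: "(\<And>k. cmod (z $ k) \<le> cmod (w $ k)) \<Longrightarrow> rho p z \<le> rho p w"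
  unfolding rho_def by (intro sum_mono power_mono) auto

lemma open_Omega: "open (Omega p)"
  unfolding Omega_eq by (intro open_Collect_less continuous_on_rho continuous_on_const)

lemma scaleR_nth_norm: "cmod ((r *\<^sub>R z) $ k) = \<bar>r\<bar> * cmod (z $ k)" for z :: "complex ^ 'n"
  by (simp add: norm_mult)

lemma norm_vec_le_sum: "norm z \<le> (\<Sum>k\<in>UNIV. cmod (z $ k))" for z :: "complex ^ 'n"
  unfolding norm_vec_def by (rule L2_set_le_sum) simp

locale admissible_domain =
  fixes p :: "'n::finite \<Rightarrow> nat list"
  assumes adm: "admissible p"
begin

abbreviation K where "K \<equiv> closure (Omega p)"

lemma exponent_pos: "j < length (p i) \<Longrightarrow> p i ! j \<ge> 1"
proof -
  assume "j < length (p i)"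
  then have "p i ! j \<in> set (p i)" by (rule nth_mem)
  then have "p i ! j > 0" using adm by (simp add: admissible_def)
  then show ?thesis by simp
qed

lemma length_pos: "0 < length (p i)"
proof -
  have "2 \<le> length (p i)" using adm by (simp add: admissible_def)
  then show ?thesis by linarith
qed

lemma rho_strict_mono:
  assumes "\<And>k. cmod (z $ k) \<le> cmod (w $ k)" "cmod (z $ i) < cmod (w $ i)"
  shows "rho p z < rho p w"
  unfolding rho_def
proof (rule sum_strict_mono_ex1)
  show "\<forall>i\<in>UNIV. (\<Sum>j<length (p i). cmod (z $ i) ^ (2 * p i ! j)) \<le> (\<Sum>j<length (p i). cmod (w $ i) ^ (2 * p i ! j))"
    using assms(1) by (auto intro!: sum_mono power_mono)
  have "(\<Sum>j<length (p i). cmod (z $ i) ^ (2 * p i ! j)) < (\<Sum>j<length (p i). cmod (w $ i) ^ (2 * p i ! j))"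
  proof (rule sum_strict_mono)
    show "cmod (z $ i) ^ (2 * p i ! j) < cmod (w $ i) ^ (2 * p i ! j)" if "j \<in> {..<length (p i)}" for j
      using assms(2) exponent_pos[of j i] that by (intro power_strict_mono) auto
  qed (use length_pos[of i] in auto)
  then show "\<exists>i\<in>UNIV. (\<Sum>j<length (p i). cmod (z $ i) ^ (2 * p i ! j)) < (\<Sum>j<length (p i). cmod (w $ i) ^ (2 * p i ! j))"
    by blast
qed simp

text \<open>The exponents differ, so \<open>rho\<close> is not homogeneous; but each is at least 2,
  which controls a contraction by its square.\<close>

lemma rho_scale_le:
  assumes "0 \<le> r" "r \<le> 1" shows "rho p (r *\<^sub>R z) \<le> r\<^sup>2 * rho p z"
proof -
  have "cmod ((r *\<^sub>R z) $ i) ^ (2 * p i ! j) \<le> r\<^sup>2 * cmod (z $ i) ^ (2 * p i ! j)"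
    if "j < length (p i)" for i j
  proof -
    have "r ^ (2 * p i ! j) \<le> r\<^sup>2"
      using assms exponent_pos[OF that] by (intro power_decreasing) auto
    then show ?thesis using assms(1)
      by (simp only: scaleR_nth_norm power_mult_distrib abs_of_nonneg) (rule mult_right_mono, auto)
  qed
  then show ?thesis unfolding rho_def sum_distrib_left by (intro sum_mono) auto
qed

lemma rho_scale_ge:
  assumes "1 \<le> r" shows "r\<^sup>2 * rho p z \<le> rho p (r *\<^sub>R z)"
proof -
  have "r\<^sup>2 * cmod (z $ i) ^ (2 * p i ! j) \<le> cmod ((r *\<^sub>R z) $ i) ^ (2 * p i ! j)"
    if "j < length (p i)" for i j
  proof -
    have "r\<^sup>2 \<le> r ^ (2 * p i ! j)"
      using assms exponent_pos[OF that] by (intro power_increasing) auto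
    then show ?thesis using assms
      by (simp only: scaleR_nth_norm power_mult_distrib abs_of_nonneg) (simp add: mult_right_mono)
  qed
  then show ?thesis unfolding rho_def sum_distrib_left by (intro sum_mono) auto
qed

lemma rho_0 [simp]: "rho p 0 = 0"
  unfolding rho_def using exponent_pos by (auto intro!: sum.neutral simp: Suc_le_eq)

text \<open>A point with \<open>rho p z = 1\<close> is the limit of its contractions towards 0,
  which lie inside by \<open>rho_scale_le\<close>.\<close>

lemma closure_Omega: "K = {z. rho p z \<le> 1}"
proof
  have "closed {z. rho p z \<le> 1}" by (intro closed_Collect_le continuous_on_rho continuous_on_const)
  then show "K \<subseteq> {z. rho p z \<le> 1}" by (intro closure_minimal) (auto simp: Omega_eq)
  show "{z. rho p z \<le> 1} \<subseteq> K"
  proof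
    fix z assume z: "z \<in> {z. rho p z \<le> 1}"
    have "(\<lambda>n. (1 - 1 / real (Suc n)) *\<^sub>R z) \<longlonglongrightarrow> (1 - 0) *\<^sub>R z"
      by (intro tendsto_intros LIMSEQ_Suc[OF lim_1_over_n])
    moreover have "(1 - 1 / real (Suc n)) *\<^sub>R z \<in> Omega p" for n
    proof -
      define r where "r = 1 - 1 / real (Suc n)"
      have r: "0 \<le> r" "r < 1" by (auto simp: r_def)
      have "rho p (r *\<^sub>R z) \<le> r\<^sup>2 * rho p z" using r by (intro rho_scale_le) auto
      also have "\<dots> \<le> r\<^sup>2 * 1" using z by (intro mult_left_mono) auto
      also have "\<dots> < 1" using r by (simp add: power_less_one_iff abs_square_less_1)
      finally show ?thesis by (simp add: Omega_eq r_def)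
    qed
    ultimately show "z \<in> K" unfolding closure_sequential
      by (intro exI[of _ "\<lambda>n. (1 - 1 / real (Suc n)) *\<^sub>R z"]) simp
  qed
qed

lemma frontier_Omega: "frontier (Omega p) = {z. rho p z = 1}"
  unfolding frontier_def interior_open[OF open_Omega] closure_Omega by (auto simp: Omega_eq)

lemma frontier_subset_K: "frontier (Omega p) \<subseteq> K"
  unfolding frontier_def by blast

lemma norm_nth_le_1:
  assumes "z \<in> K" shows "cmod (z $ i) \<le> 1"
proof (rule ccontr)
  assume "\<not> ?thesis"
  then have *: "1 < cmod (z $ i) ^ (2 * p i ! 0)"
    using exponent_pos[OF length_pos[of i]] by (intro one_less_power) auto
  have "cmod (z $ i) ^ (2 * p i ! 0) \<le> (\<Sum>j<length (p i). cmod (z $ i) ^ (2 * p i ! j))"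
    by (rule member_le_sum) (use length_pos[of i] in auto)
  also have "\<dots> \<le> rho p z" unfolding rho_def by (rule member_le_sum) (auto intro: sum_nonneg)
  finally show False using assms * by (simp add: closure_Omega)
qed

lemma compact_K: "compact K"
proof -
  have "norm z \<le> (\<Sum>i\<in>(UNIV::'n set). 1)" if "z \<in> K" for z
    by (rule order_trans[OF norm_vec_le_sum sum_mono]) (rule norm_nth_le_1[OF that])
  then have "bounded K" unfolding bounded_iff by blast
  then show ?thesis by (simp add: compact_eq_bounded_closed)
qed

lemma compact_frontier_Omega: "compact (frontier (Omega p))"
  using compact_K by (rule compact_frontier_bounded[OF bounded_subset[OF compact_imp_bounded closure_subset]])

text \<open>The closed domain is a complete Reinhardt set: membership depends on the moduli only,
  and monotonically.\<close>

lemma K_mono: "w \<in> K \<Longrightarrow> (\<And>k. cmod (z $ k) \<le> cmod (w $ k)) \<Longrightarrow> z \<in> K"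
  using rho_mono[of z w p] by (simp add: closure_Omega)

lemma rot_K: "z \<in> K \<Longrightarrow> cmod u \<le> 1 \<Longrightarrow> rot i u z \<in> K"
  by (erule K_mono) (auto simp: norm_mult intro: mult_left_le_one_le)

end

section \<open>Polynomial approximation\<close>

definition monomial :: "('n::finite \<Rightarrow> nat) \<Rightarrow> complex ^ 'n \<Rightarrow> complex" where
  "monomial \<alpha> z = (\<Prod>i\<in>UNIV. (z $ i) ^ \<alpha> i)"

definition circ :: "real \<Rightarrow> complex" where
  "circ t = exp (2 * of_real pi * \<i> * of_real t)"

lemma norm_circ [simp]: "cmod (circ t) = 1"
  by (simp add: circ_def norm_exp_eq_Re)

lemma continuous_on_circ [continuous_intros]: "continuous_on A f \<Longrightarrow> continuous_on A (\<lambda>x. circ (f x))"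
  unfolding circ_def by (intro continuous_intros)

lemma circ_minus_nonzero: "cmod w < 1 \<Longrightarrow> circ t - w \<noteq> 0"
  using norm_circ[of t] by auto

text \<open>The geometric series for \<open>1 / (1 - q)\<close> with
  \<open>q = w * cnj (circ t)\<close>, that is \<open>w / circ t\<close>. Keeping the remainder
  exact yields an error bound that is uniform on the domain.\<close>

lemma cauchy_kernel_expand:
  assumes "cmod w < 1"
  shows "circ t / (circ t - w) = (\<Sum>k<N. w ^ k * cnj (circ t) ^ k) + (w * cnj (circ t)) ^ N * (circ t / (circ t - w))"
proof -
  define q where "q = w * cnj (circ t)"
  have "cmod q < 1" using assms by (simp add: q_def norm_mult)
  then have q: "1 - q \<noteq> 0" by auto
  have "circ t / (circ t - w) = 1 / (1 - q)"
  proof -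
    have "circ t * cnj (circ t) = 1" using complex_norm_square[of "circ t"] by simp
    then have "circ t * (1 - q) = circ t - w" unfolding q_def by (simp add: algebra_simps)
    then show ?thesis using q circ_minus_nonzero[OF assms, of t] by (simp add: frac_eq_eq)
  qed
  moreover have "(\<Sum>k<N. q ^ k) = (1 - q ^ N) / (1 - q)"
    using q by (simp add: sum_gp_strict)
  moreover have "1 / (1 - q) = (1 - q ^ N) / (1 - q) + q ^ N * (1 / (1 - q))"
    by (simp add: add_divide_distrib[symmetric])
  ultimately show ?thesis
    unfolding power_mult_distrib[symmetric] q_def[symmetric] by (simp only:)
qed

text \<open>Strong induction: once the lower coefficients vanish, dividing by \<open>w ^ m\<close>
  for nonzero \<open>w\<close> leaves a series whose limit at 0 is \<open>a m\<close>.\<close>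

lemma powser_coeffs_zero:
  fixes a :: "nat \<Rightarrow> complex"
  assumes "\<And>w. cmod w < 1 \<Longrightarrow> (\<lambda>m. a m * w ^ m) sums 0"
  shows "a m = 0"
proof (induction m rule: less_induct)
  case (less m)
  have "((\<lambda>w. 0) \<longlongrightarrow> a (0 + m)) (at (0 :: complex))"
  proof (rule powser_limit_0_strong[where s = 1 and a = "\<lambda>k. a (k + m)"])
    fix w :: complex assume w: "w \<noteq> 0" "norm w < 1"
    have "(\<lambda>k. a (k + m) * w ^ (k + m)) sums (0 - (\<Sum>k<m. a k * w ^ k))"
      using assms[OF w(2)] by (rule sums_split_initial_segment)
    also have "(\<Sum>k<m. a k * w ^ k) = 0" using less by simp
    finally have "(\<lambda>k. (a (k + m) * w ^ (k + m)) / w ^ m) sums ((0 - 0) / w ^ m)" by (rule sums_divide)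
    then show "(\<lambda>k. a (k + m) * w ^ k) sums 0" using w(1) by (simp add: power_add)
  qed simp
  then show ?case by (simp add: LIM_const_eq tendsto_const_iff)
qed

context admissible_domain begin

text \<open>Cauchy's formula on the boundary circles, one coordinate at a time. Unlike holomorphy, this
  condition passes to the Fourier coefficients \<open>coeff_fun\<close> below by Fubini's theorem alone.\<close>

definition cauchy_functions :: "(complex ^ 'n \<Rightarrow> complex) set" where
  "cauchy_functions = {f. continuous_on K f \<and>
     (\<forall>i. \<forall>z\<in>K. \<forall>w. cmod w < 1 \<longrightarrow>
        f (rot i w z) = integral {0..1} (\<lambda>t. f (rot i (circ t) z) * (circ t / (circ t - w))))}"

lemma cauchy_functions_continuous: "f \<in> cauchy_functions \<Longrightarrow> continuous_on K f"
  and cauchy_functions_formula: "f \<in> cauchy_functions \<Longrightarrow> z \<in> K \<Longrightarrow> cmod w < 1 \<Longrightarrow>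
    f (rot i w z) = integral {0..1} (\<lambda>t. f (rot i (circ t) z) * (circ t / (circ t - w)))"
  by (auto simp: cauchy_functions_def)

lemma continuous_on_compose_rot:
  assumes "continuous_on K f" "continuous_on A g" "continuous_on A h"
    "\<And>x. x \<in> A \<Longrightarrow> cmod (g x) \<le> 1" "\<And>x. x \<in> A \<Longrightarrow> h x \<in> K"
  shows "continuous_on A (\<lambda>x. f (rot i (g x) (h x)))"
  by (rule continuous_on_compose2[OF assms(1)]) (use assms in \<open>auto intro!: continuous_intros rot_K\<close>)

text \<open>The one-variable slice is continuous on the closed disc and holomorphic inside it,
  because shrinking a nonzero coordinate strictly lowers \<open>rho\<close> and so leads into the
  open domain, even from a boundary point.\<close>

lemma A_algebra_subset_cauchy_functions:
  assumes f: "f \<in> A_algebra p" shows "f \<in> cauchy_functions"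
proof -
  have cont: "continuous_on K f" and hol: "holomorphic_several f (Omega p)"
    using f by (auto simp: A_algebra_def)
  have "f (rot i w z) = integral {0..1} (\<lambda>t. f (rot i (circ t) z) * (circ t / (circ t - w)))"
    if z: "z \<in> K" and w: "cmod w < 1" for i z w
  proof -
    let ?g = "\<lambda>u. f (rot i u z)"
    have "continuous_on (cball 0 1) ?g"
      by (rule continuous_on_compose_rot[OF cont]) (use z in \<open>auto intro: continuous_intros\<close>)
    moreover have "?g holomorphic_on ball 0 1"
    \<comment> \<open>Shrinking a zero coordinate does not move \<open>z\<close>, which may be a
      boundary point; but then the slice is constant.\<close>
    proof (cases "z $ i = 0")
      case True
      then have "rot i u z = z" for u by (simp add: vec_eq_iff)
      then show ?thesis by simp
    next
      case False
      have "?g field_differentiable at u" if u: "u \<in> ball 0 1" for u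
      proof -
        have "rho p (rot i u z) < rho p z"
          by (rule rho_strict_mono[of _ _ i])
             (use u False in \<open>auto simp: norm_mult intro: mult_left_le_one_le\<close>)
        also have "rho p z \<le> 1" using z by (simp add: closure_Omega)
        finally have "rot i u z \<in> Omega p" by (simp add: Omega_eq)
        then obtain D where D: "(f has_derivative D) (at (rot i u z))" "\<And>c v. D (c *s v) = c * D v"
          using hol unfolding holomorphic_several_def by blast
        define e where "e = (\<chi> k. if k = i then z $ i else 0)"
        define b where "b = rot i 0 z"
        \<comment> \<open>The slice is affine in \<open>u\<close> with direction \<open>e\<close>,
          so by complex linearity of \<open>D\<close> its derivative is multiplication by
          \<open>D e\<close>.\<close>
        have r: "rot i u z = u *s e + b" for u
          by (auto simp: vec_eq_iff e_def b_def)
        have "((\<lambda>u. rot i u z) has_derivative (\<lambda>h. h *s e)) (at u)"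
          unfolding r[abs_def]
        proof -
          have "bounded_linear (\<lambda>h::complex. h *s e)"
            by (rule bounded_linearI') (auto simp: vec_eq_iff algebra_simps)
          from has_derivative_add[OF bounded_linear_imp_has_derivative[OF this] has_derivative_const]
          show "((\<lambda>u. u *s e + b) has_derivative (\<lambda>h. h *s e)) (at u)" by simp
        qed
        from has_derivative_compose[OF this D(1)]
        have "(?g has_derivative (\<lambda>h. D e * h)) (at u)" by (simp add: D(2) mult.commute)
        then show ?thesis unfolding field_differentiable_def has_field_derivative_def by blast
      qed
      then show ?thesis by (auto simp: holomorphic_on_def intro: field_differentiable_at_within)
    qed
    ultimately have "((\<lambda>u. ?g u / (u - w)) has_contour_integral (2 * of_real pi * \<i> * ?g w)) (circlepath 0 1)"
      using w by (intro Cauchy_integral_circlepath) auto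
    then have "((\<lambda>t. ?g (circ t) / (circ t - w) * (2 * of_real pi * \<i> * circ t)) has_integral
        (2 * of_real pi * \<i> * ?g w)) {0..1}"
      unfolding has_contour_integral vector_derivative_circlepath
      by (simp add: circlepath circ_def)
    from has_integral_mult_right[OF this, of "1 / (2 * of_real pi * \<i>)"]
    have "((\<lambda>t. f (rot i (circ t) z) * (circ t / (circ t - w))) has_integral ?g w) {0..1}"
      by (simp add: mult_ac)
    then show ?thesis by (simp add: integral_unique)
  qed
  then show ?thesis using cont by (simp add: cauchy_functions_def)
qed

section \<open>Fourier coefficients in one coordinate\<close>

definition coeff_fun :: "'n \<Rightarrow> nat \<Rightarrow> (complex ^ 'n \<Rightarrow> complex) \<Rightarrow> complex ^ 'n \<Rightarrow> complex" where
  "coeff_fun i k f z = integral {0..1} (\<lambda>t. f (rot i (circ t) z) * cnj (circ t) ^ k)"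

lemma integrable_circle:
  fixes f :: "complex ^ 'n \<Rightarrow> complex"
  assumes "continuous_on K f" "z \<in> K" "continuous_on {0..1} h"
  shows "(\<lambda>t. f (rot i (circ t) z) * h t) integrable_on {0..1}"
proof (rule integrable_continuous_real)
  have "continuous_on {0..1} (\<lambda>t. f (rot i (circ t) z))"
    by (rule continuous_on_compose_rot[OF assms(1)]) (use assms(2) in \<open>auto intro!: continuous_intros\<close>)
  then show "continuous_on {0..1} (\<lambda>t. f (rot i (circ t) z) * h t)"
    using assms(3) by (rule continuous_on_mult)
qed

lemma coeff_fun_continuous:
  assumes f: "continuous_on K f" shows "continuous_on K (coeff_fun i k f)"
proof -
  have "continuous_on (K \<times> cbox 0 1) (\<lambda>(z, t). f (rot i (circ t) z) * cnj (circ t) ^ k)"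
    unfolding split_beta
    by (intro continuous_intros continuous_on_compose_rot[OF f]) auto
  from integral_continuous_on_param[OF this] show ?thesis
    unfolding coeff_fun_def[abs_def] by (simp add: cbox_interval)
qed

lemma coeff_fun_cauchy:
  assumes f: "f \<in> cauchy_functions" shows "coeff_fun i k f \<in> cauchy_functions"
  unfolding cauchy_functions_def
proof (safe)
  note cont = cauchy_functions_continuous[OF f]
  show "continuous_on K (coeff_fun i k f)" by (rule coeff_fun_continuous[OF cont])
  fix j z w assume z: "z \<in> K" and w: "cmod w < 1"
  let ?G = "\<lambda>s t. f (rot j (circ s) (rot i (circ t) z)) * (circ s / (circ s - w)) * cnj (circ t) ^ k"
  have rK: "rot i (circ t) z \<in> K" for i t using z by (intro rot_K) auto
  have "coeff_fun i k f (rot j w z) = integral {0..1} (\<lambda>t. f (rot j w (rot i (circ t) z)) * cnj (circ t) ^ k)"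
    unfolding coeff_fun_def by (subst rot_commute) (rule refl)
  also have "\<dots> = integral {0..1} (\<lambda>t. integral {0..1} (\<lambda>s. ?G s t))"
    unfolding cauchy_functions_formula[OF f rK w] integral_mult_left[symmetric] ..
  also have "\<dots> = integral {0..1} (\<lambda>s. integral {0..1} (\<lambda>t. ?G s t))"
  proof -
    have "continuous_on (cbox (0,0) (1,1)) (\<lambda>(t, s). ?G s t)"
      unfolding split_beta
      by (intro continuous_intros continuous_on_compose_rot[OF cont] rK)
         (use circ_minus_nonzero[OF w] in auto)
    from integral_swap_continuous[OF this] show ?thesis by (simp add: cbox_interval)
  qed
  also have "\<dots> = integral {0..1} (\<lambda>s. coeff_fun i k f (rot j (circ s) z) * (circ s / (circ s - w)))"
    unfolding coeff_fun_def integral_mult_left[symmetric] rot_commute[of i "circ _" j]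
    by (simp only: mult_ac)
  finally show "coeff_fun i k f (rot j w z)
      = integral {0..1} (\<lambda>s. coeff_fun i k f (rot j (circ s) z) * (circ s / (circ s - w)))" .
qed

lemma bounded_on_K:
  assumes "continuous_on K f" obtains B where "B \<ge> 0" "\<And>z. z \<in> K \<Longrightarrow> cmod (f z) \<le> B"
proof -
  have "bounded (f ` K)" by (intro compact_imp_bounded compact_continuous_image assms compact_K)
  then obtain B where "\<And>z. z \<in> K \<Longrightarrow> cmod (f z) \<le> B" by (auto simp: bounded_iff)
  then have "\<And>z. z \<in> K \<Longrightarrow> cmod (f z) \<le> \<bar>B\<bar>" by (meson abs_ge_self order_trans)
  then show ?thesis using that[of "\<bar>B\<bar>"] by simp
qed

text \<open>The integrated remainder of \<open>cauchy_kernel_expand\<close>. The bound involves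
  \<open>cmod w\<close> but not \<open>z\<close>, so for a fixed contraction the partial sums
  converge uniformly on \<open>K\<close>.\<close>

lemma coeff_fun_expansion:
  assumes f: "f \<in> cauchy_functions" and B: "\<And>z. z \<in> K \<Longrightarrow> cmod (f z) \<le> B"
    and z: "z \<in> K" and w: "cmod w < 1"
  shows "cmod (f (rot i w z) - (\<Sum>k<N. w ^ k * coeff_fun i k f z)) \<le> B * cmod w ^ N / (1 - cmod w)"
proof -
  note cont = cauchy_functions_continuous[OF f]
  have rK: "rot i (circ t) z \<in> K" for t using z by (intro rot_K) auto
  have int: "(\<lambda>t. f (rot i (circ t) z) * cnj (circ t) ^ k) integrable_on {0..1}" for k
    by (intro integrable_circle cont z continuous_intros)
  let ?R = "\<lambda>t. f (rot i (circ t) z) * ((w * cnj (circ t)) ^ N * (circ t / (circ t - w)))"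
  have intR: "?R integrable_on {0..1}"
    by (intro integrable_circle cont z continuous_intros) (use circ_minus_nonzero[OF w] in auto)
  have "f (rot i w z) = integral {0..1} (\<lambda>t. (\<Sum>k<N. w ^ k * (f (rot i (circ t) z) * cnj (circ t) ^ k)) + ?R t)"
    unfolding cauchy_functions_formula[OF f z w]
    by (subst cauchy_kernel_expand[OF w, of _ N]) (simp add: distrib_left sum_distrib_left mult_ac)
  also have "\<dots> = (\<Sum>k<N. w ^ k * coeff_fun i k f z) + integral {0..1} ?R"
    unfolding coeff_fun_def using int intR
    by (subst Henstock_Kurzweil_Integration.integral_add)
       (auto intro!: integrable_sum integrable_on_mult_right simp: Henstock_Kurzweil_Integration.integral_sum integrable_on_mult_right)
  finally have "f (rot i w z) - (\<Sum>k<N. w ^ k * coeff_fun i k f z) = integral {0..1} ?R" by simp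
  also have "cmod \<dots> \<le> (B * cmod w ^ N / (1 - cmod w)) * (1 - 0)"
  proof (rule integral_bound)
    fix t :: real
    have "1 - cmod w \<le> cmod (circ t - w)" using norm_triangle_ineq2[of "circ t" w] by simp
    then have "1 / cmod (circ t - w) \<le> 1 / (1 - cmod w)" using w by (intro divide_left_mono mult_pos_pos) auto
    then have "cmod w ^ N * (1 / cmod (circ t - w)) \<le> cmod w ^ N * (1 / (1 - cmod w))" by (intro mult_left_mono) auto
    then have "cmod (f (rot i (circ t) z)) * (cmod w ^ N * (1 / cmod (circ t - w)))
        \<le> B * (cmod w ^ N * (1 / (1 - cmod w)))"
      by (rule mult_mono[OF B[OF rK[of t]]]) (use order_trans[OF norm_ge_zero B[OF rK[of t]]] in auto)
    then show "cmod (?R t) \<le> B * cmod w ^ N / (1 - cmod w)"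
      by (simp add: norm_mult norm_divide norm_power)
  qed (use w z in \<open>auto intro!: continuous_intros continuous_on_compose_rot[OF cont]\<close>)
  finally show ?thesis by simp
qed

lemma coeff_fun_sums:
  assumes f: "f \<in> cauchy_functions" and z: "z \<in> K" and w: "cmod w < 1"
  shows "(\<lambda>k. coeff_fun i k f z * w ^ k) sums f (rot i w z)"
proof -
  obtain B where B: "\<And>z. z \<in> K \<Longrightarrow> cmod (f z) \<le> B"
    using bounded_on_K[OF cauchy_functions_continuous[OF f]] by blast
  have "(\<lambda>N. B * cmod w ^ N / (1 - cmod w)) \<longlonglongrightarrow> B * 0 / (1 - cmod w)"
    using w by (intro tendsto_intros LIMSEQ_power_zero) auto
  then have lim0: "(\<lambda>N. B * cmod w ^ N / (1 - cmod w)) \<longlonglongrightarrow> 0" by simp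
  have "(\<lambda>N. f (rot i w z) - (\<Sum>k<N. w ^ k * coeff_fun i k f z)) \<longlonglongrightarrow> 0"
    by (rule Lim_null_comparison[OF _ lim0]) (use coeff_fun_expansion[OF f B z w] in auto)
  from tendsto_diff[OF tendsto_const[of "f (rot i w z)"] this]
  show ?thesis unfolding sums_def by (simp add: mult.commute)
qed

text \<open>Homogeneity of degree \<open>k\<close> in one coordinate, demanded on the whole closed
  disc and not only on the circle, so that points with different moduli can be compared.\<close>

definition weighted :: "'n \<Rightarrow> nat \<Rightarrow> (complex ^ 'n \<Rightarrow> complex) \<Rightarrow> bool" where
  "weighted i k f \<longleftrightarrow> (\<forall>z\<in>K. \<forall>u. cmod u \<le> 1 \<longrightarrow> f (rot i u z) = u ^ k * f z)"

text \<open>\<open>f (rot i (w * u) z)\<close> has two expansions in powers of \<open>w\<close>, one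
  around \<open>rot i u z\<close> and one around \<open>z\<close>; comparing coefficients gives the
  factor \<open>u ^ k\<close>.\<close>

lemma coeff_fun_weighted:
  assumes f: "f \<in> cauchy_functions" shows "weighted i k (coeff_fun i k f)"
  unfolding weighted_def
proof (intro ballI allI impI)
  fix z u assume z: "z \<in> K" and u: "cmod u \<le> 1"
  have "coeff_fun i m f (rot i u z) - coeff_fun i m f z * u ^ m = 0" for m
  proof (rule powser_coeffs_zero[where a = "\<lambda>m. coeff_fun i m f (rot i u z) - coeff_fun i m f z * u ^ m"])
    fix w :: complex assume w: "cmod w < 1"
    have "cmod (w * u) < 1" using w u mult_right_le_one_le[of "cmod w" "cmod u"] by (simp add: norm_mult)
    from sums_diff[OF coeff_fun_sums[OF f rot_K[OF z u] w, of i i] coeff_fun_sums[OF f z this, of i]]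
    show "(\<lambda>m. (coeff_fun i m f (rot i u z) - coeff_fun i m f z * u ^ m) * w ^ m) sums 0"
      by (simp add: rot_rot algebra_simps power_mult_distrib)
  qed
  then show "coeff_fun i k f (rot i u z) = u ^ k * coeff_fun i k f z" by (simp add: mult.commute)
qed

text \<open>Homogeneity already achieved in other coordinates survives the averaging, as rotations
  commute.\<close>

lemma coeff_fun_weighted_other:
  assumes f: "weighted j l f" shows "weighted j l (coeff_fun i k f)"
  unfolding weighted_def
proof (intro ballI allI impI)
  fix z u assume z: "z \<in> K" and u: "cmod u \<le> 1"
  have "f (rot i (circ t) (rot j u z)) = u ^ l * f (rot i (circ t) z)" for t
    using f rot_K[OF z, of "circ t" i] u unfolding weighted_def rot_commute[of i] by simp
  then show "coeff_fun i k f (rot j u z) = u ^ l * coeff_fun i k f z"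
    unfolding coeff_fun_def by (simp add: mult.assoc integral_mult_right)
qed

definition poly_approx :: "(complex ^ 'n \<Rightarrow> complex) \<Rightarrow> bool" where
  "poly_approx f \<longleftrightarrow> (\<forall>e>0. \<exists>G a. finite G \<and> (\<forall>z\<in>K. cmod (f z - (\<Sum>\<alpha>\<in>G. a \<alpha> * monomial \<alpha> z)) < e))"

lemma poly_approx_limit:
  assumes "\<And>e. e > 0 \<Longrightarrow> \<exists>g. poly_approx g \<and> (\<forall>z\<in>K. cmod (f z - g z) < e)"
  shows "poly_approx f"
  unfolding poly_approx_def
proof (intro allI impI)
  fix e :: real assume "e > 0"
  then have e: "e / 2 > 0" by simp
  obtain g where g: "poly_approx g" "\<And>z. z\<in>K \<Longrightarrow> cmod (f z - g z) < e / 2" using assms[OF e] by blast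
  then obtain G a where Ga: "finite G" "\<And>z. z\<in>K \<Longrightarrow> cmod (g z - (\<Sum>\<alpha>\<in>G. a \<alpha> * monomial \<alpha> z)) < e / 2"
    using e unfolding poly_approx_def by meson
  have "cmod (f z - (\<Sum>\<alpha>\<in>G. a \<alpha> * monomial \<alpha> z)) < e" if "z \<in> K" for z
    using norm_triangle_ineq[of "f z - g z" "g z - (\<Sum>\<alpha>\<in>G. a \<alpha> * monomial \<alpha> z)"] g(2)[OF that] Ga(2)[OF that]
    by simp
  then show "\<exists>G a. finite G \<and> (\<forall>z\<in>K. cmod (f z - (\<Sum>\<alpha>\<in>G. a \<alpha> * monomial \<alpha> z)) < e)"
    using Ga(1) by blast
qed

lemma poly_approx_monom: "poly_approx (\<lambda>z. c * monomial \<alpha> z)"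
  unfolding poly_approx_def by (auto intro!: exI[of _ "{\<alpha>}"] exI[of _ "\<lambda>_. c"])

lemma poly_approx_cmult_add:
  assumes "poly_approx f" "poly_approx g" shows "poly_approx (\<lambda>z. f z + c * g z)"
  unfolding poly_approx_def
proof (intro allI impI)
  fix e :: real assume e: "e > 0"
  define d where "d = e / 2 / (cmod c + 1)"
  have c: "cmod c + 1 > 0" by (simp add: add_nonneg_pos)
  have d: "d > 0" using e c by (simp add: d_def)
  obtain G a where G: "finite G" "\<And>z. z \<in> K \<Longrightarrow> cmod (f z - (\<Sum>\<alpha>\<in>G. a \<alpha> * monomial \<alpha> z)) < e / 2"
    using assms(1) half_gt_zero[OF e] unfolding poly_approx_def by meson
  obtain G' a' where G': "finite G'" "\<And>z. z \<in> K \<Longrightarrow> cmod (g z - (\<Sum>\<alpha>\<in>G'. a' \<alpha> * monomial \<alpha> z)) < d"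
    using assms(2) d unfolding poly_approx_def by meson
  define b where "b \<alpha> = (if \<alpha> \<in> G then a \<alpha> else 0) + c * (if \<alpha> \<in> G' then a' \<alpha> else 0)" for \<alpha>
  have "cmod (f z + c * g z - (\<Sum>\<alpha>\<in>G \<union> G'. b \<alpha> * monomial \<alpha> z)) < e" if z: "z \<in> K" for z
  proof -
    have "(\<Sum>\<alpha>\<in>G \<union> G'. b \<alpha> * monomial \<alpha> z)
        = (\<Sum>\<alpha>\<in>G \<union> G'. if \<alpha> \<in> G then a \<alpha> * monomial \<alpha> z else 0)
          + c * (\<Sum>\<alpha>\<in>G \<union> G'. if \<alpha> \<in> G' then a' \<alpha> * monomial \<alpha> z else 0)"
      unfolding sum_distrib_left sum.distrib[symmetric] b_def
      by (intro sum.cong) (auto simp: algebra_simps)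
    also have "(\<Sum>\<alpha>\<in>G \<union> G'. if \<alpha> \<in> G then a \<alpha> * monomial \<alpha> z else 0) = (\<Sum>\<alpha>\<in>G. a \<alpha> * monomial \<alpha> z)"
      using G(1) G'(1) by (simp add: sum.If_cases Int_absorb1)
    also have "(\<Sum>\<alpha>\<in>G \<union> G'. if \<alpha> \<in> G' then a' \<alpha> * monomial \<alpha> z else 0) = (\<Sum>\<alpha>\<in>G'. a' \<alpha> * monomial \<alpha> z)"
      using G(1) G'(1) by (simp add: sum.If_cases Int_absorb1)
    finally have eq: "f z + c * g z - (\<Sum>\<alpha>\<in>G \<union> G'. b \<alpha> * monomial \<alpha> z)
       = (f z - (\<Sum>\<alpha>\<in>G. a \<alpha> * monomial \<alpha> z)) + c * (g z - (\<Sum>\<alpha>\<in>G'. a' \<alpha> * monomial \<alpha> z))"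
      by (simp add: algebra_simps)
    have "cmod (c * (g z - (\<Sum>\<alpha>\<in>G'. a' \<alpha> * monomial \<alpha> z))) \<le> (cmod c + 1) * d"
      unfolding norm_mult using G'(2)[OF z] by (intro mult_mono) auto
    also have "(cmod c + 1) * d = e / 2"
      unfolding d_def
      by (subst times_divide_eq_right, rule nonzero_mult_div_cancel_left) (use c in linarith)
    finally show ?thesis unfolding eq using G(2)[OF z] by (intro norm_triangle_lt) linarith
  qed
  then show "\<exists>G a. finite G \<and> (\<forall>z\<in>K. cmod (f z + c * g z - (\<Sum>\<alpha>\<in>G. a \<alpha> * monomial \<alpha> z)) < e)"
    using G(1) G'(1) by (intro exI[of _ "G \<union> G'"] exI[of _ b]) auto
qed

lemma poly_approx_sum:
  "finite I \<Longrightarrow> (\<And>k. k \<in> I \<Longrightarrow> poly_approx (f k)) \<Longrightarrow> poly_approx (\<lambda>z. \<Sum>k\<in>I. c k * f k z)"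
proof (induction I rule: finite_induct)
  case empty
  show ?case using poly_approx_monom[of 0] by simp
next
  case (insert k I)
  then have "poly_approx (\<lambda>z. (\<Sum>k\<in>I. c k * f k z) + c k * f k z)" by (intro poly_approx_cmult_add) auto
  then show ?case using insert by (simp add: add.commute)
qed

text \<open>Supplies a base point without zero coordinates, at which no monomial vanishes.\<close>

lemma ex_pos_const_in_K: "\<exists>d. 0 < d \<and> d \<le> 1 \<and> (\<chi> i. complex_of_real d) \<in> K"
proof -
  have "open (Omega p)" by (rule open_Omega)
  moreover have "0 \<in> Omega p" by (simp add: Omega_eq)
  ultimately obtain e where e: "e > 0" "cball 0 e \<subseteq> Omega p" by (meson open_contains_cball)
  define d where "d = min 1 (e / real CARD('n))"
  have d: "0 < d" "d \<le> 1" using e by (auto simp: d_def)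
  have "norm (\<chi> i::'n. complex_of_real d) \<le> (\<Sum>i\<in>(UNIV::'n set). d)"
    by (rule order_trans[OF norm_vec_le_sum]) (use d in auto)
  also have "\<dots> \<le> e" by (simp add: d_def min_def field_simps)
  finally have "(\<chi> i::'n. complex_of_real d) \<in> Omega p" using e by auto
  then show ?thesis using d closure_subset by blast
qed

lemma weighted_multi:
  assumes "finite I" "\<And>i. weighted i (k i) f" "\<And>i. cmod (u i) \<le> 1" "z \<in> K"
  shows "f (\<chi> i. if i \<in> I then u i * z $ i else z $ i) = (\<Prod>i\<in>I. u i ^ k i) * f z
    \<and> (\<chi> i. if i \<in> I then u i * z $ i else z $ i) \<in> K"
  using assms(1)
proof (induction I rule: finite_induct)
  case empty
  then show ?case using assms(4) by (simp add: vec_lambda_eta)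
next
  case (insert j I)
  let ?w = "\<chi> i. if i \<in> I then u i * z $ i else z $ i"
  have "(\<chi> i. if i \<in> insert j I then u i * z $ i else z $ i) = rot j (u j) ?w"
    using insert(2) by (auto simp: vec_eq_iff)
  moreover have "f (rot j (u j) ?w) = u j ^ k j * f ?w"
    using assms(2)[of j] assms(3)[of j] insert.IH unfolding weighted_def by blast
  ultimately show ?case using insert rot_K[of ?w "u j" j] assms(3)[of j] by simp
qed

text \<open>The point \<open>d * z\<close> is reached in two ways: by scaling \<open>z\<close> with
  the constant \<open>d\<close>, and by scaling the constant vector \<open>?o\<close> with the
  coordinates of \<open>z\<close>. Equating the two values of \<open>f\<close> expresses
  \<open>f z\<close> through \<open>f ?o\<close>.\<close>

lemma weighted_monomial:
  assumes "\<And>i. weighted i (k i) f"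
  shows "\<exists>c. \<forall>z\<in>K. f z = c * monomial k z"
proof -
  obtain d where d: "0 < d" "d \<le> 1" "(\<chi> i. complex_of_real d) \<in> K" using ex_pos_const_in_K by blast
  let ?o = "\<chi> i::'n. complex_of_real d"
  have "f z = (f ?o / (\<Prod>i\<in>UNIV. of_real d ^ k i)) * monomial k z" if z: "z \<in> K" for z
  proof -
    have "f (\<chi> i. complex_of_real d * z $ i) = (\<Prod>i\<in>UNIV. of_real d ^ k i) * f z"
      using weighted_multi[of UNIV k f "\<lambda>_. of_real d" z] assms z d by simp
    moreover have "f (\<chi> i. z $ i * complex_of_real d) = (\<Prod>i\<in>UNIV. (z $ i) ^ k i) * f ?o"
      using weighted_multi[of UNIV k f "\<lambda>i. z $ i" ?o] assms norm_nth_le_1[OF z] d by simp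
    moreover have "(\<Prod>i\<in>(UNIV::'n set). complex_of_real d ^ k i) \<noteq> 0" using d by auto
    ultimately show ?thesis by (simp add: monomial_def field_simps)
  qed
  then show ?thesis by blast
qed

text \<open>\<open>I\<close> holds the coordinates in which homogeneity is still missing. To remove
  one, contract it slightly and truncate the expansion there: the coefficients are homogeneous in
  that coordinate and keep their other weights. With \<open>I\<close> empty only multiples of a
  monomial remain.\<close>

lemma weighted_poly_approx:
  assumes "finite I" "f \<in> cauchy_functions" "\<And>i. i \<notin> I \<Longrightarrow> \<exists>k. weighted i k f"
  shows "poly_approx f"
  using assms
proof (induction I arbitrary: f rule: finite_induct)
  case empty
  then obtain k where "\<And>i. weighted i (k i) f" by (metis empty_iff)
  then obtain c where c: "\<forall>z\<in>K. f z = c * monomial k z" using weighted_monomial by blast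
  show ?case
    by (rule poly_approx_limit) (use c poly_approx_monom[of c k] in \<open>auto intro!: exI[of _ "\<lambda>z. c * monomial k z"]\<close>)
next
  case (insert i I)
  note cont = cauchy_functions_continuous[OF insert.prems(1)]
  have B: "poly_approx (coeff_fun i k f)" for k
  proof (rule insert.IH[OF coeff_fun_cauchy[OF insert.prems(1)]])
    fix j assume "j \<notin> I"
    then show "\<exists>l. weighted j l (coeff_fun i k f)"
      using coeff_fun_weighted[OF insert.prems(1)] coeff_fun_weighted_other insert.prems(2)[of j]
      by (cases "j = i") blast+
  qed
  obtain M where M: "M \<ge> 0" "\<And>z. z \<in> K \<Longrightarrow> cmod (f z) \<le> M" using bounded_on_K[OF cont] by blast
  show ?case
  proof (rule poly_approx_limit)
    fix e :: real assume e: "e > 0"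
    have "uniformly_continuous_on K f" by (rule compact_uniformly_continuous[OF cont compact_K])
    then obtain d where d: "d > 0" "\<And>z z'. z \<in> K \<Longrightarrow> z' \<in> K \<Longrightarrow> dist z' z < d \<Longrightarrow> dist (f z') (f z) < e / 2"
      unfolding uniformly_continuous_on_def using half_gt_zero[OF e] by meson
    \<comment> \<open>The contraction moves a point of \<open>K\<close> by at most
      \<open>1 - r\<close>, which is below the modulus \<open>d\<close> of uniform
      continuity.\<close>
    define r where "r = max 0 (1 - d / 2)"
    have r: "0 \<le> r" "r < 1" "1 - r < d" using d(1) by (auto simp: r_def)
    have "(\<lambda>N. M * r ^ N / (1 - r)) \<longlonglongrightarrow> M * 0 / (1 - r)"
      using r by (intro tendsto_intros LIMSEQ_power_zero) auto
    then have "\<forall>\<^sub>F N in sequentially. M * r ^ N / (1 - r) < e / 2"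
      using e by (intro order_tendstoD(2)[where y = "M * 0 / (1 - r)"]) auto
    then obtain N where N: "M * r ^ N / (1 - r) < e / 2" by (auto simp: eventually_sequentially)
    have "cmod (f z - (\<Sum>k<N. of_real r ^ k * coeff_fun i k f z)) < e" if z: "z \<in> K" for z
    proof -
      have rz: "rot i (of_real r) z \<in> K" using r by (intro rot_K z) auto
      have "dist (rot i (of_real r) z) z \<le> (\<Sum>k\<in>UNIV. cmod ((rot i (of_real r) z - z) $ k))"
        unfolding dist_norm by (rule norm_vec_le_sum)
      also have "\<dots> = (\<Sum>k\<in>UNIV. if k = i then cmod (of_real r * z $ i - z $ i) else 0)"
        by (intro sum.cong) auto
      also have "\<dots> = cmod (of_real (r - 1) * z $ i)" by (simp add: algebra_simps)
      also have "\<dots> \<le> (1 - r) * 1" unfolding norm_mult norm_of_real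
        using r norm_nth_le_1[OF z, of i] by (intro mult_mono) auto
      finally have "dist (f (rot i (of_real r) z)) (f z) < e / 2" using d(2)[OF z rz] r by simp
      moreover have "cmod (f (rot i (of_real r) z) - (\<Sum>k<N. of_real r ^ k * coeff_fun i k f z)) < e / 2"
      proof -
        have cr: "cmod (of_real r) = r" using r by simp
        then have "cmod (of_real r) < 1" using r by simp
        from coeff_fun_expansion[OF insert.prems(1) M(2) z this, of i N] N show ?thesis
          unfolding cr by linarith
      qed
      ultimately show ?thesis
        using norm_triangle_ineq[of "f z - f (rot i (of_real r) z)"
            "f (rot i (of_real r) z) - (\<Sum>k<N. of_real r ^ k * coeff_fun i k f z)"]
        by (simp add: dist_norm norm_minus_commute)
    qed
    then show "\<exists>g. poly_approx g \<and> (\<forall>z\<in>K. cmod (f z - g z) < e)"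
      by (intro exI[of _ "\<lambda>z. \<Sum>k<N. of_real r ^ k * coeff_fun i k f z"] conjI poly_approx_sum ballI) (auto intro: B)
  qed
qed

theorem A_algebra_poly_approx:
  assumes "f \<in> A_algebra p" shows "poly_approx f"
  using weighted_poly_approx[of UNIV f] A_algebra_subset_cauchy_functions[OF assms] by simp

end

section \<open>Surface measure\<close>

lemma diameter_isometry_image:
  assumes "\<And>x y. dist (R x) (R y) = dist x y"
  shows "diameter (R ` U) = diameter U"
proof -
  have "(\<lambda>(x, y). dist x y) ` (R ` U \<times> R ` U) = (\<lambda>(x, y). dist x y) ` (U \<times> U)"
    by (force simp: assms)
  then show ?thesis by (simp add: diameter_def)
qed

lemma bounded_isometry_image:
  assumes R: "\<And>x y. dist (R x) (R y) = dist x y" and U: "bounded U"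
  shows "bounded (R ` U)"
proof -
  obtain x e where "\<forall>y\<in>U. dist x y \<le> e" using U by (auto simp: bounded_def)
  then have "\<forall>y\<in>R ` U. dist (R x) y \<le> e" by (simp add: R)
  then show ?thesis unfolding bounded_def by blast
qed

lemma hausdorff_premeasure_isometry_le:
  assumes R: "\<And>x y. dist (R x) (R y) = dist x y"
  shows "hausdorff_premeasure k \<delta> (R ` A) \<le> hausdorff_premeasure k \<delta> A"
  unfolding hausdorff_premeasure_def
proof (rule INF_greatest)
  fix U :: "nat \<Rightarrow> _"
  assume U: "U \<in> {U. A \<subseteq> (\<Union>i. U i) \<and> (\<forall>i. bounded (U i) \<and> diameter (U i) \<le> \<delta>)}"
  show "(INF U \<in> {U. R ` A \<subseteq> (\<Union>i. U i) \<and> (\<forall>i. bounded (U i) \<and> diameter (U i) \<le> \<delta>)}.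
        \<Sum>i. ennreal (unit_ball_vol (real k) * (diameter (U i) / 2) ^ k))
      \<le> (\<Sum>i. ennreal (unit_ball_vol (real k) * (diameter (U i) / 2) ^ k))"
  proof (rule INF_lower2[of "\<lambda>i. R ` U i"])
    have "R ` A \<subseteq> (\<Union>i. R ` U i)" using U by blast
    then show "(\<lambda>i. R ` U i) \<in> {U. R ` A \<subseteq> (\<Union>i. U i) \<and> (\<forall>i. bounded (U i) \<and> diameter (U i) \<le> \<delta>)}"
      using U by (simp add: diameter_isometry_image[OF R] bounded_isometry_image[OF R])
  qed (simp add: diameter_isometry_image[OF R])
qed

lemma hausdorff_outer_isometry:
  assumes R: "\<And>x y. dist (R x) (R y) = dist x y" and S: "\<And>x y. dist (S x) (S y) = dist x y"
    and inv: "\<And>x. S (R x) = x"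
  shows "hausdorff_outer k (R ` A) = hausdorff_outer k A"
proof -
  have "hausdorff_premeasure k \<delta> A \<le> hausdorff_premeasure k \<delta> (R ` A)" for \<delta>
    using hausdorff_premeasure_isometry_le[OF S, of k \<delta> "R ` A"] by (simp add: image_image inv)
  then have "hausdorff_premeasure k \<delta> (R ` A) = hausdorff_premeasure k \<delta> A" for \<delta>
    using hausdorff_premeasure_isometry_le[OF R] by (intro antisym)
  then show ?thesis by (simp add: hausdorff_outer_def)
qed

lemma sigma_sets_borel: "sigma_sets UNIV (sets borel) = sets (borel :: 'a::topological_space measure)"
  using sets.sigma_sets_eq[of "borel :: 'a measure"] by simp

lemma space_hausdorff_measure [simp]: "space (hausdorff_measure k) = UNIV"
  by (simp add: hausdorff_measure_def space_measure_of_conv)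

lemma sets_hausdorff_measure [simp]: "sets (hausdorff_measure k) = sets borel"
  by (simp add: hausdorff_measure_def sets_measure_of_conv sigma_sets_borel)

text \<open>By the convention for \<open>measure_of\<close>, the measure would be null if countable additivity failed;
  the proof covers that case, so additivity of the Hausdorff measure is never needed.\<close>

lemma emeasure_hausdorff_measure:
  "emeasure (hausdorff_measure k) A =
     (if A \<in> sets borel \<and> measure_space UNIV (sets borel) (hausdorff_outer k :: 'a::metric_space set \<Rightarrow> ennreal)
      then hausdorff_outer k A else 0)" for A :: "'a::metric_space set"
  unfolding hausdorff_measure_def emeasure_measure_of_conv sigma_sets_borel ..

text \<open>The dilates \<open>t \<cdot> B\<close>, \<open>1 \<le> t \<le> 2\<close>, of a set of small diameter \<open>d\<close> are covered by about \<open>1 / d\<close>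
  balls of radius comparable to \<open>d\<close>.\<close>

lemma cone_cover:
  fixes a :: "'a::euclidean_space"
  assumes D: "DIM('a) \<ge> 2" and R: "norm a \<le> R" and d: "0 \<le> d" "d \<le> 1"
  shows "\<exists>W\<in>sets lborel. (\<forall>t\<in>{1..2}. \<forall>x\<in>cball a d. t *\<^sub>R x \<in> W) \<and>
     emeasure lborel W \<le> ennreal (3 * unit_ball_vol (real DIM('a)) * (R + 2) ^ DIM('a) * d ^ (DIM('a) - 1))"
proof -
  define C where "C = 3 * unit_ball_vol (real DIM('a)) * (R + 2) ^ DIM('a)"
  define W where "W = (\<lambda>(t, x). t *\<^sub>R x) ` ({1..2} \<times> cball a d)"
  have R0: "R \<ge> 0" using R norm_ge_zero order_trans by blast
  have C0: "C \<ge> 0" using R0 by (auto simp: C_def intro!: mult_nonneg_nonneg)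
  have "compact W" unfolding W_def
    by (intro compact_continuous_image compact_Times) (auto intro!: continuous_intros simp: split_beta)
  then have W: "W \<in> sets lborel" by (auto intro: compact_imp_closed borel_closed)
  \<comment> \<open>A positive radius \<open>e \<ge> d\<close> replaces \<open>d\<close>, since the
    number of balls is about \<open>1 / e\<close>; the case \<open>d = 0\<close> follows by letting
    \<open>e\<close> tend to 0.\<close>
  have le: "emeasure lborel W \<le> ennreal (C * e ^ (DIM('a) - 1))" if e: "0 < e" "d \<le> e" "e \<le> 1" for e
  proof -
    define m where "m = nat \<lceil>1 / e\<rceil>"
    have m: "1 / e \<le> real m" "real m \<le> 1 / e + 1" using e by (auto simp: m_def)
    have m0: "m > 0" using m(1) e by (metis divide_pos_pos less_le_trans of_nat_0_less_iff zero_less_one)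
    \<comment> \<open>The grid of dilation factors has step at most \<open>e\<close>: rounding
      \<open>t\<close> costs \<open>e * R\<close>, and replacing \<open>x\<close> by
      \<open>a\<close> costs at most \<open>2 * e\<close>.\<close>
    define r where "r = (R + 2) * e"
    define B where "B l = cball ((1 + real l / real m) *\<^sub>R a) r" for l :: nat
    have "W \<subseteq> (\<Union>l\<in>{..m}. B l)"
    proof
      fix y assume "y \<in> W"
      then obtain t x where y: "y = t *\<^sub>R x" "1 \<le> t" "t \<le> 2" "dist a x \<le> d" by (auto simp: W_def)
      define l where "l = nat \<lfloor>(t - 1) * real m\<rfloor>"
      have l: "real l \<le> (t - 1) * real m" "(t - 1) * real m \<le> real l + 1"
        using y(2) by (auto simp: l_def)
      have "(t - 1) * real m \<le> 1 * real m" using y(3) by (intro mult_right_mono) auto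
      then have lm: "l \<le> m" using l(1) by linarith
      have "t - (1 + real l / real m) = ((t - 1) * real m - real l) / real m"
        using m0 by (simp add: field_simps)
      then have "\<bar>t - (1 + real l / real m)\<bar> \<le> 1 / real m"
        using l m0 by (simp add: abs_le_iff divide_right_mono)
      also have "1 / real m \<le> e" using m(1) m0 e(1) by (simp add: field_simps)
      finally have tl: "\<bar>t - (1 + real l / real m)\<bar> \<le> e" .
      have "norm (t *\<^sub>R x - (1 + real l / real m) *\<^sub>R a)
          = norm (t *\<^sub>R (x - a) + (t - (1 + real l / real m)) *\<^sub>R a)"
        by (simp add: algebra_simps)
      also have "\<dots> \<le> t * norm (x - a) + \<bar>t - (1 + real l / real m)\<bar> * norm a"
        using norm_triangle_ineq[of "t *\<^sub>R (x - a)" "(t - (1 + real l / real m)) *\<^sub>R a"] y(2) by simp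
      also have "\<dots> \<le> 2 * e + e * R"
        using y e tl R by (intro add_mono mult_mono) (auto simp: dist_norm norm_minus_commute)
      also have "\<dots> = r" by (simp add: r_def algebra_simps)
      finally have "y \<in> B l" by (simp add: B_def y(1) dist_norm norm_minus_commute)
      then show "y \<in> (\<Union>l\<in>{..m}. B l)" using lm by blast
    qed
    then have "emeasure lborel W \<le> emeasure lborel (\<Union>l\<in>{..m}. B l)"
      by (intro emeasure_mono) (auto simp: B_def)
    also have "\<dots> \<le> (\<Sum>l\<in>{..m}. emeasure lborel (B l))"
      by (intro emeasure_subadditive_finite) (auto simp: B_def)
    also have "\<dots> = (\<Sum>l\<in>{..m}. ennreal (unit_ball_vol (real DIM('a)) * r ^ DIM('a)))"
      using R0 e by (intro sum.cong) (auto simp: B_def emeasure_cball r_def)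
    also have "\<dots> = ennreal (real (m + 1) * (unit_ball_vol (real DIM('a)) * r ^ DIM('a)))"
    proof -
      have "0 \<le> unit_ball_vol (real DIM('a)) * r ^ DIM('a)" using R0 e by (simp add: r_def)
      then have "ennreal (real (m + 1) * (unit_ball_vol (real DIM('a)) * r ^ DIM('a)))
          = ennreal (real (m + 1)) * ennreal (unit_ball_vol (real DIM('a)) * r ^ DIM('a))"
        by (intro ennreal_mult) auto
      then show ?thesis by (simp add: ennreal_of_nat_eq_real_of_nat)
    qed
    also have "\<dots> \<le> ennreal (C * e ^ (DIM('a) - 1))"
    proof (rule ennreal_leI)
      \<comment> \<open>The number of balls, at most \<open>3 / e\<close> because
        \<open>e \<le> 1\<close>; this is the factor 3 in the bound.\<close>
      have "real (m + 1) \<le> 1 / e + 2" using m by simp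
      also have "\<dots> \<le> 3 / e" using e by (simp add: field_simps)
      finally have "real (m + 1) * (unit_ball_vol (real DIM('a)) * r ^ DIM('a))
          \<le> 3 / e * (unit_ball_vol (real DIM('a)) * r ^ DIM('a))"
        using R0 e by (intro mult_right_mono) (auto simp: r_def)
      also have "\<dots> = C * (e ^ DIM('a) / e)" by (simp add: C_def r_def power_mult_distrib)
      also have "e ^ DIM('a) / e = e ^ (DIM('a) - 1)"
        using e D by (cases "DIM('a)") auto
      finally show "real (m + 1) * (unit_ball_vol (real DIM('a)) * r ^ DIM('a)) \<le> C * e ^ (DIM('a) - 1)" .
    qed
    finally show ?thesis .
  qed
  have "emeasure lborel W \<le> ennreal (C * d ^ (DIM('a) - 1))"
  proof (cases "d = 0")
    case True
    have "emeasure lborel W \<le> ennreal x" if x: "x > 0" for x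
    proof -
      define e where "e = min 1 (x / (C + 1))"
      have e: "0 < e" "e \<le> 1" "C * e \<le> x"
      proof -
        have C1: "0 < C + 1" using C0 by linarith
        show "0 < e" unfolding e_def min_less_iff_conj using divide_pos_pos[OF x C1] by simp
        show "e \<le> 1" unfolding e_def by (rule min.cobounded1)
        have "C * e \<le> C * (x / (C + 1))" unfolding e_def using C0 by (intro mult_left_mono) auto
        also have "\<dots> \<le> (C + 1) * (x / (C + 1))"
          using divide_pos_pos[OF x C1] by (intro mult_right_mono) auto
        also have "\<dots> = x"
          using C0 by (subst times_divide_eq_right, intro nonzero_mult_div_cancel_left) linarith
        finally show "C * e \<le> x" .
      qed
      \<comment> \<open>Dimension at least 2 enters here: the exponent is positive, so the bound
        tends to 0 with \<open>e\<close>.\<close>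
      have "e ^ (DIM('a) - 1) \<le> e ^ 1" using e D by (intro power_decreasing) auto
      then have "C * e ^ (DIM('a) - 1) \<le> x"
        using e(3) mult_left_mono[OF _ C0, of "e ^ (DIM('a) - 1)" e] by simp
      then have "ennreal (C * e ^ (DIM('a) - 1)) \<le> ennreal x" by (rule ennreal_leI)
      moreover have "d \<le> e" using True e(1) by simp
      ultimately show ?thesis using le[OF e(1) _ e(2)] order_trans by blast
    qed
    then have "emeasure lborel W \<le> 0 + ennreal x" if "x > 0" for x
      using that by simp
    then have "emeasure lborel W \<le> 0" by (rule ennreal_le_epsilon)
    then show ?thesis by simp
  next
    case False
    then have "0 < d" using d(1) by simp
    then show ?thesis using d(2) by (intro le) auto
  qed
  moreover have "t *\<^sub>R x \<in> W" if "t \<in> {1..2}" "x \<in> cball a d" for t x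
    unfolding W_def using that by (intro image_eqI[of _ _ "(t, x)"]) auto
  ultimately show ?thesis using W unfolding C_def by blast
qed

text \<open>A cover of \<open>A\<close> with tiny total Hausdorff weight turns into a cover of its
  cone: by \<open>cone_cover\<close> the cone over a piece of diameter \<open>d\<close> has volume
  at most a constant times \<open>d ^ k\<close>, which is comparable to the weight of that
  piece.\<close>

lemma hausdorff_null_cone:
  fixes A :: "'a::euclidean_space set"
  assumes D: "DIM('a) \<ge> 2" and A: "\<And>x. x \<in> A \<Longrightarrow> norm x \<le> R"
    and null: "hausdorff_outer (DIM('a) - 1) A = 0" and e: "e > 0"
  shows "\<exists>W\<in>sets lborel. (\<forall>t\<in>{1..2}. \<forall>x\<in>A. t *\<^sub>R x \<in> W) \<and> emeasure lborel W \<le> ennreal e"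
proof (cases "A = {}")
  case True
  then show ?thesis by (intro bexI[of _ "{}"]) auto
next
  case False
  then have R0: "R \<ge> 0" using A norm_ge_zero order_trans by blast
  define k where "k = DIM('a) - 1"
  define C where "C = 3 * unit_ball_vol (real DIM('a)) * (R + 2) ^ DIM('a)"
  have C0: "C > 0" using R0 by (auto simp: C_def intro!: mult_pos_pos)
  \<comment> \<open>The Hausdorff weight of a set of diameter \<open>d\<close> is
    \<open>v * d ^ k\<close>, so \<open>C / v\<close> converts weight into a bound for the volume of
    the cone.\<close>
  define v where "v = unit_ball_vol (real k) / 2 ^ k"
  have v0: "v > 0" by (simp add: v_def)
  have "hausdorff_premeasure k 1 A = 0"
  proof -
    have "hausdorff_premeasure k 1 A \<le> hausdorff_outer k A"
      unfolding hausdorff_outer_def by (rule SUP_upper) simp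
    then show ?thesis using null by (simp add: k_def)
  qed
  moreover have "0 < ennreal (e * v / C)" using e v0 C0 by simp
  ultimately have "hausdorff_premeasure k 1 A < ennreal (e * v / C)" by simp
  then obtain U :: "nat \<Rightarrow> 'a set" where U: "A \<subseteq> (\<Union>i. U i)" "\<And>i. bounded (U i)" "\<And>i. diameter (U i) \<le> 1"
    and sum: "(\<Sum>i. ennreal (unit_ball_vol (real k) * (diameter (U i) / 2) ^ k)) < ennreal (e * v / C)"
    unfolding hausdorff_premeasure_def INF_less_iff by blast
  have "\<exists>W\<in>sets lborel. (\<forall>t\<in>{1..2}. \<forall>x\<in>U i \<inter> A. t *\<^sub>R x \<in> W) \<and>
      emeasure lborel W \<le> ennreal (C * diameter (U i) ^ k)" for i
  proof (cases "U i \<inter> A = {}")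
    case True
    then show ?thesis by (intro bexI[of _ "{}"]) auto
  next
    case False
    \<comment> \<open>The centre is taken in \<open>A\<close>, where \<open>R\<close> bounds the
      norm; the covering set itself may stick out of \<open>A\<close>.\<close>
    then obtain a where a: "a \<in> U i" "a \<in> A" by blast
    have sub: "x \<in> cball a (diameter (U i))" if "x \<in> U i" for x
      using diameter_bounded_bound[OF U(2) a(1) that] by simp
    from cone_cover[OF D A[OF a(2)] diameter_ge_0[OF U(2)] U(3)[of i]]
    obtain W where "W \<in> sets lborel" "\<forall>t\<in>{1..2}. \<forall>x\<in>cball a (diameter (U i)). t *\<^sub>R x \<in> W"
      "emeasure lborel W \<le> ennreal (C * diameter (U i) ^ k)"
      unfolding C_def k_def by blast
    then show ?thesis using sub by (intro bexI[of _ W]) blast+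
  qed
  then obtain W where W: "\<And>i. W i \<in> sets lborel" "\<And>i t x. t \<in> {1..2} \<Longrightarrow> x \<in> U i \<inter> A \<Longrightarrow> t *\<^sub>R x \<in> W i"
    "\<And>i. emeasure lborel (W i) \<le> ennreal (C * diameter (U i) ^ k)"
    by metis
  have "emeasure lborel (\<Union>i. W i) \<le> (\<Sum>i. emeasure lborel (W i))"
    using W(1) by (intro emeasure_subadditive_countably) auto
  also have "\<dots> \<le> (\<Sum>i. ennreal (C / v) * ennreal (unit_ball_vol (real k) * (diameter (U i) / 2) ^ k))"
  proof (intro suminf_le summableI)
    fix i
    have "ennreal (C / v) * ennreal (unit_ball_vol (real k) * (diameter (U i) / 2) ^ k)
        = ennreal (C * diameter (U i) ^ k)"
    proof -
      have d: "unit_ball_vol (real k) * (diameter (U i) / 2) ^ k = v * diameter (U i) ^ k"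
        by (simp add: v_def power_divide)
      show ?thesis unfolding d using C0 v0 diameter_ge_0[OF U(2)[of i]]
        by (subst ennreal_mult[symmetric]) auto
    qed
    then show "emeasure lborel (W i)
        \<le> ennreal (C / v) * ennreal (unit_ball_vol (real k) * (diameter (U i) / 2) ^ k)"
      using W(3)[of i] by simp
  qed
  also have "\<dots> = ennreal (C / v) * (\<Sum>i. ennreal (unit_ball_vol (real k) * (diameter (U i) / 2) ^ k))"
    by (rule ennreal_suminf_cmult)
  also have "\<dots> \<le> ennreal (C / v) * ennreal (e * v / C)"
    using sum by (intro mult_left_mono) auto
  also have "\<dots> = ennreal e" using C0 v0 e by (subst ennreal_mult[symmetric]) auto
  finally have "emeasure lborel (\<Union>i. W i) \<le> ennreal e" .
  moreover have "t *\<^sub>R x \<in> (\<Union>i. W i)" if t: "t \<in> {1..2}" and x: "x \<in> A" for t x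
  proof -
    obtain i where "x \<in> U i" using U(1) x by auto
    then have "t *\<^sub>R x \<in> W i" using t x by (intro W(2)) auto
    then show ?thesis by blast
  qed
  moreover have "(\<Union>i. W i) \<in> sets lborel" using W(1) by (intro sets.countable_UN) auto
  ultimately show ?thesis by blast
qed

section \<open>The normalized surface measure: rotations and masses of balls\<close>

context admissible_domain begin

abbreviation S where "S \<equiv> frontier (Omega p)"
abbreviation \<sigma> where "\<sigma> \<equiv> sigma_p p"

lemma S_eq: "S = {z. rho p z = 1}"
  by (rule frontier_Omega)

lemma S_borel [measurable]: "S \<in> sets borel"
  using compact_frontier_Omega by (auto intro: borel_closed compact_imp_closed)

lemma space_sigma: "space \<sigma> = S"
  by (simp add: sigma_p_def surface_measure_def space_restrict_space)

lemma sets_sigma_borel: "sets \<sigma> = sets (restrict_space borel S)"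
  by (simp add: sigma_p_def surface_measure_def sets_restrict_space)

lemma sets_sigma: "A \<in> sets \<sigma> \<longleftrightarrow> A \<subseteq> S \<and> A \<in> sets borel"
  unfolding sets_sigma_borel by (rule sets_restrict_space_iff) simp

abbreviation hm where "hm \<equiv> (hausdorff_measure (DIM(complex ^ 'n) - 1) :: (complex ^ 'n) measure)"

lemma emeasure_sigma:
  assumes "A \<in> sets \<sigma>" shows "emeasure \<sigma> A = emeasure hm A / emeasure hm S"
proof -
  let ?N = "restrict_space hm S"
  have N: "B \<in> sets ?N" if "B \<subseteq> S" "B \<in> sets borel" for B
    using that by (subst sets_restrict_space_iff) auto
  have E: "emeasure ?N B = emeasure hm B" if "B \<subseteq> S" for B
    using that by (intro emeasure_restrict_space) auto
  have A: "A \<subseteq> S" "A \<in> sets borel" using assms by (auto simp only: sets_sigma)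
  have "emeasure \<sigma> A = emeasure ?N (S \<inter> A) / emeasure ?N S"
    unfolding sigma_p_def surface_measure_def
    by (rule emeasure_uniform_measure[OF N[OF order_refl S_borel] N[OF A]])
  also have "S \<inter> A = A" using A(1) by blast
  finally show ?thesis by (simp only: E[OF A(1)] E[OF order_refl])
qed

text \<open>Normalization divides by the Hausdorff mass of \<open>S\<close>. By the conventions for
  extended reals, mass 0 or infinity sends every quotient to 0; otherwise a probability measure
  results. This dichotomy already gives finiteness of \<sigma>.\<close>

lemma sigma_null_or_prob:
  "(\<forall>A. emeasure \<sigma> A = 0) \<or> (emeasure \<sigma> S = 1 \<and> emeasure hm S \<noteq> 0 \<and> emeasure hm S \<noteq> \<infinity>)"
proof (cases "emeasure hm S = 0 \<or> emeasure hm S = \<infinity>")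
  case True
  have "emeasure \<sigma> A = 0" for A
  proof (cases "A \<in> sets \<sigma>")
    case A: True
    then have "emeasure hm A \<le> emeasure hm S"
      by (intro emeasure_mono) (auto simp: sets_sigma)
    then show ?thesis using True A by (auto simp: emeasure_sigma ennreal_divide_self)
  qed (rule emeasure_notin_sets)
  then show ?thesis by blast
next
  case False
  have "S \<in> sets \<sigma>" by (simp add: sets_sigma)
  then have "emeasure \<sigma> S = 1"
    using False by (simp add: emeasure_sigma ennreal_divide_self less_top)
  then show ?thesis using False by auto
qed

lemma finite_measure_sigma: "finite_measure \<sigma>"
  using sigma_null_or_prob by (auto intro!: finite_measureI simp: space_sigma)

lemma rho_rot: "cmod u = 1 \<Longrightarrow> rho p (rot i u z) = rho p z"
  unfolding rho_def by (intro sum.cong refl) (auto simp: norm_mult)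

lemma dist_rot: "cmod u = 1 \<Longrightarrow> dist (rot i u x) (rot i u y) = dist x y"
proof -
  assume u: "cmod u = 1"
  have "cmod (rot i u x $ k - rot i u y $ k) = cmod (x $ k - y $ k)" for k
    using u by (simp add: right_diff_distrib[symmetric] norm_mult)
  then show ?thesis unfolding dist_norm norm_vec_def by simp
qed

lemma rot_S: "cmod u = 1 \<Longrightarrow> z \<in> S \<Longrightarrow> rot i u z \<in> S"
  by (simp add: S_eq rho_rot)

lemma rot_measurable:
  assumes "cmod u = 1" shows "rot i u \<in> measurable \<sigma> \<sigma>"
proof -
  have "rot i u \<in> borel_measurable borel"
    by (intro borel_measurable_continuous_onI continuous_intros)
  then have "rot i u \<in> measurable (restrict_space borel S) (restrict_space borel S)"
    using rot_S[OF assms]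
    by (intro measurable_restrict_space2 measurable_restrict_space1) (auto simp: space_restrict_space)
  then show ?thesis using measurable_cong_sets[OF sets_sigma_borel sets_sigma_borel] by blast
qed

text \<open>The preimage under a rotation is the image under the inverse rotation, an isometry
  mapping \<open>S\<close> to itself, so Hausdorff invariance applies.\<close>

lemma distr_rot:
  assumes u: "cmod u = 1" shows "distr \<sigma> \<sigma> (rot i u) = \<sigma>"
proof (rule measure_eqI)
  fix A assume "A \<in> sets (distr \<sigma> \<sigma> (rot i u))"
  then have A: "A \<in> sets \<sigma>" by simp
  have u': "cmod (cnj u) = 1" using u by simp
  have uc: "cnj u * u = 1" "u * cnj u = 1"
    using complex_norm_square[of u] u by (simp_all add: mult.commute)
  have eq: "rot i u -` A \<inter> space \<sigma> = rot i (cnj u) ` A"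
  proof
    show "rot i u -` A \<inter> space \<sigma> \<subseteq> rot i (cnj u) ` A"
    proof
      fix z assume "z \<in> rot i u -` A \<inter> space \<sigma>"
      then have "rot i u z \<in> A" by simp
      moreover have "z = rot i (cnj u) (rot i u z)" by (simp add: rot_rot uc)
      ultimately show "z \<in> rot i (cnj u) ` A" by blast
    qed
    show "rot i (cnj u) ` A \<subseteq> rot i u -` A \<inter> space \<sigma>"
    proof
      fix z assume "z \<in> rot i (cnj u) ` A"
      then obtain y where y: "y \<in> A" "z = rot i (cnj u) y" by blast
      then have "y \<in> S" using A by (auto simp: sets_sigma)
      then show "z \<in> rot i u -` A \<inter> space \<sigma>"
        using y rot_S[OF u', of y i] by (simp add: space_sigma rot_rot uc)
    qed
  qed
  have B: "rot i (cnj u) ` A \<in> sets \<sigma>"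
    using measurable_sets[OF rot_measurable[OF u] A, of i] by (simp only: eq)
  have "emeasure (distr \<sigma> \<sigma> (rot i u)) A = emeasure \<sigma> (rot i (cnj u) ` A)"
    by (simp add: emeasure_distr[OF rot_measurable[OF u] A] eq)
  also have "\<dots> = emeasure \<sigma> A"
  proof -
    have "hausdorff_outer k (rot i (cnj u) ` A) = hausdorff_outer k A" for k
      by (rule hausdorff_outer_isometry[OF dist_rot[OF u'] dist_rot[OF u, of i]]) (simp add: rot_rot uc)
    then have "emeasure hm (rot i (cnj u) ` A) = emeasure hm A"
      using A B by (simp add: emeasure_hausdorff_measure sets_sigma)
    then show ?thesis using A B by (simp add: emeasure_sigma)
  qed
  finally show "emeasure (distr \<sigma> \<sigma> (rot i u)) A = emeasure \<sigma> A" .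
qed simp

lemma integral_rot:
  fixes f :: "complex ^ 'n \<Rightarrow> complex"
  assumes u: "cmod u = 1" and f: "f \<in> borel_measurable \<sigma>"
  shows "(\<integral>z. f (rot i u z) \<partial>\<sigma>) = (\<integral>z. f z \<partial>\<sigma>)"
  using integral_distr[OF rot_measurable[OF u] f, of i] by (simp add: distr_rot[OF u])

text \<open>Points near \<open>(3/2) w\<close> are dilates, by factors between 1 and 2, of points of the surface near \<open>w\<close>.\<close>

lemma hausdorff_outer_surface_ball_nonzero:
  assumes w: "w \<in> S" and \<eta>: "\<eta> > 0"
  shows "hausdorff_outer (DIM(complex ^ 'n) - 1) (S \<inter> ball w \<eta>) \<noteq> 0"
proof
  assume null: "hausdorff_outer (DIM(complex ^ 'n) - 1) (S \<inter> ball w \<eta>) = 0"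
  have rw: "rho p w = 1" using w by (simp add: S_eq)
  \<comment> \<open>The bound \<open>1/4\<close> keeps the dilation factors \<open>3/2 - h\<close>
    and \<open>3/2 + h\<close> within \<open>1..2\<close>; the other bound keeps the cone base
    within \<eta> of \<open>w\<close>.\<close>
  define h where "h = min (1/4) (\<eta> / (4 * (norm w + 1)))"
  have nw: "norm w + 1 > 0" by (simp add: add_nonneg_pos)
  have h: "0 < h" using \<eta> nw by (simp add: h_def)
  have h': "h \<le> 1/4" unfolding h_def by (rule min.cobounded1)
  have hw: "h * norm w < \<eta> / 2"
  proof -
    have "h * norm w \<le> \<eta> / (4 * (norm w + 1)) * (norm w + 1)"
      using \<eta> nw by (intro mult_mono) (auto simp: h_def)
    also have "\<dots> = \<eta> / 4" using nw by (simp add: divide_simps)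
    finally show ?thesis using \<eta> by simp
  qed
  define t1 where "t1 = 3/2 - h"
  define t2 where "t2 = 3/2 + h"
  have t: "1 \<le> t1" "t1 < 3/2" "3/2 < t2" "t2 \<le> 2" "t1 \<le> t2" using h h' by (auto simp: t1_def t2_def)
  \<comment> \<open>An open neighbourhood of \<open>(3/2) w\<close>, consisting of points whose ray
    from 0 crosses \<open>S\<close> at a dilation factor between \<open>t1\<close> and
    \<open>t2\<close>.\<close>
  define Q where "Q = {y. rho p ((1 / t1) *\<^sub>R y) > 1} \<inter> {y. rho p ((1 / t2) *\<^sub>R y) < 1} \<inter> ball ((3/2) *\<^sub>R w) (\<eta> / 2)"
  have cont: "continuous_on UNIV (\<lambda>y. rho p (c *\<^sub>R y))" for c
    by (rule continuous_on_compose2[OF continuous_on_rho[of UNIV]]) (auto intro: continuous_intros)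
  have sc: "(1 / t) *\<^sub>R (3/2) *\<^sub>R w = (3 / 2 / t) *\<^sub>R w" for t
    by (simp add: mult.commute)
  have "open Q" unfolding Q_def
    by (intro open_Int open_Collect_less cont continuous_on_const open_ball)
  moreover have "(3/2) *\<^sub>R w \<in> Q"
  proof -
    have "1 < 3 / 2 / t1" using t by simp
    then have "1 < (3 / 2 / t1)\<^sup>2" by (rule one_less_power) simp
    also have "\<dots> \<le> rho p ((3 / 2 / t1) *\<^sub>R w)" using rho_scale_ge[of "3/2/t1" w] rw t by simp
    finally have a: "1 < rho p ((1 / t1) *\<^sub>R (3/2) *\<^sub>R w)" unfolding sc .
    have "rho p ((3 / 2 / t2) *\<^sub>R w) \<le> (3 / 2 / t2)\<^sup>2" using rho_scale_le[of "3/2/t2" w] rw t by simp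
    also have "\<dots> < 1" using t by (simp add: power_less_one_iff abs_square_less_1)
    finally have b: "rho p ((1 / t2) *\<^sub>R (3/2) *\<^sub>R w) < 1" unfolding sc .
    show ?thesis unfolding Q_def using a b \<eta> by (simp del: scaleR_scaleR)
  qed
  ultimately obtain r where r: "r > 0" "ball ((3/2) *\<^sub>R w) r \<subseteq> Q"
    by (meson open_contains_ball)
  have cone: "\<exists>t\<in>{1..2}. \<exists>x\<in>S \<inter> ball w \<eta>. y = t *\<^sub>R x" if y: "y \<in> Q" for y
  proof -
    \<comment> \<open>For \<open>y\<close> in \<open>Q\<close>, \<open>rho\<close> of
      \<open>y / t\<close> exceeds 1 at \<open>t1\<close> and is below 1 at
      \<open>t2\<close>.\<close>
    have "\<exists>t. t1 \<le> t \<and> t \<le> t2 \<and> rho p ((1 / t) *\<^sub>R y) = 1"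
    proof (rule IVT2')
      show "continuous_on {t1..t2} (\<lambda>t. rho p ((1 / t) *\<^sub>R y))"
        by (rule continuous_on_compose2[OF continuous_on_rho[of UNIV]])
           (use t in \<open>auto intro!: continuous_intros\<close>)
    qed (use y t in \<open>auto simp: Q_def\<close>)
    then obtain s where s: "t1 \<le> s" "s \<le> t2" "rho p ((1 / s) *\<^sub>R y) = 1" by blast
    have s1: "s \<ge> 1" "s \<le> 2" "\<bar>3/2 - s\<bar> \<le> h" using s t by (auto simp: t1_def t2_def)
    have "norm ((1 / s) *\<^sub>R y - w) = norm ((1 / s) *\<^sub>R (y - (3/2) *\<^sub>R w) + ((3/2 - s) / s) *\<^sub>R w)"
      using s1 by (simp add: algebra_simps diff_divide_distrib)
    also have "\<dots> \<le> (1 / s) * norm (y - (3/2) *\<^sub>R w) + \<bar>(3/2 - s) / s\<bar> * norm w"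
      using norm_triangle_ineq[of "(1 / s) *\<^sub>R (y - (3/2) *\<^sub>R w)" "((3/2 - s) / s) *\<^sub>R w"] s1 by simp
    also have "\<dots> \<le> 1 * norm (y - (3/2) *\<^sub>R w) + h * norm w"
    proof (intro add_mono mult_right_mono)
      have "\<bar>(3/2 - s) / s\<bar> = \<bar>3/2 - s\<bar> / s" using s1 by simp
      also have "\<dots> \<le> \<bar>3/2 - s\<bar> / 1" using s1 by (intro divide_left_mono) auto
      finally show "\<bar>(3/2 - s) / s\<bar> \<le> h" using s1(3) by simp
    qed (use s1 in auto)
    also have "\<dots> < \<eta> / 2 + \<eta> / 2"
      using y hw by (intro add_strict_mono) (auto simp: Q_def dist_norm norm_minus_commute)
    finally have "(1 / s) *\<^sub>R y \<in> S \<inter> ball w \<eta>"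
      using s(3) by (simp add: S_eq dist_norm norm_minus_commute)
    moreover have "y = s *\<^sub>R (1 / s) *\<^sub>R y" using s1 by simp
    ultimately show ?thesis using s1 by (intro bexI[of _ s] bexI[of _ "(1 / s) *\<^sub>R y"]) auto
  qed
  have D: "DIM(complex ^ 'n) \<ge> 2"
    using zero_less_card_finite[where 'a = 'n] by (simp add: Suc_le_eq)
  have "bounded (S \<inter> ball w \<eta>)" by (simp add: bounded_Int)
  then obtain R where R: "\<And>x. x \<in> S \<inter> ball w \<eta> \<Longrightarrow> norm x \<le> R" unfolding bounded_iff by blast
  have le: "emeasure lborel (ball ((3/2) *\<^sub>R w) r) \<le> ennreal e" if "e > 0" for e
  proof -
    obtain W where W: "W \<in> sets lborel" "\<forall>t\<in>{1..2}. \<forall>x\<in>S \<inter> ball w \<eta>. t *\<^sub>R x \<in> W"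
      "emeasure lborel W \<le> ennreal e"
      using hausdorff_null_cone[OF D R null \<open>e > 0\<close>] by blast
    have "ball ((3/2) *\<^sub>R w) r \<subseteq> W" using r(2) cone W(2) by blast
    then have "emeasure lborel (ball ((3/2) *\<^sub>R w) r) \<le> emeasure lborel W"
      using W(1) by (intro emeasure_mono)
    then show ?thesis using W(3) by (rule order_trans)
  qed
  then have "emeasure lborel (ball ((3/2) *\<^sub>R w) r) \<le> 0 + ennreal e" if "e > 0" for e
    using that by simp
  then have "emeasure lborel (ball ((3/2) *\<^sub>R w) r) \<le> 0" by (rule ennreal_le_epsilon)
  moreover have "emeasure lborel (ball ((3/2) *\<^sub>R w) r) > 0"
    using r(1) by (simp add: emeasure_ball)
  ultimately show False by simp
qed

lemma sigma_ball_pos: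
  assumes nonnull: "\<not> (\<forall>A. emeasure \<sigma> A = 0)" and w: "w \<in> S" and \<eta>: "\<eta> > 0"
  shows "measure \<sigma> (S \<inter> ball w \<eta>) > 0"
proof -
  interpret finite_measure \<sigma> by (rule finite_measure_sigma)
  have h: "emeasure hm S \<noteq> 0" "emeasure hm S \<noteq> \<infinity>" using sigma_null_or_prob nonnull by blast+
  have A: "S \<inter> ball w \<eta> \<in> sets \<sigma>" by (auto simp: sets_sigma)
  \<comment> \<open>A nonzero mass of \<open>S\<close> excludes the null default of
    \<open>measure_of\<close>, so \<open>hm\<close> agrees with the outer measure here.\<close>
  have "emeasure hm (S \<inter> ball w \<eta>) \<noteq> 0"
    using h hausdorff_outer_surface_ball_nonzero[OF w \<eta>] A
    by (auto simp: emeasure_hausdorff_measure sets_sigma split: if_splits)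
  then have "emeasure \<sigma> (S \<inter> ball w \<eta>) \<noteq> 0"
    using A h by (simp add: emeasure_sigma ennreal_divide_eq_0_iff)
  then show ?thesis by (simp add: emeasure_eq_measure zero_less_measure_iff)
qed

text \<open>By compactness finitely many balls of radius \<open>\<eta> / 2\<close> cover
  \<open>S\<close>, and every ball of radius \<eta> centred on \<open>S\<close> contains one of
  them. Uniformity in \<open>w\<close> matters because the centre used later depends on the
  multi-index.\<close>

lemma sigma_ball_uniform:
  assumes nonnull: "\<not> (\<forall>A. emeasure \<sigma> A = 0)" and \<eta>: "\<eta> > 0"
  shows "\<exists>c>0. \<forall>w\<in>S. c \<le> measure \<sigma> (S \<inter> ball w \<eta>)"
proof -
  interpret finite_measure \<sigma> by (rule finite_measure_sigma)
  obtain F where F: "F \<subseteq> S" "finite F" "S \<subseteq> (\<Union>x\<in>F. ball x (\<eta> / 2))"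
  proof (rule compactE_image[OF compact_frontier_Omega, of S "\<lambda>x. ball x (\<eta> / 2)"])
    show "S \<subseteq> (\<Union>x\<in>S. ball x (\<eta> / 2))" using \<eta> by (intro subsetI UN_I) auto
  qed auto
  show ?thesis
  proof (cases "F = {}")
    case True
    then show ?thesis using F(3) by (intro exI[of _ 1]) auto
  next
    case False
    define c where "c = Min ((\<lambda>x. measure \<sigma> (S \<inter> ball x (\<eta> / 2))) ` F)"
    have "c > 0" using F False sigma_ball_pos[OF nonnull] \<eta> by (auto simp: c_def)
    moreover have "c \<le> measure \<sigma> (S \<inter> ball w \<eta>)" if "w \<in> S" for w
    proof -
      obtain x where x: "x \<in> F" "dist x w < \<eta> / 2" using F(3) \<open>w \<in> S\<close> by auto
      have "c \<le> measure \<sigma> (S \<inter> ball x (\<eta> / 2))" unfolding c_def using F x by (intro Min_le) auto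
      moreover have "ball x (\<eta> / 2) \<subseteq> ball w \<eta>"
      proof
        fix y assume "y \<in> ball x (\<eta> / 2)"
        then show "y \<in> ball w \<eta>" using x(2) dist_triangle[of w y x] by (simp add: dist_commute)
      qed
      then have "measure \<sigma> (S \<inter> ball x (\<eta> / 2)) \<le> measure \<sigma> (S \<inter> ball w \<eta>)"
        by (intro finite_measure_mono) (auto simp: sets_sigma)
      ultimately show ?thesis by linarith
    qed
    ultimately show ?thesis by blast
  qed
qed

end

section \<open>Concentration of monomials\<close>

definition deg :: "('n::finite \<Rightarrow> nat) \<Rightarrow> nat" where "deg \<alpha> = sum \<alpha> UNIV"

lemma norm_monom: "cmod (monomial \<alpha> z) = (\<Prod>i\<in>UNIV. cmod (z $ i) ^ \<alpha> i)"
  by (simp add: monomial_def prod_norm[symmetric] norm_power)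

lemma norm_monom_mono:
  "(\<And>k. cmod (z $ k) \<le> cmod (w $ k)) \<Longrightarrow> cmod (monomial \<alpha> z) \<le> cmod (monomial \<alpha> w)"
  unfolding norm_monom by (intro prod_mono) (auto intro: power_mono)

lemma norm_monom_scale: "cmod (monomial \<alpha> (r *\<^sub>R z)) = \<bar>r\<bar> ^ deg \<alpha> * cmod (monomial \<alpha> z)"
  unfolding norm_monom scaleR_nth_norm power_mult_distrib prod.distrib
  by (simp add: deg_def power_sum)

lemma continuous_on_monom: "continuous_on A (monomial \<alpha>)"
  unfolding monomial_def by (intro continuous_intros)

lemma monom_Suc: "\<alpha> i > 0 \<Longrightarrow> monomial \<alpha> z = z $ i * monomial (\<alpha>(i := \<alpha> i - 1)) z"
proof -
  assume a: "\<alpha> i > 0"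
  have "(\<Prod>k\<in>UNIV - {i}. (z $ k) ^ (\<alpha>(i := \<alpha> i - 1)) k) = (\<Prod>k\<in>UNIV - {i}. (z $ k) ^ \<alpha> k)"
    by (intro prod.cong) auto
  moreover have "(z $ i) ^ \<alpha> i = z $ i * (z $ i) ^ (\<alpha> i - 1)" using a by (cases "\<alpha> i") auto
  ultimately show ?thesis
    unfolding monomial_def by (simp add: prod.remove[of UNIV i])
qed

lemma deg_Suc: "\<alpha> i > 0 \<Longrightarrow> deg \<alpha> = Suc (deg (\<alpha>(i := \<alpha> i - 1)))"
proof -
  assume a: "\<alpha> i > 0"
  have "(\<Sum>k\<in>UNIV - {i}. (\<alpha>(i := \<alpha> i - 1)) k) = (\<Sum>k\<in>UNIV - {i}. \<alpha> k)"
    by (intro sum.cong) auto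
  then show ?thesis unfolding deg_def using a by (simp add: sum.remove[of UNIV i])
qed

lemma monom_rot: "monomial \<alpha> (rot i u z) = u ^ \<alpha> i * monomial \<alpha> z"
proof -
  have "(\<Prod>k\<in>UNIV - {i}. (rot i u z $ k) ^ \<alpha> k) = (\<Prod>k\<in>UNIV - {i}. (z $ k) ^ \<alpha> k)"
    by (intro prod.cong) auto
  then show ?thesis unfolding monomial_def by (simp add: prod.remove[of UNIV i] power_mult_distrib)
qed

lemma finite_deg_less: "finite {\<alpha> :: 'n::finite \<Rightarrow> nat. deg \<alpha> < N}"
proof (rule finite_subset)
  show "{\<alpha> :: 'n \<Rightarrow> nat. deg \<alpha> < N} \<subseteq> PiE UNIV (\<lambda>_. {..<N})"
  proof
    fix \<alpha> :: "'n \<Rightarrow> nat" assume "\<alpha> \<in> {\<alpha>. deg \<alpha> < N}"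
    moreover have "\<alpha> i \<le> deg \<alpha>" for i unfolding deg_def by (rule member_le_sum) auto
    ultimately show "\<alpha> \<in> PiE UNIV (\<lambda>_. {..<N})" by (auto intro: le_less_trans)
  qed
qed (auto intro: finite_PiE)

lemma power_superadditive:
  fixes x y :: real
  assumes "0 \<le> x" "0 \<le> y" "n \<ge> 1" shows "x ^ n + y ^ n \<le> (x + y) ^ n"
  using assms(3)
proof (induction n rule: dec_induct)
  case (step n)
  have "x ^ Suc n + y ^ Suc n \<le> (x + y) * (x ^ n + y ^ n)"
    using assms by (simp add: algebra_simps)
  also have "\<dots> \<le> (x + y) * (x + y) ^ n" using step assms by (intro mult_left_mono) auto
  finally show ?case by simp
qed simp

text \<open>From superadditivity of \<open>x ^ n\<close>. The bound remains valid when
  \<open>a\<close> and \<open>b\<close> are both near 0, where the derivative of the power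
  degenerates.\<close>

lemma power_diff_ge:
  fixes a b :: real
  assumes "0 \<le> a" "0 \<le> b" "n \<ge> 1" shows "\<bar>a - b\<bar> ^ n \<le> \<bar>a ^ n - b ^ n\<bar>"
  using assms
proof (induction a b rule: linorder_wlog)
  case (le a b)
  then have "a ^ n + (b - a) ^ n \<le> b ^ n" using power_superadditive[of a "b - a" n] by simp
  moreover have "a ^ n \<le> b ^ n" using le by (intro power_mono) auto
  moreover have "\<bar>a - b\<bar> = b - a" using le by simp
  ultimately show ?case by simp
next
  case (sym a b)
  then show ?case by (simp add: abs_minus_commute)
qed

context admissible_domain begin

text \<open>Used as an upper bound for all exponents at once.\<close>

definition total_exponent :: nat where
  "total_exponent = (\<Sum>i\<in>UNIV. \<Sum>j<length (p i). p i ! j)"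

lemma exponent_le_total: "j < length (p i) \<Longrightarrow> p i ! j \<le> total_exponent"
proof -
  assume "j < length (p i)"
  then have "p i ! j \<le> (\<Sum>j<length (p i). p i ! j)" by (intro member_le_sum) auto
  also have "\<dots> \<le> total_exponent" unfolding total_exponent_def by (intro member_le_sum) auto
  finally show ?thesis .
qed

lemma total_exponent_pos: "total_exponent \<ge> 1"
  using exponent_le_total[OF length_pos] exponent_pos[OF length_pos] le_trans by blast

lemma rho_scale_le_total:
  assumes "1 \<le> t" shows "rho p (t *\<^sub>R z) \<le> t ^ (2 * total_exponent) * rho p z"
proof -
  have "cmod ((t *\<^sub>R z) $ i) ^ (2 * p i ! j) \<le> t ^ (2 * total_exponent) * cmod (z $ i) ^ (2 * p i ! j)"
    if "j < length (p i)" for i j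
  proof -
    have "t ^ (2 * p i ! j) \<le> t ^ (2 * total_exponent)"
      using assms exponent_le_total[OF that] by (intro power_increasing) auto
    then show ?thesis using assms
      by (simp only: scaleR_nth_norm power_mult_distrib abs_of_nonneg) (simp add: mult_right_mono)
  qed
  then show ?thesis unfolding rho_def sum_distrib_left by (intro sum_mono) auto
qed

text \<open>A gap in \<open>rho\<close> leaves room for a dilation: with \<open>n\<close> bounding
  all exponents of the moduli and \<open>r = 1 - \<tau> / n\<close>, Bernoulli's inequality gives
  \<open>r ^ n \<ge> 1 - \<tau>\<close>.\<close>

lemma scale_into_K:
  assumes "0 < \<tau>" "\<tau> \<le> 1"
  obtains r where "0 < r" "r < 1" "\<And>y. rho p y \<le> 1 - \<tau> \<Longrightarrow> (1 / r) *\<^sub>R y \<in> K"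
proof -
  define n where "n = 2 * total_exponent"
  have n: "n \<ge> 2" using total_exponent_pos by (simp add: n_def)
  define r where "r = 1 - \<tau> / real n"
  have q: "0 < \<tau> / real n" "\<tau> / real n < 1" using assms n by (auto simp: divide_less_eq)
  then have r: "0 < r" "r < 1" by (auto simp: r_def)
  have "1 + real n * (- (\<tau> / real n)) \<le> (1 + - (\<tau> / real n)) ^ n"
    by (rule Bernoulli_inequality) (use q in linarith)
  then have rn: "1 - \<tau> \<le> r ^ n" using n by (simp add: r_def)
  have "(1 / r) *\<^sub>R y \<in> K" if y: "rho p y \<le> 1 - \<tau>" for y
  proof -
    have "rho p ((1 / r) *\<^sub>R y) \<le> (1 / r) ^ n * rho p y"
      unfolding n_def using r by (intro rho_scale_le_total) simp
    also have "\<dots> \<le> (1 / r) ^ n * r ^ n" using r y rn by (intro mult_left_mono) auto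
    also have "\<dots> = 1" using r by (simp add: power_divide)
    finally show ?thesis by (simp add: closure_Omega)
  qed
  then show ?thesis using that[of r] r by blast
qed

definition max_point :: "('n \<Rightarrow> nat) \<Rightarrow> complex ^ 'n" where
  "max_point \<alpha> = (SOME \<xi>. \<xi> \<in> K \<and> (\<forall>z\<in>K. cmod (monomial \<alpha> z) \<le> cmod (monomial \<alpha> \<xi>)))"

abbreviation max_monom :: "('n \<Rightarrow> nat) \<Rightarrow> real" where
  "max_monom \<alpha> \<equiv> cmod (monomial \<alpha> (max_point \<alpha>))"

lemma max_point: "max_point \<alpha> \<in> K" and le_max_monom: "z \<in> K \<Longrightarrow> cmod (monomial \<alpha> z) \<le> max_monom \<alpha>"
proof -
  obtain d where "(\<chi> i. complex_of_real d) \<in> K" using ex_pos_const_in_K by auto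
  then have ne: "K \<noteq> {}" by (metis empty_iff)
  have "continuous_on K (\<lambda>z. cmod (monomial \<alpha> z))" by (intro continuous_on_norm continuous_on_monom)
  from continuous_attains_sup[OF compact_K ne this]
  have "\<exists>\<xi>\<in>K. \<forall>z\<in>K. cmod (monomial \<alpha> z) \<le> cmod (monomial \<alpha> \<xi>)" .
  then have "\<exists>\<xi>. \<xi> \<in> K \<and> (\<forall>z\<in>K. cmod (monomial \<alpha> z) \<le> cmod (monomial \<alpha> \<xi>))" by blast
  then have "max_point \<alpha> \<in> K \<and> (\<forall>z\<in>K. cmod (monomial \<alpha> z) \<le> max_monom \<alpha>)"
    unfolding max_point_def by (rule someI_ex)
  then show "max_point \<alpha> \<in> K" "z \<in> K \<Longrightarrow> cmod (monomial \<alpha> z) \<le> max_monom \<alpha>" by auto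
qed

lemma max_monom_pos: "max_monom \<alpha> > 0"
proof -
  obtain d where d: "0 < d" "(\<chi> i. complex_of_real d) \<in> K" using ex_pos_const_in_K by blast
  have "0 < cmod (monomial \<alpha> (\<chi> i. complex_of_real d))" using d(1) by (simp add: monomial_def)
  then show ?thesis using le_max_monom[OF d(2), of \<alpha>] by linarith
qed

text \<open>A monomial is homogeneous, so room for a dilation by \<open>1 / r\<close> gains a factor
  exponential in the degree.\<close>

lemma monom_le_inside:
  assumes "0 < r" "(1 / r) *\<^sub>R y \<in> K" shows "cmod (monomial \<alpha> y) \<le> r ^ deg \<alpha> * max_monom \<alpha>"
proof -
  have "cmod (monomial \<alpha> y) = cmod (monomial \<alpha> (r *\<^sub>R (1 / r) *\<^sub>R y))" using assms(1) by simp
  also have "\<dots> = r ^ deg \<alpha> * cmod (monomial \<alpha> ((1 / r) *\<^sub>R y))"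
    unfolding norm_monom_scale[of _ r] using assms(1) by simp
  also have "\<dots> \<le> r ^ deg \<alpha> * max_monom \<alpha>"
    using assms by (intro mult_left_mono le_max_monom) auto
  finally show ?thesis .
qed

text \<open>Strict convexity in logarithmic coordinates: the componentwise geometric mean of two points of
  the closed domain lies well inside the domain unless the points have nearly the same moduli.\<close>

lemma rho_geometric_mean:
  assumes z: "z \<in> K" and w: "w \<in> K" and \<delta>: "0 \<le> \<delta>" "\<delta> \<le> 1" "\<delta> \<le> \<bar>cmod (z $ i) - cmod (w $ i)\<bar>"
  shows "rho p (\<chi> k. complex_of_real (sqrt (cmod (z $ k) * cmod (w $ k)))) \<le> 1 - (\<delta> ^ total_exponent)\<^sup>2 / 2"
proof -
  let ?a = "\<lambda>k. cmod (z $ k)" and ?b = "\<lambda>k. cmod (w $ k)"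
  let ?y = "\<chi> k. complex_of_real (sqrt (?a k * ?b k))"
  define D where "D k j = (?a k ^ (p k ! j) - ?b k ^ (p k ! j))\<^sup>2" for k j
  \<comment> \<open>With \<open>A\<close> and \<open>B\<close> the powers of \<open>?a k\<close> and
    \<open>?b k\<close> with exponent \<open>p k ! j\<close>, this is
    \<open>A * B = (A^2 + B^2 - (A - B)^2) / 2\<close>.\<close>
  have "cmod (?y $ k) ^ (2 * p k ! j) = (?a k ^ (2 * p k ! j) + ?b k ^ (2 * p k ! j) - D k j) / 2" for k j
  proof -
    have "cmod (?y $ k) ^ (2 * p k ! j) = (?a k * ?b k) ^ (p k ! j)"
      by (simp add: power_mult)
    also have "\<dots> = (?a k ^ (2 * p k ! j) + ?b k ^ (2 * p k ! j) - D k j) / 2"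
      by (simp add: D_def power_mult_distrib power2_diff mult.commute[of 2] power_mult)
    finally show ?thesis .
  qed
  then have "rho p ?y = (\<Sum>k\<in>UNIV. \<Sum>j<length (p k). (?a k ^ (2 * p k ! j) + ?b k ^ (2 * p k ! j) - D k j) / 2)"
    unfolding rho_def by (simp only:)
  then have "rho p ?y = (rho p z + rho p w - (\<Sum>k\<in>UNIV. \<Sum>j<length (p k). D k j)) / 2"
    unfolding rho_def by (simp only: sum_divide_distrib[symmetric] sum.distrib sum_subtractf)
  moreover have "(\<delta> ^ total_exponent)\<^sup>2 \<le> (\<Sum>k\<in>UNIV. \<Sum>j<length (p k). D k j)"
  proof -
    have "\<delta> ^ total_exponent \<le> \<delta> ^ (p i ! 0)"
      using \<delta> exponent_le_total[OF length_pos] by (intro power_decreasing) auto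
    also have "\<dots> \<le> \<bar>?a i - ?b i\<bar> ^ (p i ! 0)" using \<delta> by (intro power_mono) auto
    also have "\<dots> \<le> \<bar>?a i ^ (p i ! 0) - ?b i ^ (p i ! 0)\<bar>"
      using exponent_pos[OF length_pos] by (intro power_diff_ge) auto
    finally have "(\<delta> ^ total_exponent)\<^sup>2 \<le> \<bar>?a i ^ (p i ! 0) - ?b i ^ (p i ! 0)\<bar>\<^sup>2"
      using \<delta> by (intro power_mono) auto
    also have "\<dots> = D i 0" by (simp add: D_def)
    also have "\<dots> \<le> (\<Sum>j<length (p i). D i j)"
      by (rule member_le_sum) (use length_pos[of i] in \<open>auto simp: D_def\<close>)
    also have "\<dots> \<le> (\<Sum>k\<in>UNIV. \<Sum>j<length (p k). D k j)"
      by (rule member_le_sum) (auto simp: D_def intro!: sum_nonneg)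
    finally show ?thesis .
  qed
  moreover have "rho p z \<le> 1" "rho p w \<le> 1" using z w by (auto simp: closure_Omega)
  moreover have "r = (a + b - X) / 2 \<Longrightarrow> Y \<le> X \<Longrightarrow> a \<le> 1 \<Longrightarrow> b \<le> 1 \<Longrightarrow> r \<le> 1 - Y / 2"
    for r a b X Y :: real by simp
  ultimately show ?thesis by blast
qed

text \<open>The rate \<open>r\<close> depends on \<delta> but not on the multi-index. In the first
  estimate, the squared monomial at the geometric mean of \<open>z\<close> and the maximum point is
  the product of its two values there, and the mean lies well inside. In the second, setting the
  absent coordinate to 0 leaves the monomial unchanged and moves the point inside.\<close>

lemma monom_small_far:
  assumes \<delta>: "0 < \<delta>" "\<delta> \<le> 1"
  obtains r where "0 < r" "r < 1"
    "\<And>\<alpha> i z. z \<in> K \<Longrightarrow> \<delta> \<le> \<bar>cmod (z $ i) - cmod (max_point \<alpha> $ i)\<bar> \<Longrightarrow> cmod (monomial \<alpha> z) \<le> r ^ deg \<alpha> * max_monom \<alpha>"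
    "\<And>\<alpha> i z. z \<in> K \<Longrightarrow> \<delta> \<le> cmod (z $ i) \<Longrightarrow> \<alpha> i = 0 \<Longrightarrow> cmod (monomial \<alpha> z) \<le> r ^ deg \<alpha> * max_monom \<alpha>"
proof -
  define \<tau> where "\<tau> = (\<delta> ^ total_exponent)\<^sup>2 / 2"
  have "\<delta> ^ total_exponent \<le> 1" using \<delta> by (simp add: power_le_one)
  then have "(\<delta> ^ total_exponent)\<^sup>2 \<le> 1" using \<delta> by (simp add: power_le_one)
  then have \<tau>: "0 < \<tau>" "\<tau> \<le> 1" using \<delta> by (auto simp: \<tau>_def)
  obtain r where r: "0 < r" "r < 1" "\<And>y. rho p y \<le> 1 - \<tau> \<Longrightarrow> (1 / r) *\<^sub>R y \<in> K"
    using scale_into_K[OF \<tau>] by blast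
  show ?thesis
  proof (rule that[OF r(1,2)])
    fix \<alpha> i z assume z: "z \<in> K" and far: "\<delta> \<le> \<bar>cmod (z $ i) - cmod (max_point \<alpha> $ i)\<bar>"
    let ?y = "\<chi> k. complex_of_real (sqrt (cmod (z $ k) * cmod (max_point \<alpha> $ k)))"
    have "(1 / r) *\<^sub>R ?y \<in> K"
      using rho_geometric_mean[OF z max_point less_imp_le[OF \<delta>(1)] \<delta>(2) far]
      by (intro r(3)) (simp add: \<tau>_def)
    from monom_le_inside[OF r(1) this, of \<alpha>]
    have "(cmod (monomial \<alpha> ?y))\<^sup>2 \<le> (r ^ deg \<alpha> * max_monom \<alpha>)\<^sup>2" by (intro power_mono) auto
    moreover have "(cmod (monomial \<alpha> ?y))\<^sup>2 = cmod (monomial \<alpha> z) * max_monom \<alpha>"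
      unfolding norm_monom prod_power_distrib prod.distrib[symmetric]
    proof (intro prod.cong refl)
      fix k
      have "(cmod (?y $ k) ^ \<alpha> k)\<^sup>2 = ((cmod (?y $ k))\<^sup>2) ^ \<alpha> k"
        by (simp only: power_mult[symmetric] mult.commute)
      then show "(cmod (?y $ k) ^ \<alpha> k)\<^sup>2 = cmod (z $ k) ^ \<alpha> k * cmod (max_point \<alpha> $ k) ^ \<alpha> k"
        by (simp add: power_mult_distrib)
    qed
    ultimately have "cmod (monomial \<alpha> z) * max_monom \<alpha> \<le> (r ^ deg \<alpha> * r ^ deg \<alpha> * max_monom \<alpha>) * max_monom \<alpha>"
      by (simp add: power2_eq_square mult_ac)
    then have "cmod (monomial \<alpha> z) \<le> r ^ deg \<alpha> * r ^ deg \<alpha> * max_monom \<alpha>"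
      using max_monom_pos mult_right_le_imp_le by blast
    \<comment> \<open>One power is given up so that both estimates share the same rate.\<close>
    also have "\<dots> \<le> 1 * r ^ deg \<alpha> * max_monom \<alpha>"
      using r by (intro mult_right_mono) (auto intro: power_le_one)
    finally show "cmod (monomial \<alpha> z) \<le> r ^ deg \<alpha> * max_monom \<alpha>" by simp
  next
    fix \<alpha> :: "'n \<Rightarrow> nat" and i z
    assume z: "z \<in> K" and far: "\<delta> \<le> cmod (z $ i)" and 0: "\<alpha> i = 0"
    let ?a = "\<lambda>k. \<Sum>j<length (p k). cmod (z $ k) ^ (2 * p k ! j)"
    have "rho p (rot i 0 z) = (\<Sum>k\<in>UNIV - {i}. ?a k)"
    proof -
      have "(\<Sum>j<length (p i). cmod (rot i 0 z $ i) ^ (2 * p i ! j)) = 0"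
        using exponent_pos[of _ i] by (auto intro!: sum.neutral simp: Suc_le_eq)
      moreover have "(\<Sum>k\<in>UNIV - {i}. \<Sum>j<length (p k). cmod (rot i 0 z $ k) ^ (2 * p k ! j)) = (\<Sum>k\<in>UNIV - {i}. ?a k)"
        by (intro sum.cong) auto
      ultimately show ?thesis unfolding rho_def by (simp only: sum.remove[of UNIV i, OF finite UNIV_I])
    qed
    also have "\<dots> = rho p z - ?a i" unfolding rho_def by (simp add: sum.remove[of UNIV i])
    also have "\<dots> \<le> 1 - \<tau>"
    proof -
      have "\<tau> \<le> (\<delta> ^ total_exponent)\<^sup>2" by (simp add: \<tau>_def)
      also have "\<dots> = \<delta> ^ (2 * total_exponent)" by (simp add: power_mult mult.commute)
      also have "\<dots> \<le> \<delta> ^ (2 * p i ! 0)"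
        using \<delta> exponent_le_total[OF length_pos] by (intro power_decreasing) auto
      also have "\<dots> \<le> cmod (z $ i) ^ (2 * p i ! 0)" using \<delta> far by (intro power_mono) auto
      also have "\<dots> \<le> ?a i" by (rule member_le_sum) (use length_pos[of i] in auto)
      finally show ?thesis using z by (simp add: closure_Omega)
    qed
    finally have "cmod (monomial \<alpha> (rot i 0 z)) \<le> r ^ deg \<alpha> * max_monom \<alpha>"
      by (intro monom_le_inside r)
    then show "cmod (monomial \<alpha> z) \<le> r ^ deg \<alpha> * max_monom \<alpha>" by (simp add: monom_rot 0)
  qed
qed

text \<open>Shrink the moduli of \<xi> by \<open>r\<close>, raise each by \<open>2 * \<eta>\<close>
  while staying inside, and push the result outward to the surface. The margin \<eta> keeps every
  coordinate away from 0 on the ball, even where \<xi> has a zero coordinate.\<close>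

lemma lower_ball:
  assumes "0 < r" "r < 1"
  obtains \<eta> where "0 < \<eta>" "\<eta> \<le> 1"
    "\<And>\<xi>. \<xi> \<in> K \<Longrightarrow> \<exists>w\<in>S. \<forall>z\<in>ball w \<eta>. \<forall>k. r * cmod (\<xi> $ k) + \<eta> \<le> cmod (z $ k)"
proof -
  define n where "n = real CARD('n)"
  have n: "n > 0" by (simp add: n_def)
  have vec_norm: "norm (\<chi> k::'n. complex_of_real (f k)) \<le> n * b"
    if "\<And>k. 0 \<le> f k" "\<And>k. f k \<le> b" for f b
  proof -
    have "norm (\<chi> k::'n. complex_of_real (f k)) \<le> (\<Sum>k\<in>UNIV. cmod ((\<chi> k::'n. complex_of_real (f k)) $ k))"
      by (rule norm_vec_le_sum)
    also have "\<dots> \<le> (\<Sum>k\<in>(UNIV::'n set). b)" by (rule sum_mono) (use that in simp)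
    finally show ?thesis by (simp add: n_def)
  qed
  \<comment> \<open>Large enough for the points \<open>?x\<close> and \<open>?q\<close> below, whose
    moduli are at most \<open>1 + 2 * \<eta> \<le> 3\<close>.\<close>
  have "uniformly_continuous_on (cball 0 (n * 3)) (rho p)"
    by (rule compact_uniformly_continuous[OF continuous_on_rho compact_cball])
  moreover have "0 < 1 - r\<^sup>2" using assms by (simp add: power_less_one_iff abs_square_less_1)
  ultimately obtain d where d: "d > 0"
    "\<And>x y. x \<in> cball 0 (n * 3) \<Longrightarrow> y \<in> cball 0 (n * 3) \<Longrightarrow> dist y x < d \<Longrightarrow> dist (rho p y) (rho p x) < 1 - r\<^sup>2"
    unfolding uniformly_continuous_on_def by meson
  \<comment> \<open>Raising every modulus by \<open>2 * \<eta>\<close> moves a point by at most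
    \<open>2 * n * \<eta> \<le> d / 2\<close>.\<close>
  define \<eta> where "\<eta> = min 1 (d / (4 * n))"
  have \<eta>1: "\<eta> \<le> 1" unfolding \<eta>_def by (rule min.cobounded1)
  have \<eta>0: "0 < \<eta>" using d(1) n by (simp add: \<eta>_def)
  have "\<eta> \<le> d / (4 * n)" unfolding \<eta>_def by (rule min.cobounded2)
  then have \<eta>d: "4 * n * \<eta> \<le> d" using n by (simp add: field_simps)
  have "\<exists>w\<in>S. \<forall>z\<in>ball w \<eta>. \<forall>k. r * cmod (\<xi> $ k) + \<eta> \<le> cmod (z $ k)" if \<xi>: "\<xi> \<in> K" for \<xi>
  proof -
    let ?x = "\<chi> k. complex_of_real (r * cmod (\<xi> $ k))"
    let ?q = "\<chi> k. complex_of_real (r * cmod (\<xi> $ k) + 2 * \<eta>)"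
    have rk: "0 \<le> r * cmod (\<xi> $ k)" "r * cmod (\<xi> $ k) \<le> 1" for k
      using assms norm_nth_le_1[OF \<xi>, of k] mult_mono[of r 1 "cmod (\<xi> $ k)" 1] by auto
    have x: "?x \<in> cball 0 (n * 3)"
      unfolding mem_cball_0
    proof (rule vec_norm)
      show "r * cmod (\<xi> $ k) \<le> 3" for k using rk(2)[of k] by linarith
    qed (rule rk(1))
    have q: "?q \<in> cball 0 (n * 3)"
      unfolding mem_cball_0
    proof (rule vec_norm)
      show "0 \<le> r * cmod (\<xi> $ k) + 2 * \<eta>" for k using rk(1)[of k] \<eta>0 by linarith
      show "r * cmod (\<xi> $ k) + 2 * \<eta> \<le> 3" for k using rk(2)[of k] \<eta>1 by linarith
    qed
    have "?q - ?x = (\<chi> k. complex_of_real (2 * \<eta>))" by (simp add: vec_eq_iff)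
    then have "dist ?q ?x \<le> n * (2 * \<eta>)" unfolding dist_norm
      using vec_norm[of "\<lambda>_. 2 * \<eta>" "2 * \<eta>"] \<eta>0 by simp
    also have "\<dots> < d" using \<eta>d \<eta>0 n mult_pos_pos[OF n \<eta>0] by linarith
    finally have "dist (rho p ?q) (rho p ?x) < 1 - r\<^sup>2" by (rule d(2)[OF x q])
    moreover have "rho p ?x \<le> r\<^sup>2"
    proof -
      have "rho p ?x \<le> rho p (r *\<^sub>R \<xi>)"
        using assms(1) by (intro rho_mono) (simp add: norm_mult)
      also have "\<dots> \<le> r\<^sup>2 * rho p \<xi>" using assms by (intro rho_scale_le) auto
      also have "\<dots> \<le> r\<^sup>2 * 1" using \<xi> by (intro mult_left_mono) (auto simp: closure_Omega)
      finally show ?thesis by simp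
    qed
    ultimately have q1: "rho p ?q < 1" by (simp add: dist_real_def)
    have qk: "cmod (?q $ k) = r * cmod (\<xi> $ k) + 2 * \<eta>" for k
      using rk(1)[of k] \<eta>0 by (simp add: abs_of_nonneg del: of_real_add of_real_mult)
    have q0: "0 < rho p ?q"
    proof -
      fix i :: 'n
      have "rho p 0 < rho p ?q"
      proof (rule rho_strict_mono)
        show "cmod (0 $ k) \<le> cmod (?q $ k)" for k by (simp only: zero_index norm_zero norm_ge_zero)
        show "cmod (0 $ i) < cmod (?q $ i)"
          unfolding qk zero_index norm_zero using rk(1)[of i] \<eta>0 by linarith
      qed
      then show ?thesis by (simp only: rho_0)
    qed
    \<comment> \<open>\<open>?q\<close> lies inside, and \<open>rho\<close> grows at least
      quadratically along its ray, so the factor \<open>1 / rho p ?q\<close> is enough to reach the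
      surface.\<close>
    have "\<exists>t. 1 \<le> t \<and> t \<le> 1 / rho p ?q \<and> rho p (t *\<^sub>R ?q) = 1"
    proof (rule IVT')
      have "1 \<le> 1 / rho p ?q" using q0 q1 by simp
      moreover have "(1 / R)\<^sup>2 * R = 1 / R" if "R > 0" for R :: real
        using that by (simp add: power2_eq_square)
      from this[OF q0] have "1 / rho p ?q \<le> rho p ((1 / rho p ?q) *\<^sub>R ?q)"
        using rho_scale_ge[OF \<open>1 \<le> 1 / rho p ?q\<close>, of ?q] by (simp only:)
      ultimately show "1 \<le> rho p ((1 / rho p ?q) *\<^sub>R ?q)" by (rule order_trans)
      show "continuous_on {1..1 / rho p ?q} (\<lambda>t. rho p (t *\<^sub>R ?q))"
        by (rule continuous_on_compose2[OF continuous_on_rho[of UNIV]]) (auto intro!: continuous_intros)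
    qed (use q0 q1 in auto)
    then obtain t where t: "1 \<le> t" "rho p (t *\<^sub>R ?q) = 1" by blast
    have "r * cmod (\<xi> $ k) + \<eta> \<le> cmod (z $ k)" if z: "z \<in> ball (t *\<^sub>R ?q) \<eta>" for z k
    proof -
      have "cmod ((t *\<^sub>R ?q - z) $ k) \<le> norm (t *\<^sub>R ?q - z)" by (rule Finite_Cartesian_Product.norm_nth_le)
      then have "cmod ((t *\<^sub>R ?q) $ k - z $ k) \<le> \<eta>"
        using z by (simp only: mem_ball dist_norm vector_minus_component)
      moreover have "cmod ((t *\<^sub>R ?q) $ k) \<ge> r * cmod (\<xi> $ k) + 2 * \<eta>"
        unfolding scaleR_nth_norm qk using t(1) rk(1)[of k] \<eta>0
          mult_right_mono[of 1 t "r * cmod (\<xi> $ k) + 2 * \<eta>"] by simp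
      ultimately show ?thesis using norm_triangle_ineq2[of "(t *\<^sub>R ?q) $ k" "z $ k"] by linarith
    qed
    then show ?thesis using t(2) by (intro bexI[of _ "t *\<^sub>R ?q"]) (auto simp: S_eq)
  qed
  then show ?thesis using that[OF \<eta>0 \<eta>1] by blast
qed

lemma sigma_measurable_continuous: "continuous_on S f \<Longrightarrow> f \<in> borel_measurable \<sigma>"
  for f :: "complex ^ 'n \<Rightarrow> 'b::topological_space"
  using borel_measurable_continuous_on_restrict measurable_cong_sets[OF sets_sigma_borel refl] by blast

lemma sigma_L2_continuous:
  assumes "continuous_on S f" shows "f \<in> L2 \<sigma>"
proof -
  interpret finite_measure \<sigma> by (rule finite_measure_sigma)
  have "bounded (f ` S)" by (intro compact_imp_bounded compact_continuous_image assms compact_frontier_Omega)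
  then obtain B where B: "\<And>z. z \<in> S \<Longrightarrow> cmod (f z) \<le> B" by (auto simp: bounded_iff)
  show ?thesis
  proof (rule L2I_bound)
    show "f \<in> borel_measurable \<sigma>" by (rule sigma_measurable_continuous[OF assms])
    show "(cmod (f x))\<^sup>2 \<le> B\<^sup>2" if "x \<in> space \<sigma>" for x
      using B[of x] that by (intro power_mono) (auto simp: space_sigma)
  qed simp
qed

lemma L2_norm_sq_ge:
  assumes f: "f \<in> L2 \<sigma>" and A: "A \<in> sets \<sigma>" and c: "c \<le> measure \<sigma> A" and v: "0 \<le> v"
    and ge: "\<And>z. z \<in> A \<Longrightarrow> v \<le> cmod (f z)"
  shows "c * v\<^sup>2 \<le> (L2_norm \<sigma> f)\<^sup>2"
proof -
  interpret finite_measure \<sigma> by (rule finite_measure_sigma)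
  have "c * v\<^sup>2 \<le> measure \<sigma> A * v\<^sup>2" by (intro mult_right_mono c) auto
  also have "\<dots> = (\<integral>z. v\<^sup>2 * indicator A z \<partial>\<sigma>)" using A by (simp add: Int_absorb2 sets.sets_into_space)
  also have "\<dots> \<le> (\<integral>z. (cmod (f z))\<^sup>2 \<partial>\<sigma>)"
  proof (rule integral_mono[OF _ L2_integrable_norm[OF f]])
    show "integrable \<sigma> (\<lambda>z. v\<^sup>2 * indicator A z)"
      using A by (intro integrable_mult_right integrable_real_indicator) (auto simp: less_top[symmetric])
    show "v\<^sup>2 * indicator A z \<le> (cmod (f z))\<^sup>2" for z
      using v ge[of z] by (auto simp: indicator_def intro!: power_mono)
  qed
  finally show ?thesis by (simp add: L2_norm_sq)
qed

lemma L2_norm_sq_le_pointwise: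
  assumes f: "f \<in> L2 \<sigma>" and g: "g \<in> L2 \<sigma>" and "0 \<le> b"
    and le: "\<And>z. z \<in> S \<Longrightarrow> (cmod (f z))\<^sup>2 \<le> a * (cmod (g z))\<^sup>2 + b"
  shows "(L2_norm \<sigma> f)\<^sup>2 \<le> a * (L2_norm \<sigma> g)\<^sup>2 + b"
proof -
  interpret finite_measure \<sigma> by (rule finite_measure_sigma)
  have "emeasure \<sigma> S \<le> 1" using sigma_null_or_prob by auto
  then have m: "measure \<sigma> (space \<sigma>) \<le> 1" by (simp add: space_sigma emeasure_eq_measure)
  have "(L2_norm \<sigma> f)\<^sup>2 \<le> (\<integral>z. a * (cmod (g z))\<^sup>2 + b \<partial>\<sigma>)"
    unfolding L2_norm_sq
    by (rule integral_mono) (use le L2_integrable_norm[OF f] L2_integrable_norm[OF g] in \<open>auto simp: space_sigma\<close>)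
  also have "\<dots> = a * (L2_norm \<sigma> g)\<^sup>2 + b * measure \<sigma> (space \<sigma>)"
    unfolding L2_norm_sq using L2_integrable_norm[OF g] by simp
  also have "b * measure \<sigma> (space \<sigma>) \<le> b * 1" using m \<open>0 \<le> b\<close> by (intro mult_left_mono)
  finally show ?thesis by simp
qed

lemma monomial_L2: "monomial \<alpha> \<in> L2 \<sigma>"
  by (intro sigma_L2_continuous continuous_on_monom)

text \<open>If \<open>\<alpha> i = 0\<close>, truncated subtraction leaves \<alpha> unchanged; the
  coefficients of such terms are always required to be 0.\<close>

definition lowered :: "'n \<Rightarrow> ('n \<Rightarrow> nat) \<Rightarrow> 'n \<Rightarrow> nat" where
  "lowered i \<alpha> = \<alpha>(i := \<alpha> i - 1)"

text \<open>The surface splits according to whether the modulus of \<open>z $ i\<close> is within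
  \<delta> of its value at the maximum point (or of 0 if \<open>\<alpha> i = 0\<close>). Nearby, the
  error is pointwise at most \<open>3 * \<delta>\<close> times the monomial; elsewhere it is
  exponentially small compared with the norm of the monomial.\<close>

lemma conj_coordinate_estimate:
  assumes nonnull: "\<not> (\<forall>A. emeasure \<sigma> A = 0)" and \<epsilon>: "\<epsilon> > 0"
  shows "\<exists>N. \<forall>\<alpha>. deg \<alpha> \<ge> N \<longrightarrow> (\<exists>d. (\<alpha> i = 0 \<longrightarrow> d = 0) \<and>
    L2_norm \<sigma> (\<lambda>z. cnj (z $ i) * monomial \<alpha> z - d * monomial (lowered i \<alpha>) z) \<le> \<epsilon> * L2_norm \<sigma> (monomial \<alpha>))"
proof -
  \<comment> \<open>The near part contributes \<open>9 * \<delta>^2\<close> and the far part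
    \<open>\<delta>^2\<close> to the squared ratio; together they stay below
    \<open>(4 * \<delta>)^2 \<le> \<epsilon>^2\<close>.\<close>
  define \<delta> where "\<delta> = min 1 (\<epsilon> / 4)"
  have \<delta>: "0 < \<delta>" "\<delta> \<le> 1" "\<delta> \<le> \<epsilon> / 4" using \<epsilon> by (auto simp: \<delta>_def)
  obtain r where r: "0 < r" "r < 1"
    "\<And>\<alpha> i z. z \<in> K \<Longrightarrow> \<delta> \<le> \<bar>cmod (z $ i) - cmod (max_point \<alpha> $ i)\<bar> \<Longrightarrow> cmod (monomial \<alpha> z) \<le> r ^ deg \<alpha> * max_monom \<alpha>"
    "\<And>\<alpha> i z. z \<in> K \<Longrightarrow> \<delta> \<le> cmod (z $ i) \<Longrightarrow> \<alpha> i = 0 \<Longrightarrow> cmod (monomial \<alpha> z) \<le> r ^ deg \<alpha> * max_monom \<alpha>"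
    using monom_small_far[OF \<delta>(1,2)] by blast
  \<comment> \<open>Strictly between \<open>r\<close> and 1: the far part is bounded with rate
    \<open>r\<close>, the norm from below with rate \<open>s\<close>, and the quotient
    \<open>r / s\<close> still decays.\<close>
  define s where "s = (1 + r) / 2"
  have s: "0 < s" "s < 1" "r < s" using r(1,2) by (auto simp: s_def)
  obtain \<eta> where \<eta>: "0 < \<eta>" "\<eta> \<le> 1"
    "\<And>\<xi>. \<xi> \<in> K \<Longrightarrow> \<exists>w\<in>S. \<forall>z\<in>ball w \<eta>. \<forall>k. s * cmod (\<xi> $ k) + \<eta> \<le> cmod (z $ k)"
    using lower_ball[OF s(1,2)] by blast
  obtain c where c: "c > 0" "\<And>w. w \<in> S \<Longrightarrow> c \<le> measure \<sigma> (S \<inter> ball w \<eta>)"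
    using sigma_ball_uniform[OF nonnull \<eta>(1)] by blast
  \<comment> \<open>Covers both \<alpha> equal to \<beta> and \<alpha> one higher than \<beta> at
    \<open>i\<close>; in the latter case the extra factor \<open>z $ i\<close> is at least \<eta> on
    the ball.\<close>
  have lower: "c * (\<eta> * (s ^ deg \<beta> * max_monom \<beta>))\<^sup>2 \<le> (L2_norm \<sigma> (monomial \<alpha>))\<^sup>2"
    if \<alpha>: "\<alpha> = \<beta> \<or> (\<forall>z. monomial \<alpha> z = z $ i * monomial \<beta> z)" for \<alpha> \<beta>
  proof -
    obtain w where w: "w \<in> S" "\<forall>z\<in>ball w \<eta>. \<forall>k. s * cmod (max_point \<beta> $ k) + \<eta> \<le> cmod (z $ k)"
      using \<eta>(3)[OF max_point] by blast
    show ?thesis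
    proof (rule L2_norm_sq_ge[OF monomial_L2 _ c(2)[OF w(1)]])
      show "S \<inter> ball w \<eta> \<in> sets \<sigma>" by (auto simp: sets_sigma)
      show "0 \<le> \<eta> * (s ^ deg \<beta> * max_monom \<beta>)" using \<eta>(1) s(1) by simp
      fix z assume "z \<in> S \<inter> ball w \<eta>"
      then have z: "s * cmod (max_point \<beta> $ k) + \<eta> \<le> cmod (z $ k)" for k using w(2) by blast
      have "s ^ deg \<beta> * max_monom \<beta> = cmod (monomial \<beta> (s *\<^sub>R max_point \<beta>))"
        using s(1) by (simp add: norm_monom_scale)
      also have "\<dots> \<le> cmod (monomial \<beta> z)"
      proof (rule norm_monom_mono)
        fix k show "cmod ((s *\<^sub>R max_point \<beta>) $ k) \<le> cmod (z $ k)"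
          unfolding scaleR_nth_norm using z[of k] s(1) \<eta>(1) by simp
      qed
      finally have b: "s ^ deg \<beta> * max_monom \<beta> \<le> cmod (monomial \<beta> z)" .
      have "0 \<le> s * cmod (max_point \<beta> $ i)" using s(1) by simp
      then have zi: "\<eta> \<le> cmod (z $ i)" using z[of i] by linarith
      from \<alpha> show "\<eta> * (s ^ deg \<beta> * max_monom \<beta>) \<le> cmod (monomial \<alpha> z)"
      proof
        assume "\<alpha> = \<beta>"
        have "\<eta> * (s ^ deg \<beta> * max_monom \<beta>) \<le> 1 * cmod (monomial \<beta> z)"
          using b \<eta> s(1) by (intro mult_mono) auto
        then show ?thesis by (simp add: \<open>\<alpha> = \<beta>\<close>)
      next
        assume *: "\<forall>z. monomial \<alpha> z = z $ i * monomial \<beta> z"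
        have "\<eta> * (s ^ deg \<beta> * max_monom \<beta>) \<le> cmod (z $ i) * cmod (monomial \<beta> z)"
          using b zi s(1) by (intro mult_mono) auto
        then show ?thesis by (simp add: * norm_mult)
      qed
    qed
  qed
  have "(\<lambda>n. ((r / s) ^ n)\<^sup>2) \<longlonglongrightarrow> 0\<^sup>2"
    using r(1) s by (intro tendsto_power LIMSEQ_power_zero) auto
  moreover have "0 < c * \<eta>\<^sup>2 * \<delta>\<^sup>2" using c(1) \<eta>(1) \<delta>(1) by simp
  ultimately have "\<forall>\<^sub>F n in sequentially. ((r / s) ^ n)\<^sup>2 < c * \<eta>\<^sup>2 * \<delta>\<^sup>2"
    by (intro order_tendstoD(2)[where y = "0\<^sup>2"]) auto
  then obtain N where N: "\<And>n. n \<ge> N \<Longrightarrow> ((r / s) ^ n)\<^sup>2 < c * \<eta>\<^sup>2 * \<delta>\<^sup>2"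
    unfolding eventually_sequentially by blast
  have far: "(r ^ deg \<beta> * max_monom \<beta>)\<^sup>2 \<le> \<delta>\<^sup>2 * (L2_norm \<sigma> (monomial \<alpha>))\<^sup>2"
    if \<alpha>: "\<alpha> = \<beta> \<or> (\<forall>z. monomial \<alpha> z = z $ i * monomial \<beta> z)" and n: "deg \<beta> \<ge> N" for \<alpha> \<beta>
  proof -
    have "r ^ deg \<beta> = (r / s) ^ deg \<beta> * s ^ deg \<beta>" using s(1) by (simp add: power_divide)
    then have "(r ^ deg \<beta> * max_monom \<beta>)\<^sup>2 = ((r / s) ^ deg \<beta>)\<^sup>2 * (s ^ deg \<beta> * max_monom \<beta>)\<^sup>2"
      by (simp only: power_mult_distrib mult.assoc)
    also have "\<dots> \<le> (c * \<eta>\<^sup>2 * \<delta>\<^sup>2) * (s ^ deg \<beta> * max_monom \<beta>)\<^sup>2"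
      using N[OF n] by (intro mult_right_mono) auto
    also have "\<dots> = \<delta>\<^sup>2 * (c * (\<eta> * (s ^ deg \<beta> * max_monom \<beta>))\<^sup>2)"
      by (simp add: power_mult_distrib mult_ac)
    also have "\<dots> \<le> \<delta>\<^sup>2 * (L2_norm \<sigma> (monomial \<alpha>))\<^sup>2"
      by (intro mult_left_mono lower \<alpha>) auto
    finally show ?thesis .
  qed
  have root: "x \<le> \<epsilon> * L2_norm \<sigma> (monomial \<alpha>)"
    if "x\<^sup>2 \<le> 9 * \<delta>\<^sup>2 * (L2_norm \<sigma> (monomial \<alpha>))\<^sup>2 + b" "b \<le> \<delta>\<^sup>2 * (L2_norm \<sigma> (monomial \<alpha>))\<^sup>2" for x b \<alpha>
  proof (rule power2_le_imp_le)
    have "x\<^sup>2 \<le> 16 * (\<delta>\<^sup>2 * (L2_norm \<sigma> (monomial \<alpha>))\<^sup>2)"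
    proof -
      have "0 \<le> \<delta>\<^sup>2 * (L2_norm \<sigma> (monomial \<alpha>))\<^sup>2" by simp
      then show ?thesis using that unfolding mult.assoc by linarith
    qed
    also have "\<dots> = (4 * \<delta>)\<^sup>2 * (L2_norm \<sigma> (monomial \<alpha>))\<^sup>2" by (simp add: power_mult_distrib)
    also have "\<dots> \<le> \<epsilon>\<^sup>2 * (L2_norm \<sigma> (monomial \<alpha>))\<^sup>2"
      using \<delta> by (intro mult_right_mono power_mono) auto
    finally show "x\<^sup>2 \<le> (\<epsilon> * L2_norm \<sigma> (monomial \<alpha>))\<^sup>2" by (simp add: power_mult_distrib)
  qed (use \<epsilon> in simp)
  have SK: "z \<in> K" if "z \<in> S" for z using that frontier_subset_K by blast
  \<comment> \<open>Degree \<open>Suc N\<close>, because for \<open>\<alpha> i > 0\<close> the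
    bounds are applied to \<beta>, whose degree is one lower.\<close>
  have "\<exists>d. (\<alpha> i = 0 \<longrightarrow> d = 0) \<and>
    L2_norm \<sigma> (\<lambda>z. cnj (z $ i) * monomial \<alpha> z - d * monomial (lowered i \<alpha>) z) \<le> \<epsilon> * L2_norm \<sigma> (monomial \<alpha>)"
    if deg: "deg \<alpha> \<ge> Suc N" for \<alpha>
  proof (cases "\<alpha> i = 0")
    case True
    let ?b = "(r ^ deg \<alpha> * max_monom \<alpha>)\<^sup>2"
    have "(L2_norm \<sigma> (\<lambda>z. cnj (z $ i) * monomial \<alpha> z))\<^sup>2 \<le> (9 * \<delta>\<^sup>2) * (L2_norm \<sigma> (monomial \<alpha>))\<^sup>2 + ?b"
    proof (rule L2_norm_sq_le_pointwise[OF _ monomial_L2])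
      show "(\<lambda>z. cnj (z $ i) * monomial \<alpha> z) \<in> L2 \<sigma>"
        by (intro sigma_L2_continuous continuous_intros continuous_on_monom)
      fix z assume z: "z \<in> S"
      show "(cmod (cnj (z $ i) * monomial \<alpha> z))\<^sup>2 \<le> (9 * \<delta>\<^sup>2) * (cmod (monomial \<alpha> z))\<^sup>2 + ?b"
      proof (cases "\<delta> \<le> cmod (z $ i)")
        case far: True
        have "cmod (cnj (z $ i) * monomial \<alpha> z) \<le> 1 * (r ^ deg \<alpha> * max_monom \<alpha>)"
          unfolding norm_mult complex_mod_cnj using norm_nth_le_1[OF SK[OF z]]
          by (intro mult_mono r(4)[where \<alpha> = \<alpha> and i = i, OF SK[OF z] far True]) auto
        then have "(cmod (cnj (z $ i) * monomial \<alpha> z))\<^sup>2 \<le> ?b" by (intro power_mono) auto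
        moreover have "0 \<le> (9 * \<delta>\<^sup>2) * (cmod (monomial \<alpha> z))\<^sup>2" by simp
        ultimately show ?thesis by linarith
      next
        case False
        have "(cmod (cnj (z $ i) * monomial \<alpha> z))\<^sup>2 = (cmod (z $ i))\<^sup>2 * (cmod (monomial \<alpha> z))\<^sup>2"
          by (simp add: norm_mult power_mult_distrib)
        also have "\<dots> \<le> (3 * \<delta>)\<^sup>2 * (cmod (monomial \<alpha> z))\<^sup>2"
          using False \<delta> by (intro mult_right_mono power_mono) auto
        also have "\<dots> = 9 * \<delta>\<^sup>2 * (cmod (monomial \<alpha> z))\<^sup>2" by (simp add: power_mult_distrib)
        finally show ?thesis by (simp add: add_increasing2)
      qed
    qed simp
    from root[OF this] far[of \<alpha> \<alpha>] deg show ?thesis by (intro exI[of _ 0]) simp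
  next
    case False
    define \<beta> where "\<beta> = lowered i \<alpha>"
    have \<alpha>\<beta>: "monomial \<alpha> z = z $ i * monomial \<beta> z" for z
      unfolding \<beta>_def lowered_def by (rule monom_Suc) (use False in simp)
    have "deg \<alpha> = Suc (deg \<beta>)" unfolding \<beta>_def lowered_def by (rule deg_Suc) (use False in simp)
    then have deg\<beta>: "deg \<beta> \<ge> N" using deg by simp
    define b where "b = cmod (max_point \<beta> $ i)"
    have b01: "0 \<le> b" "b \<le> 1" unfolding b_def using norm_nth_le_1[OF max_point] by auto
    \<comment> \<open>The obvious guess is the squared modulus at the maximum point. When that
      modulus is small it is replaced by 0, as the error has to vanish with
      \<open>z $ i\<close>.\<close>
    define d where "d = (if b < 2 * \<delta> then 0 else b\<^sup>2)"
    have d01: "0 \<le> d" "d \<le> 1" using b01 by (auto simp: d_def power_le_one)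
    let ?b = "(r ^ deg \<beta> * max_monom \<beta>)\<^sup>2"
    let ?f = "\<lambda>z. cnj (z $ i) * monomial \<alpha> z - complex_of_real d * monomial \<beta> z"
    have f: "cmod (?f z) = \<bar>(cmod (z $ i))\<^sup>2 - d\<bar> * cmod (monomial \<beta> z)" for z
    proof -
      have "?f z = complex_of_real ((cmod (z $ i))\<^sup>2 - d) * monomial \<beta> z"
        using complex_norm_square[of "z $ i"] by (simp add: \<alpha>\<beta> algebra_simps)
      then show ?thesis by (simp only: norm_mult norm_of_real)
    qed
    have "(L2_norm \<sigma> ?f)\<^sup>2 \<le> (9 * \<delta>\<^sup>2) * (L2_norm \<sigma> (monomial \<alpha>))\<^sup>2 + ?b"
    proof (rule L2_norm_sq_le_pointwise[OF _ monomial_L2])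
      show "?f \<in> L2 \<sigma>" by (intro sigma_L2_continuous continuous_intros continuous_on_monom)
      fix z assume z: "z \<in> S"
      define a where "a = cmod (z $ i)"
      have a01: "0 \<le> a" "a \<le> 1" unfolding a_def using norm_nth_le_1[OF SK[OF z]] by auto
      have "0 \<le> a\<^sup>2" by simp
      moreover have "a\<^sup>2 \<le> 1" using a01 by (simp add: power_le_one)
      ultimately have ad: "\<bar>a\<^sup>2 - d\<bar> \<le> 1" using d01 by linarith
      show "(cmod (?f z))\<^sup>2 \<le> (9 * \<delta>\<^sup>2) * (cmod (monomial \<alpha> z))\<^sup>2 + ?b"
      proof (cases "\<delta> \<le> \<bar>a - b\<bar>")
        case True
        have "cmod (?f z) \<le> 1 * (r ^ deg \<beta> * max_monom \<beta>)"
          unfolding f a_def[symmetric] using ad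
          by (intro mult_mono r(3)[OF SK[OF z] True[unfolded a_def b_def]]) auto
        then have "(cmod (?f z))\<^sup>2 \<le> ?b" by (intro power_mono) auto
        moreover have "0 \<le> (9 * \<delta>\<^sup>2) * (cmod (monomial \<alpha> z))\<^sup>2" by simp
        ultimately show ?thesis by linarith
      next
        \<comment> \<open>The factor \<open>a\<close> in the next bound is what turns the monomial
          of \<beta> into that of \<alpha>. If \<open>b < 2 * \<delta>\<close>, then
          \<open>d = 0\<close> and \<open>a < 3 * \<delta>\<close>.\<close>
        case near: False
        have "\<bar>a\<^sup>2 - d\<bar> \<le> 3 * \<delta> * a"
        proof (cases "b < 2 * \<delta>")
          case True
          have "a * a \<le> (3 * \<delta>) * a" using near True a01 by (intro mult_right_mono) auto
          then show ?thesis using True by (simp add: d_def power2_eq_square)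
        next
          \<comment> \<open>Here \<open>b \<ge> 2 * \<delta>\<close> and \<open>a\<close> is within
            \<delta> of \<open>b\<close>, hence \<open>a > \<delta>\<close>,
            \<open>b < 2 * a\<close> and \<open>a + b \<le> 3 * a\<close>.\<close>
          case False
          have "\<bar>a\<^sup>2 - b\<^sup>2\<bar> = \<bar>a - b\<bar> * (a + b)"
            using a01 b01 by (simp add: power2_eq_square square_diff_square_factored abs_mult mult.commute)
          also have "\<dots> \<le> \<delta> * (3 * a)" using near False a01 b01 \<delta> by (intro mult_mono) auto
          finally show ?thesis using False by (simp add: d_def mult_ac)
        qed
        then have "cmod (?f z) \<le> (3 * \<delta> * a) * cmod (monomial \<beta> z)"
          unfolding f a_def[symmetric] by (intro mult_right_mono) auto
        also have "\<dots> = 3 * \<delta> * cmod (monomial \<alpha> z)" by (simp add: \<alpha>\<beta> norm_mult a_def)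
        finally have "(cmod (?f z))\<^sup>2 \<le> (3 * \<delta> * cmod (monomial \<alpha> z))\<^sup>2" by (intro power_mono) auto
        also have "\<dots> = 9 * \<delta>\<^sup>2 * (cmod (monomial \<alpha> z))\<^sup>2" by (simp add: power_mult_distrib)
        finally show ?thesis by (simp add: add_increasing2)
      qed
    qed simp
    from root[OF this far[OF _ deg\<beta>]] \<alpha>\<beta>
    have "L2_norm \<sigma> ?f \<le> \<epsilon> * L2_norm \<sigma> (monomial \<alpha>)" by blast
    then show ?thesis using False by (intro exI[of _ "complex_of_real d"]) (simp add: \<beta>_def)
  qed
  then show ?thesis by (intro exI[of _ "Suc N"]) blast
qed

section \<open>The Hardy space\<close>

lemma A_algebra_continuous_S: "f \<in> A_algebra p \<Longrightarrow> continuous_on S f"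
  using continuous_on_subset[OF _ frontier_subset_K] by (auto simp: A_algebra_def)

lemma A_algebra_L2: "f \<in> A_algebra p \<Longrightarrow> f \<in> L2 \<sigma>"
  by (intro sigma_L2_continuous A_algebra_continuous_S)

lemma A_algebra_const: "(\<lambda>z. c) \<in> A_algebra p"
proof -
  have "holomorphic_several (\<lambda>z. c) (Omega p)"
    unfolding holomorphic_several_def by (intro ballI exI[of _ "\<lambda>_. 0"]) auto
  then show ?thesis by (simp add: A_algebra_def)
qed

lemma A_algebra_coord:
  assumes "f \<in> A_algebra p" shows "(\<lambda>z. z $ i * f z) \<in> A_algebra p"
proof -
  have "holomorphic_several (\<lambda>z. z $ i * f z) (Omega p)"
    unfolding holomorphic_several_def
  proof
    fix z assume "z \<in> Omega p"
    then obtain D where D: "(f has_derivative D) (at z)" "\<And>c v. D (c *s v) = c * D v"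
      using assms by (auto simp: A_algebra_def holomorphic_several_def)
    have "((\<lambda>z. z $ i * f z) has_derivative (\<lambda>v. z $ i * D v + v $ i * f z)) (at z)"
      by (rule has_derivative_mult[OF bounded_linear_imp_has_derivative[OF bounded_linear_vec_nth] D(1)])
    then show "\<exists>D. ((\<lambda>z. z $ i * f z) has_derivative D) (at z) \<and> (\<forall>c v. D (c *s v) = c * D v)"
      by (intro exI[of _ "\<lambda>v. z $ i * D v + v $ i * f z"]) (auto simp: D(2) algebra_simps)
  qed
  moreover have "continuous_on K (\<lambda>z. z $ i * f z)"
    using assms by (intro continuous_intros) (auto simp: A_algebra_def)
  ultimately show ?thesis by (simp add: A_algebra_def)
qed

lemma A_algebra_lincomb:
  assumes "f \<in> A_algebra p" "g \<in> A_algebra p" shows "(\<lambda>z. a * f z + b * g z) \<in> A_algebra p"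
proof -
  have "holomorphic_several (\<lambda>z. a * f z + b * g z) (Omega p)"
    unfolding holomorphic_several_def
  proof
    fix z assume z: "z \<in> Omega p"
    obtain D where D: "(f has_derivative D) (at z)" "\<And>c v. D (c *s v) = c * D v"
      using assms(1) z by (auto simp: A_algebra_def holomorphic_several_def)
    obtain E where E: "(g has_derivative E) (at z)" "\<And>c v. E (c *s v) = c * E v"
      using assms(2) z by (auto simp: A_algebra_def holomorphic_several_def)
    have "((\<lambda>z. a * f z + b * g z) has_derivative (\<lambda>v. a * D v + b * E v)) (at z)"
      by (intro has_derivative_add has_derivative_mult_right D E)
    then show "\<exists>D. ((\<lambda>z. a * f z + b * g z) has_derivative D) (at z) \<and> (\<forall>c v. D (c *s v) = c * D v)"
      by (intro exI[of _ "\<lambda>v. a * D v + b * E v"]) (auto simp: D(2) E(2) algebra_simps)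
  qed
  moreover have "continuous_on K (\<lambda>z. a * f z + b * g z)"
    using assms by (intro continuous_intros) (auto simp: A_algebra_def)
  ultimately show ?thesis by (simp add: A_algebra_def)
qed

lemma A_algebra_monomial: "monomial \<alpha> \<in> A_algebra p"
proof -
  have pow: "(\<lambda>z. (z $ i) ^ n * f z) \<in> A_algebra p" if "f \<in> A_algebra p" for i n f
    using that by (induction n) (auto simp: mult.assoc dest: A_algebra_coord)
  have "(\<lambda>z. \<Prod>i\<in>I. (z $ i) ^ \<alpha> i) \<in> A_algebra p" if "finite I" for I
    using that by (induction I rule: finite_induct) (auto intro: pow A_algebra_const)
  then show ?thesis unfolding monomial_def[abs_def] by simp
qed

lemma A_algebra_subset_hardy: "f \<in> A_algebra p \<Longrightarrow> f \<in> hardy p"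
  by (auto simp: hardy_def A_algebra_L2 intro!: bexI[of _ f])

lemma hardy_approx:
  assumes "f \<in> hardy p" "e > 0"
  obtains g where "g \<in> A_algebra p" "L2_norm \<sigma> (\<lambda>z. f z - g z) < e"
  using assms by (auto simp: hardy_def)

lemma hardyI:
  assumes "f \<in> L2 \<sigma>" "\<And>e. e > 0 \<Longrightarrow> \<exists>g\<in>A_algebra p. L2_norm \<sigma> (\<lambda>z. f z - g z) < e"
  shows "f \<in> hardy p"
  using assms by (auto simp: hardy_def)

lemma hardy_L2: "f \<in> hardy p \<Longrightarrow> f \<in> L2 \<sigma>"
  by (simp add: hardy_def)

sublocale H: L2_closed_subspace \<sigma> "hardy p"
proof
  show "f \<in> L2 \<sigma>" if "f \<in> hardy p" for f by (rule hardy_L2[OF that])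
  show "(\<lambda>x. 0) \<in> hardy p" by (intro A_algebra_subset_hardy A_algebra_const)
  show "(\<lambda>x. f x + g x) \<in> hardy p" if f: "f \<in> hardy p" and g: "g \<in> hardy p" for f g
  proof (rule hardyI)
    show "(\<lambda>x. f x + g x) \<in> L2 \<sigma>" by (intro L2_add hardy_L2 f g)
    fix e :: real assume "e > 0"
    then have e: "e / 2 > 0" by simp
    obtain f' where f': "f' \<in> A_algebra p" "L2_norm \<sigma> (\<lambda>z. f z - f' z) < e / 2" by (rule hardy_approx[OF f e])
    obtain g' where g': "g' \<in> A_algebra p" "L2_norm \<sigma> (\<lambda>z. g z - g' z) < e / 2" by (rule hardy_approx[OF g e])
    have "L2_norm \<sigma> (\<lambda>z. (f z - f' z) + (g z - g' z)) \<le> L2_norm \<sigma> (\<lambda>z. f z - f' z) + L2_norm \<sigma> (\<lambda>z. g z - g' z)"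
      by (intro L2_norm_triangle L2_diff hardy_L2 f g A_algebra_L2 f' g')
    then have "L2_norm \<sigma> (\<lambda>z. (f z + g z) - (1 * f' z + 1 * g' z)) < e"
      using f'(2) g'(2) by (simp add: algebra_simps)
    then show "\<exists>h\<in>A_algebra p. L2_norm \<sigma> (\<lambda>z. (f z + g z) - h z) < e"
      using A_algebra_lincomb[OF f'(1) g'(1), of 1 1] by (intro bexI[of _ "\<lambda>z. 1 * f' z + 1 * g' z"])
  qed
  show "(\<lambda>x. c * f x) \<in> hardy p" if f: "f \<in> hardy p" for c f
  proof (rule hardyI)
    show "(\<lambda>x. c * f x) \<in> L2 \<sigma>" by (intro L2_cmult hardy_L2 f)
    fix e :: real assume "e > 0"
    have c1: "cmod c + 1 > 0" by (simp add: add_nonneg_pos)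
    with \<open>e > 0\<close> have e: "e / (cmod c + 1) > 0" by (rule divide_pos_pos)
    obtain g where g: "g \<in> A_algebra p" "L2_norm \<sigma> (\<lambda>z. f z - g z) < e / (cmod c + 1)"
      by (rule hardy_approx[OF f e])
    have "L2_norm \<sigma> (\<lambda>z. c * f z - (c * g z + 0 * g z)) = cmod c * L2_norm \<sigma> (\<lambda>z. f z - g z)"
      unfolding L2_norm_cmult[symmetric] by (simp add: algebra_simps)
    also have "\<dots> \<le> cmod c * (e / (cmod c + 1))" using g(2) by (intro mult_left_mono) auto
    also have "\<dots> < (cmod c + 1) * (e / (cmod c + 1))" using e by (intro mult_strict_right_mono) auto
    also have "\<dots> = e" by (subst times_divide_eq_right, rule nonzero_mult_div_cancel_left) (use c1 in linarith)
    finally have "L2_norm \<sigma> (\<lambda>z. c * f z - (c * g z + 0 * g z)) < e" .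
    then show "\<exists>h\<in>A_algebra p. L2_norm \<sigma> (\<lambda>z. c * f z - h z) < e"
      using A_algebra_lincomb[OF g(1) g(1), of c 0] by (intro bexI[of _ "\<lambda>z. c * g z + 0 * g z"])
  qed
  show "f \<in> hardy p" if f: "f \<in> L2 \<sigma>" and ap: "\<And>e. e > 0 \<Longrightarrow> \<exists>h\<in>hardy p. L2_norm \<sigma> (\<lambda>x. f x - h x) < e" for f
  proof (rule hardyI[OF f])
    fix e :: real assume "e > 0"
    then have e: "e / 2 > 0" by simp
    obtain h where h: "h \<in> hardy p" "L2_norm \<sigma> (\<lambda>x. f x - h x) < e / 2" using ap[OF e] by blast
    obtain g where g: "g \<in> A_algebra p" "L2_norm \<sigma> (\<lambda>z. h z - g z) < e / 2" by (rule hardy_approx[OF h(1) e])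
    have "L2_norm \<sigma> (\<lambda>z. f z - g z) < e"
      using L2_norm_triangle_mid[OF f hardy_L2[OF h(1)] A_algebra_L2[OF g(1)]] h(2) g(2) by linarith
    then show "\<exists>g\<in>A_algebra p. L2_norm \<sigma> (\<lambda>z. f z - g z) < e" using g(1) by blast
  qed
qed

lemma continuous_bounded_symbol:
  assumes "continuous_on S \<phi>" shows "H.bounded_symbol \<phi>"
proof -
  have "bounded (\<phi> ` S)" by (intro compact_imp_bounded compact_continuous_image assms compact_frontier_Omega)
  then obtain B where "\<And>z. z \<in> S \<Longrightarrow> cmod (\<phi> z) \<le> B" by (auto simp: bounded_iff)
  then show ?thesis
    using sigma_measurable_continuous[OF assms] by (auto simp: H.bounded_symbol_def space_sigma)
qed

lemma coordinate_mult_norm_le: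
  assumes "f \<in> L2 \<sigma>" "\<And>z. cmod (\<phi> z) = cmod (z $ i)" "continuous_on S \<phi>"
  shows "L2_norm \<sigma> (\<lambda>z. \<phi> z * f z) \<le> L2_norm \<sigma> f"
  using L2_bounded_mult(2)[OF assms(1) sigma_measurable_continuous[OF assms(3)], of 1]
    norm_nth_le_1[OF subsetD[OF frontier_subset_K], of _ i] assms(2) by (simp add: space_sigma)

lemma hardy_coord:
  assumes f: "f \<in> hardy p" shows "(\<lambda>z. z $ i * f z) \<in> hardy p"
proof (rule hardyI)
  have c: "continuous_on S (\<lambda>z. z $ i)" by (intro continuous_intros)
  show "(\<lambda>z. z $ i * f z) \<in> L2 \<sigma>"
    by (rule H.bounded_symbol_mult_L2[OF continuous_bounded_symbol[OF c] hardy_L2[OF f]])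
  fix e :: real assume e: "e > 0"
  obtain g where g: "g \<in> A_algebra p" "L2_norm \<sigma> (\<lambda>z. f z - g z) < e" by (rule hardy_approx[OF f e])
  have "L2_norm \<sigma> (\<lambda>z. z $ i * (f z - g z)) \<le> L2_norm \<sigma> (\<lambda>z. f z - g z)"
    by (intro coordinate_mult_norm_le c L2_diff hardy_L2 f A_algebra_L2 g) simp
  then have "L2_norm \<sigma> (\<lambda>z. z $ i * f z - z $ i * g z) < e" using g(2) by (simp add: right_diff_distrib)
  then show "\<exists>h\<in>A_algebra p. L2_norm \<sigma> (\<lambda>z. z $ i * f z - h z) < e"
    using A_algebra_coord[OF g(1)] by (intro bexI[of _ "\<lambda>z. z $ i * g z"])
qed

lemma hardy_monomial: "monomial \<alpha> \<in> hardy p"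
  by (intro A_algebra_subset_hardy A_algebra_monomial)

lemma hardy_sum: "(\<And>i. i \<in> I \<Longrightarrow> f i \<in> hardy p) \<Longrightarrow> (\<lambda>z. \<Sum>i\<in>I. f i z) \<in> hardy p"
  by (induction I rule: infinite_finite_induct) (auto intro: H.add_mem H.zero_mem)

lemma hardy_poly_approx:
  assumes f: "f \<in> hardy p" and "e > 0"
  obtains G a where "finite G" "L2_norm \<sigma> (\<lambda>z. f z - (\<Sum>\<alpha>\<in>G. a \<alpha> * monomial \<alpha> z)) < e"
proof -
  have e: "e / 2 > 0" "e / 4 > 0" using \<open>e > 0\<close> by auto
  obtain g where g: "g \<in> A_algebra p" "L2_norm \<sigma> (\<lambda>z. f z - g z) < e / 2" by (rule hardy_approx[OF f e(1)])
  obtain G a where G: "finite G" "\<forall>z\<in>K. cmod (g z - (\<Sum>\<alpha>\<in>G. a \<alpha> * monomial \<alpha> z)) < e / 4"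
    using A_algebra_poly_approx[OF g(1)] e(2) unfolding poly_approx_def by meson
  let ?q = "\<lambda>z. \<Sum>\<alpha>\<in>G. a \<alpha> * monomial \<alpha> z"
  have q: "?q \<in> L2 \<sigma>" by (intro L2_sum L2_cmult monomial_L2)
  \<comment> \<open>The zero function with factor 0 leaves only the constant term: \<sigma> has mass
    at most 1, so a uniform bound is a bound in norm.\<close>
  have "(L2_norm \<sigma> (\<lambda>z. g z - ?q z))\<^sup>2 \<le> 0 * (L2_norm \<sigma> (\<lambda>z. 0))\<^sup>2 + (e / 4)\<^sup>2"
  proof (rule L2_norm_sq_le_pointwise)
    show "(cmod (g z - ?q z))\<^sup>2 \<le> 0 * (cmod 0)\<^sup>2 + (e / 4)\<^sup>2" if "z \<in> S" for z
    proof -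
      have "cmod (g z - ?q z) \<le> e / 4" using G(2) subsetD[OF frontier_subset_K that] by (blast intro: less_imp_le)
      then have "(cmod (g z - ?q z))\<^sup>2 \<le> (e / 4)\<^sup>2" by (intro power_mono) auto
      then show ?thesis by simp
    qed
  qed (auto intro!: L2_diff[OF A_algebra_L2[OF g(1)] q])
  then have "(L2_norm \<sigma> (\<lambda>z. g z - ?q z))\<^sup>2 \<le> (e / 4)\<^sup>2" by simp
  then have "L2_norm \<sigma> (\<lambda>z. g z - ?q z) \<le> e / 4" using e by (meson less_imp_le power2_le_imp_le)
  then have "L2_norm \<sigma> (\<lambda>z. f z - ?q z) < e"
    using L2_norm_triangle_mid[OF hardy_L2[OF f] A_algebra_L2[OF g(1)] q] g(2) e by linarith
  then show ?thesis using that[OF G(1)] by blast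
qed

section \<open>Orthogonality and the Hankel operators\<close>

text \<open>Rotation invariance multiplies the inner product by \<open>a * cnj b\<close>, which
  differs from 1.\<close>

lemma orthogonal_weights:
  assumes f: "f \<in> L2 \<sigma>" and g: "g \<in> L2 \<sigma>" and u: "cmod u = 1"
    and fw: "\<And>z. f (rot j u z) = a * f z" and gw: "\<And>z. g (rot j u z) = b * g z"
    and ab: "a * cnj b \<noteq> 1"
  shows "L2_inner \<sigma> f g = 0"
proof -
  have m: "(\<lambda>z. f z * cnj (g z)) \<in> borel_measurable \<sigma>"
    using L2_integrable_mult[OF f g] by (rule borel_measurable_integrable)
  have "L2_inner \<sigma> f g = (\<integral>z. f (rot j u z) * cnj (g (rot j u z)) \<partial>\<sigma>)"
    unfolding L2_inner_def by (rule integral_rot[OF u m, symmetric])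
  also have "\<dots> = (\<integral>z. (a * cnj b) * (f z * cnj (g z)) \<partial>\<sigma>)"
    by (simp add: fw gw mult_ac)
  also have "\<dots> = (a * cnj b) * L2_inner \<sigma> f g" unfolding L2_inner_def by simp
  finally have "(1 - a * cnj b) * L2_inner \<sigma> f g = 0" by (simp add: algebra_simps)
  then show ?thesis using ab by simp
qed

lemma separating_rotation:
  fixes a b :: nat
  assumes "a \<noteq> b"
  obtains u where "cmod u = 1" "u ^ a * cnj u ^ b \<noteq> 1"
proof -
  \<comment> \<open>For \<open>u = cis x\<close> the product becomes
    \<open>cis ((a - b) * x) = cis pi = -1\<close>.\<close>
  define x where "x = pi / (real a - real b)"
  have "(real a - real b) * x = pi" using assms by (simp add: x_def)
  then have "real a * x + real b * (- x) = pi" by (simp add: left_diff_distrib)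
  then have "cis x ^ a * cnj (cis x) ^ b = cis pi"
    unfolding cis_cnj Complex.DeMoivre cis_mult by simp
  then have "cis x ^ a * cnj (cis x) ^ b \<noteq> 1" by simp
  then show ?thesis using that[of "cis x"] by simp
qed

lemma monomial_orthogonal:
  assumes "\<alpha> \<noteq> \<beta>" shows "L2_inner \<sigma> (monomial \<alpha>) (monomial \<beta>) = 0"
proof -
  obtain j where "\<alpha> j \<noteq> \<beta> j" using assms by auto
  then obtain u where u: "cmod u = 1" "u ^ \<alpha> j * cnj u ^ \<beta> j \<noteq> 1" by (rule separating_rotation)
  show ?thesis
    by (rule orthogonal_weights[OF monomial_L2 monomial_L2 u(1) monom_rot monom_rot]) (use u(2) in simp)
qed

text \<open>\<open>d \<alpha>\<close> need not be the exact coefficient of the projection of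
  \<open>cnj z_i z^\<alpha>\<close>: subtracting any multiple of a monomial gives an upper bound for
  the Hankel norm.\<close>

definition hankel_term :: "'n \<Rightarrow> (('n \<Rightarrow> nat) \<Rightarrow> complex) \<Rightarrow> ('n \<Rightarrow> nat) \<Rightarrow> complex ^ 'n \<Rightarrow> complex" where
  "hankel_term i d \<alpha> z = cnj (z $ i) * monomial \<alpha> z - d \<alpha> * monomial (lowered i \<alpha>) z"

lemma hankel_term_L2: "hankel_term i d \<alpha> \<in> L2 \<sigma>"
  unfolding hankel_term_def[abs_def] by (intro sigma_L2_continuous continuous_intros continuous_on_monom)

text \<open>Both summands have the same weight: \<open>cnj (z $ i)\<close> lowers the weight at
  \<open>i\<close> by one, just as \<open>lowered\<close> does. At \<open>\<alpha> i = 0\<close>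
  these weights would be -1 and 0, so the second summand has to be absent.\<close>

lemma hankel_term_rot:
  assumes d: "\<alpha> i = 0 \<Longrightarrow> d \<alpha> = 0" and u: "cmod u = 1"
  shows "hankel_term i d \<alpha> (rot j u z) = (u ^ \<alpha> j * (if j = i then cnj u else 1)) * hankel_term i d \<alpha> z"
proof (cases "j = i")
  case False
  then show ?thesis by (simp add: hankel_term_def monom_rot lowered_def algebra_simps)
next
  case True
  have uc: "u * cnj u = 1" using complex_norm_square[of u] u by simp
  have "d \<alpha> * monomial (lowered i \<alpha>) (rot i u z) = (u ^ \<alpha> i * cnj u) * (d \<alpha> * monomial (lowered i \<alpha>) z)"
  proof (cases "\<alpha> i = 0")
    case False
    then have "u ^ \<alpha> i * cnj u = u ^ (\<alpha> i - 1)"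
      using uc by (cases "\<alpha> i") (simp_all add: mult_ac)
    then show ?thesis by (simp add: monom_rot lowered_def)
  qed (simp add: d)
  then have "hankel_term i d \<alpha> (rot i u z) = cnj (u * z $ i) * (u ^ \<alpha> i * monomial \<alpha> z)
      - (u ^ \<alpha> i * cnj u) * (d \<alpha> * monomial (lowered i \<alpha>) z)"
    unfolding hankel_term_def by (simp only: rot_nth monom_rot[of \<alpha>] if_True refl)
  then show ?thesis using True by (simp add: hankel_term_def algebra_simps)
qed

lemma hankel_term_orthogonal:
  assumes d: "\<And>\<alpha>. \<alpha> i = 0 \<Longrightarrow> d \<alpha> = 0" and "\<alpha> \<noteq> \<beta>"
  shows "L2_inner \<sigma> (hankel_term i d \<alpha>) (hankel_term i d \<beta>) = 0"
proof -
  obtain j where "\<alpha> j \<noteq> \<beta> j" using assms(2) by auto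
  then obtain u where u: "cmod u = 1" "u ^ \<alpha> j * cnj u ^ \<beta> j \<noteq> 1" by (rule separating_rotation)
  have uc: "cnj u * u = 1" using complex_norm_square[of u] u(1) by (simp add: mult.commute)
  let ?w = "\<lambda>n. u ^ n * (if j = i then cnj u else 1)"
  \<comment> \<open>The extra factor \<open>cnj u\<close> at coordinate \<open>i\<close> is common
    to both terms and unimodular, so it cancels.\<close>
  have "?w (\<alpha> j) * cnj (?w (\<beta> j)) = u ^ \<alpha> j * cnj u ^ \<beta> j * (if j = i then cnj u * u else 1)"
    by (cases "j = i") (simp_all add: mult_ac)
  also have "\<dots> = u ^ \<alpha> j * cnj u ^ \<beta> j" by (simp add: uc)
  finally have w: "?w (\<alpha> j) * cnj (?w (\<beta> j)) \<noteq> 1" using u(2) by (simp only: not_False_eq_True)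
  show ?thesis
  proof (rule orthogonal_weights[OF hankel_term_L2 hankel_term_L2 u(1) _ _ w])
    show "hankel_term i d \<alpha> (rot j u z) = ?w (\<alpha> j) * hankel_term i d \<alpha> z" for z
      by (rule hankel_term_rot[OF d u(1)])
    show "hankel_term i d \<beta> (rot j u z) = ?w (\<beta> j) * hankel_term i d \<beta> z" for z
      by (rule hankel_term_rot[OF d u(1)])
  qed
qed

lemma polynomial_norm_sq:
  assumes "finite G"
  shows "(L2_norm \<sigma> (\<lambda>z. \<Sum>\<alpha>\<in>G. a \<alpha> * monomial \<alpha> z))\<^sup>2 = (\<Sum>\<alpha>\<in>G. (cmod (a \<alpha>) * L2_norm \<sigma> (monomial \<alpha>))\<^sup>2)"
  using L2_norm_sum_orthogonal[OF assms, of "\<lambda>\<alpha> z. a \<alpha> * monomial \<alpha> z" \<sigma>]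
  by (simp add: L2_cmult monomial_L2 L2_inner_cmult_left L2_inner_cmult_right monomial_orthogonal)

text \<open>Division by zero makes this the zero function when the monomial has norm zero.\<close>

definition unit_monomial :: "('n \<Rightarrow> nat) \<Rightarrow> complex ^ 'n \<Rightarrow> complex" where
  "unit_monomial \<alpha> z = of_real (1 / L2_norm \<sigma> (monomial \<alpha>)) * monomial \<alpha> z"

lemma unit_monomial_L2: "unit_monomial \<alpha> \<in> L2 \<sigma>"
  unfolding unit_monomial_def[abs_def] by (intro L2_cmult monomial_L2)

lemma polynomial_inner_unit_monomial:
  assumes "finite G" "\<beta> \<in> G"
  shows "cmod (L2_inner \<sigma> (\<lambda>z. \<Sum>\<alpha>\<in>G. a \<alpha> * monomial \<alpha> z) (unit_monomial \<beta>)) = cmod (a \<beta>) * L2_norm \<sigma> (monomial \<beta>)"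
proof -
  have "L2_inner \<sigma> (\<lambda>z. \<Sum>\<alpha>\<in>G. a \<alpha> * monomial \<alpha> z) (monomial \<beta>)
      = (\<Sum>\<alpha>\<in>G. a \<alpha> * L2_inner \<sigma> (monomial \<alpha>) (monomial \<beta>))"
    by (subst L2_inner_sum_left) (auto intro: L2_cmult monomial_L2 simp: L2_inner_cmult_left)
  also have "\<dots> = (\<Sum>\<alpha>\<in>G. if \<alpha> = \<beta> then a \<beta> * of_real ((L2_norm \<sigma> (monomial \<beta>))\<^sup>2) else 0)"
    by (intro sum.cong) (auto simp: monomial_orthogonal L2_inner_self)
  also have "\<dots> = a \<beta> * of_real ((L2_norm \<sigma> (monomial \<beta>))\<^sup>2)" using assms by simp
  finally have "cmod (L2_inner \<sigma> (\<lambda>z. \<Sum>\<alpha>\<in>G. a \<alpha> * monomial \<alpha> z) (unit_monomial \<beta>))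
      = (1 / L2_norm \<sigma> (monomial \<beta>)) * (cmod (a \<beta>) * (L2_norm \<sigma> (monomial \<beta>))\<^sup>2)"
    unfolding unit_monomial_def[abs_def] L2_inner_cmult_right by (simp add: norm_mult norm_divide norm_power)
  then show ?thesis by (cases "L2_norm \<sigma> (monomial \<beta>) = 0") (simp_all add: power2_eq_square)
qed

text \<open>The terms \<open>hankel_term i d \<alpha>\<close> differ from \<open>cnj z\<^sub>i z\<^sup>\<alpha>\<close> by elements of the Hardy space and are
  mutually orthogonal, so an estimate for single monomials is inherited by polynomials.\<close>

lemma hankel_polynomial_estimate:
  fixes a d :: "('n \<Rightarrow> nat) \<Rightarrow> complex"
  assumes F: "finite F" and G: "finite G" and \<epsilon>: "\<epsilon> \<ge> 0"
    and d0: "\<And>\<alpha>. \<alpha> i = 0 \<Longrightarrow> d \<alpha> = 0" and dF: "\<And>\<alpha>. \<alpha> \<in> F \<Longrightarrow> d \<alpha> = 0"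
    and est: "\<And>\<alpha>. \<alpha> \<notin> F \<Longrightarrow> L2_norm \<sigma> (hankel_term i d \<alpha>) \<le> \<epsilon> * L2_norm \<sigma> (monomial \<alpha>)"
  defines "q \<equiv> \<lambda>z. \<Sum>\<alpha>\<in>G. a \<alpha> * monomial \<alpha> z"
  shows "H.hankel_norm (\<lambda>z. cnj (z $ i)) q
    \<le> \<epsilon> * L2_norm \<sigma> q + (\<Sum>\<alpha>\<in>F. cmod (L2_inner \<sigma> q (unit_monomial \<alpha>)))"
proof -
  let ?v = "\<lambda>\<alpha> z. a \<alpha> * hankel_term i d \<alpha> z"
  let ?h = "\<lambda>z. \<Sum>\<alpha>\<in>G. a \<alpha> * d \<alpha> * monomial (lowered i \<alpha>) z"
  have c: "continuous_on S (\<lambda>z. cnj (z $ i))" by (intro continuous_intros)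
  have qL: "q \<in> L2 \<sigma>" unfolding q_def by (intro L2_sum L2_cmult monomial_L2)
  have "?h \<in> hardy p" by (intro hardy_sum H.cmult_mem hardy_monomial)
  then have "H.hankel_norm (\<lambda>z. cnj (z $ i)) q \<le> L2_norm \<sigma> (\<lambda>z. cnj (z $ i) * q z - ?h z)"
    by (intro H.proj_best H.bounded_symbol_mult_L2 continuous_bounded_symbol c qL)
  also have "(\<lambda>z. cnj (z $ i) * q z - ?h z) = (\<lambda>z. \<Sum>\<alpha>\<in>G. ?v \<alpha> z)"
    by (simp add: q_def hankel_term_def sum_distrib_left sum_subtractf[symmetric] algebra_simps)
  \<comment> \<open>Each exponent in \<open>F\<close> is paid for by its own functional; the
    remaining terms satisfy \<open>est\<close> and are summed by Pythagoras.\<close>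
  also have "\<dots> = (\<lambda>z. (\<Sum>\<alpha>\<in>G \<inter> F. ?v \<alpha> z) + (\<Sum>\<alpha>\<in>G - F. ?v \<alpha> z))"
    using G by (simp add: sum.Int_Diff[of G _ F])
  also have "L2_norm \<sigma> \<dots> \<le> L2_norm \<sigma> (\<lambda>z. \<Sum>\<alpha>\<in>G \<inter> F. ?v \<alpha> z) + L2_norm \<sigma> (\<lambda>z. \<Sum>\<alpha>\<in>G - F. ?v \<alpha> z)"
    by (intro L2_norm_triangle L2_sum L2_cmult hankel_term_L2)
  also have "L2_norm \<sigma> (\<lambda>z. \<Sum>\<alpha>\<in>G \<inter> F. ?v \<alpha> z) \<le> (\<Sum>\<alpha>\<in>F. cmod (L2_inner \<sigma> q (unit_monomial \<alpha>)))"
  proof -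
    have "L2_norm \<sigma> (\<lambda>z. \<Sum>\<alpha>\<in>G \<inter> F. ?v \<alpha> z) \<le> (\<Sum>\<alpha>\<in>G \<inter> F. L2_norm \<sigma> (?v \<alpha>))"
      by (intro L2_norm_sum_le L2_cmult hankel_term_L2)
    also have "\<dots> \<le> (\<Sum>\<alpha>\<in>G \<inter> F. cmod (L2_inner \<sigma> q (unit_monomial \<alpha>)))"
    proof (rule sum_mono)
      fix \<alpha> assume \<alpha>: "\<alpha> \<in> G \<inter> F"
      then have "hankel_term i d \<alpha> = (\<lambda>z. cnj (z $ i) * monomial \<alpha> z)"
        by (simp add: hankel_term_def fun_eq_iff dF)
      then have "L2_norm \<sigma> (?v \<alpha>) \<le> cmod (a \<alpha>) * L2_norm \<sigma> (monomial \<alpha>)"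
        unfolding L2_norm_cmult using coordinate_mult_norm_le[OF monomial_L2 _ c]
        by (intro mult_left_mono) auto
      then show "L2_norm \<sigma> (?v \<alpha>) \<le> cmod (L2_inner \<sigma> q (unit_monomial \<alpha>))"
        unfolding q_def using polynomial_inner_unit_monomial[OF G, of \<alpha> a] \<alpha> by simp
    qed
    also have "\<dots> \<le> (\<Sum>\<alpha>\<in>F. cmod (L2_inner \<sigma> q (unit_monomial \<alpha>)))"
      using F by (intro sum_mono2) auto
    finally show ?thesis .
  qed
  also have "L2_norm \<sigma> (\<lambda>z. \<Sum>\<alpha>\<in>G - F. ?v \<alpha> z) \<le> \<epsilon> * L2_norm \<sigma> q"
  proof (rule power2_le_imp_le)
    have "(L2_norm \<sigma> (\<lambda>z. \<Sum>\<alpha>\<in>G - F. ?v \<alpha> z))\<^sup>2 = (\<Sum>\<alpha>\<in>G - F. (L2_norm \<sigma> (?v \<alpha>))\<^sup>2)"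
      using G by (intro L2_norm_sum_orthogonal)
        (auto intro: L2_cmult hankel_term_L2 simp: L2_inner_cmult_left L2_inner_cmult_right hankel_term_orthogonal[OF d0])
    also have "\<dots> \<le> (\<Sum>\<alpha>\<in>G - F. \<epsilon>\<^sup>2 * (cmod (a \<alpha>) * L2_norm \<sigma> (monomial \<alpha>))\<^sup>2)"
    proof (rule sum_mono)
      fix \<alpha> assume "\<alpha> \<in> G - F"
      then have "cmod (a \<alpha>) * L2_norm \<sigma> (hankel_term i d \<alpha>) \<le> cmod (a \<alpha>) * (\<epsilon> * L2_norm \<sigma> (monomial \<alpha>))"
        by (intro mult_left_mono est) auto
      then have "(L2_norm \<sigma> (?v \<alpha>))\<^sup>2 \<le> (cmod (a \<alpha>) * (\<epsilon> * L2_norm \<sigma> (monomial \<alpha>)))\<^sup>2"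
        unfolding L2_norm_cmult by (intro power_mono) auto
      then show "(L2_norm \<sigma> (?v \<alpha>))\<^sup>2 \<le> \<epsilon>\<^sup>2 * (cmod (a \<alpha>) * L2_norm \<sigma> (monomial \<alpha>))\<^sup>2"
        by (simp add: power_mult_distrib mult_ac)
    qed
    also have "\<dots> \<le> (\<Sum>\<alpha>\<in>G. \<epsilon>\<^sup>2 * (cmod (a \<alpha>) * L2_norm \<sigma> (monomial \<alpha>))\<^sup>2)"
      using G by (intro sum_mono2) auto
    also have "\<dots> = (\<epsilon> * L2_norm \<sigma> q)\<^sup>2"
      unfolding q_def power_mult_distrib[of \<epsilon>] polynomial_norm_sq[OF G] sum_distrib_left ..
    finally show "(L2_norm \<sigma> (\<lambda>z. \<Sum>\<alpha>\<in>G - F. ?v \<alpha> z))\<^sup>2 \<le> (\<epsilon> * L2_norm \<sigma> q)\<^sup>2" .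
  qed (use \<epsilon> in simp)
  finally show ?thesis by simp
qed

text \<open>The Hankel seminorm is Lipschitz with constant 1, as the coordinates have modulus at
  most 1 on \<open>S\<close>. This transfers estimates from polynomials to their limits.\<close>

lemma hankel_norm_cnj_coord_diff:
  assumes f: "f \<in> hardy p" and q: "q \<in> hardy p"
  shows "H.hankel_norm (\<lambda>z. cnj (z $ i)) f
    \<le> H.hankel_norm (\<lambda>z. cnj (z $ i)) q + L2_norm \<sigma> (\<lambda>z. f z - q z)"
proof -
  have c: "continuous_on S (\<lambda>z. cnj (z $ i))" by (intro continuous_intros)
  note bs = continuous_bounded_symbol[OF c]
  let ?F = "\<lambda>z. cnj (z $ i) * f z" and ?Q = "\<lambda>z. cnj (z $ i) * q z"
  have L: "?F \<in> L2 \<sigma>" "?Q \<in> L2 \<sigma>" by (intro H.bounded_symbol_mult_L2 bs hardy_L2 f q)+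
  have "H.hankel_norm (\<lambda>z. cnj (z $ i)) f \<le> L2_norm \<sigma> (\<lambda>z. ?F z - L2_proj \<sigma> (hardy p) ?Q z)"
    by (intro H.proj_best H.proj_mem L)
  also have "\<dots> \<le> L2_norm \<sigma> (\<lambda>z. ?F z - ?Q z) + H.hankel_norm (\<lambda>z. cnj (z $ i)) q"
    by (intro L2_norm_triangle_mid L H.proj_L2)
  also have "L2_norm \<sigma> (\<lambda>z. ?F z - ?Q z) = L2_norm \<sigma> (\<lambda>z. cnj (z $ i) * (f z - q z))"
    by (simp add: right_diff_distrib)
  also have "\<dots> \<le> L2_norm \<sigma> (\<lambda>z. f z - q z)"
    by (intro coordinate_mult_norm_le c L2_diff hardy_L2 f q) simp
  finally show ?thesis by simp
qed

lemma null_L2_norm: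
  assumes "\<forall>A. emeasure \<sigma> A = 0" shows "L2_norm \<sigma> f = 0"
proof -
  have "space \<sigma> \<in> null_sets \<sigma>" using assms by (auto simp: null_sets_def)
  then have "AE z in \<sigma>. (cmod (f z))\<^sup>2 = 0" by (rule AE_I') auto
  then have "(\<integral>z. (cmod (f z))\<^sup>2 \<partial>\<sigma>) = 0" by (rule integral_eq_zero_AE)
  then show ?thesis by (simp add: L2_norm_def)
qed

text \<open>Both sides of the polynomial estimate are continuous in the norm, so density of
  polynomials extends it to the Hardy space. The test functions are the finitely many unit monomials
  of low degree.\<close>

lemma compact_hankel_cnj_coord: "H.compact_hankel (\<lambda>z. cnj (z $ i))"
  unfolding H.compact_hankel_def
proof
  show "H.bounded_symbol (\<lambda>z. cnj (z $ i))" by (intro continuous_bounded_symbol continuous_intros)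
  show "H.compact_seminorm (H.hankel_norm (\<lambda>z. cnj (z $ i)))"
  proof (cases "\<forall>A. emeasure \<sigma> A = 0")
    case True
    show ?thesis
      by (rule H.compact_seminorm_mono[OF H.compact_seminorm_zero]) (simp add: null_L2_norm[OF True])
  next
    case nonnull: False
    show ?thesis
      unfolding H.compact_seminorm_def
    proof (intro allI impI)
      fix e :: real assume e: "e > 0"
      obtain N where N: "\<And>\<alpha>. deg \<alpha> \<ge> N \<Longrightarrow> \<exists>d. (\<alpha> i = 0 \<longrightarrow> d = 0) \<and>
          L2_norm \<sigma> (\<lambda>z. cnj (z $ i) * monomial \<alpha> z - d * monomial (lowered i \<alpha>) z) \<le> e * L2_norm \<sigma> (monomial \<alpha>)"
        using conj_coordinate_estimate[OF nonnull e] by blast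
      define F where "F = {\<alpha> :: 'n \<Rightarrow> nat. deg \<alpha> < N}"
      have F: "finite F" unfolding F_def by (rule finite_deg_less)
      have "\<forall>\<alpha>. \<exists>d. (\<alpha> i = 0 \<longrightarrow> d = 0) \<and> (\<alpha> \<in> F \<longrightarrow> d = 0) \<and> (\<alpha> \<notin> F \<longrightarrow>
          L2_norm \<sigma> (\<lambda>z. cnj (z $ i) * monomial \<alpha> z - d * monomial (lowered i \<alpha>) z) \<le> e * L2_norm \<sigma> (monomial \<alpha>))"
      proof
        fix \<alpha> show "\<exists>d. (\<alpha> i = 0 \<longrightarrow> d = 0) \<and> (\<alpha> \<in> F \<longrightarrow> d = 0) \<and> (\<alpha> \<notin> F \<longrightarrow>
          L2_norm \<sigma> (\<lambda>z. cnj (z $ i) * monomial \<alpha> z - d * monomial (lowered i \<alpha>) z) \<le> e * L2_norm \<sigma> (monomial \<alpha>))"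
          using N[of \<alpha>] by (cases "\<alpha> \<in> F") (auto simp: F_def not_less)
      qed
      from choice[OF this] obtain d where d: "\<And>\<alpha>. \<alpha> i = 0 \<Longrightarrow> d \<alpha> = 0" "\<And>\<alpha>. \<alpha> \<in> F \<Longrightarrow> d \<alpha> = 0"
        and est: "\<And>\<alpha>. \<alpha> \<notin> F \<Longrightarrow> L2_norm \<sigma> (\<lambda>z. cnj (z $ i) * monomial \<alpha> z - d \<alpha> * monomial (lowered i \<alpha>) z)
            \<le> e * L2_norm \<sigma> (monomial \<alpha>)"
        by blast
      obtain Fl where Fl: "set Fl = F" "distinct Fl" using finite_distinct_list[OF F] by blast
      have sum_Fl: "(\<Sum>g\<leftarrow>map unit_monomial Fl. h g) = (\<Sum>\<alpha>\<in>F. h (unit_monomial \<alpha>))"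
        for h :: "(complex ^ 'n \<Rightarrow> complex) \<Rightarrow> real"
        using Fl by (simp add: o_def sum_list_distinct_conv_sum_set)
      have "H.hankel_norm (\<lambda>z. cnj (z $ i)) f
          \<le> e * L2_norm \<sigma> f + (\<Sum>\<alpha>\<in>F. cmod (L2_inner \<sigma> f (unit_monomial \<alpha>)))" if f: "f \<in> hardy p" for f
      proof (rule field_le_epsilon)
        fix t :: real assume t: "t > 0"
        \<comment> \<open>Collects the three errors made on replacing \<open>f\<close> by
          \<open>q\<close>: in the norm, in the Hankel seminorm, and in the functionals.\<close>
        define C where "C = e + 1 + (\<Sum>\<alpha>\<in>F. L2_norm \<sigma> (unit_monomial \<alpha>))"
        have C: "C > 0" unfolding C_def using e by (intro add_pos_nonneg sum_nonneg) auto
        obtain G a where G: "finite G" "L2_norm \<sigma> (\<lambda>z. f z - (\<Sum>\<alpha>\<in>G. a \<alpha> * monomial \<alpha> z)) < t / C"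
          by (rule hardy_poly_approx[OF f divide_pos_pos[OF t C]])
        define q where "q = (\<lambda>z. \<Sum>\<alpha>\<in>G. a \<alpha> * monomial \<alpha> z)"
        define s where "s = L2_norm \<sigma> (\<lambda>z. f z - q z)"
        have s: "s < t / C" using G(2) by (simp add: s_def q_def)
        have q: "q \<in> hardy p" unfolding q_def by (intro hardy_sum H.cmult_mem hardy_monomial)
        have "H.hankel_norm (\<lambda>z. cnj (z $ i)) q
            \<le> e * L2_norm \<sigma> q + (\<Sum>\<alpha>\<in>F. cmod (L2_inner \<sigma> q (unit_monomial \<alpha>)))"
          unfolding q_def
          by (rule hankel_polynomial_estimate[OF F G(1) less_imp_le[OF e] d]) (use est in \<open>simp_all add: hankel_term_def[abs_def]\<close>)
        moreover have "H.hankel_norm (\<lambda>z. cnj (z $ i)) f \<le> H.hankel_norm (\<lambda>z. cnj (z $ i)) q + s"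
          unfolding s_def by (rule hankel_norm_cnj_coord_diff[OF f q])
        moreover have "e * L2_norm \<sigma> q \<le> e * L2_norm \<sigma> f + e * s"
          unfolding distrib_left[symmetric] s_def using e L2_norm_le_add[OF hardy_L2[OF q] hardy_L2[OF f]]
          by (intro mult_left_mono) (auto simp: L2_norm_minus_commute[of _ q])
        moreover have "(\<Sum>\<alpha>\<in>F. cmod (L2_inner \<sigma> q (unit_monomial \<alpha>)))
            \<le> (\<Sum>\<alpha>\<in>F. cmod (L2_inner \<sigma> f (unit_monomial \<alpha>))) + s * (\<Sum>\<alpha>\<in>F. L2_norm \<sigma> (unit_monomial \<alpha>))"
          unfolding sum_distrib_left sum.distrib[symmetric]
        proof (rule sum_mono)
          fix \<alpha>
          have "L2_inner \<sigma> (\<lambda>z. f z - q z) (unit_monomial \<alpha>) = L2_inner \<sigma> f (unit_monomial \<alpha>) - L2_inner \<sigma> q (unit_monomial \<alpha>)"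
            by (intro L2_inner_diff_left hardy_L2 f q unit_monomial_L2)
          moreover have "cmod (L2_inner \<sigma> (\<lambda>z. f z - q z) (unit_monomial \<alpha>)) \<le> s * L2_norm \<sigma> (unit_monomial \<alpha>)"
            unfolding s_def by (intro L2_Cauchy_Schwarz L2_diff hardy_L2 f q unit_monomial_L2)
          ultimately show "cmod (L2_inner \<sigma> q (unit_monomial \<alpha>))
              \<le> cmod (L2_inner \<sigma> f (unit_monomial \<alpha>)) + s * L2_norm \<sigma> (unit_monomial \<alpha>)"
            using norm_triangle_ineq3[of "L2_inner \<sigma> f (unit_monomial \<alpha>)" "L2_inner \<sigma> q (unit_monomial \<alpha>)"]
            by simp
        qed
        moreover have "e * s + s + s * (\<Sum>\<alpha>\<in>F. L2_norm \<sigma> (unit_monomial \<alpha>)) = s * C"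
          by (simp add: C_def algebra_simps)
        moreover have "s * C \<le> t" using s C by (simp add: pos_less_divide_eq)
        ultimately show "H.hankel_norm (\<lambda>z. cnj (z $ i)) f
          \<le> e * L2_norm \<sigma> f + (\<Sum>\<alpha>\<in>F. cmod (L2_inner \<sigma> f (unit_monomial \<alpha>))) + t" by linarith
      qed
      then show "\<exists>gs. set gs \<subseteq> L2 \<sigma> \<and> (\<forall>f\<in>hardy p. H.hankel_norm (\<lambda>z. cnj (z $ i)) f
          \<le> e * L2_norm \<sigma> f + (\<Sum>g\<leftarrow>gs. cmod (L2_inner \<sigma> f g)))"
        by (intro exI[of _ "map unit_monomial Fl"] conjI ballI) (auto simp only: sum_Fl set_map intro: unit_monomial_L2)
    qed
  qed
qed

section \<open>From the coordinates to all continuous symbols\<close>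

lemma compact_hankel_coord: "H.compact_hankel (\<lambda>z. z $ i)"
  by (intro H.compact_hankel_multiplier continuous_bounded_symbol continuous_intros hardy_coord)

lemma compact_hankel_sum:
  "(\<And>i. i \<in> I \<Longrightarrow> H.compact_hankel (\<phi> i)) \<Longrightarrow> H.compact_hankel (\<lambda>z. \<Sum>i\<in>I. \<phi> i z)"
  by (induction I rule: infinite_finite_induct) (auto intro: H.compact_hankel_const H.compact_hankel_add)

text \<open>Real polynomial functions are generated by real-linear functionals. Such a functional is
  a combination of real and imaginary parts of coordinates, hence of the \<open>z $ i\<close> and
  their conjugates.\<close>

lemma compact_hankel_linear:
  fixes f :: "complex ^ 'n \<Rightarrow> real"
  assumes "bounded_linear f" shows "H.compact_hankel (\<lambda>z. of_real (f z))"
proof -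
  interpret bounded_linear f by (rule assms)
  define A where "A i = f (axis i 1)" for i
  define B where "B i = f (axis i \<i>)" for i
  have "of_real (f z) = (\<Sum>i\<in>UNIV. (of_real (A i) / 2 + of_real (B i) / (2 * \<i>)) * z $ i
      + (of_real (A i) / 2 - of_real (B i) / (2 * \<i>)) * cnj (z $ i))" for z
  proof -
    have "z = (\<Sum>i\<in>UNIV. Re (z $ i) *\<^sub>R axis i 1 + Im (z $ i) *\<^sub>R axis i \<i>)"
    proof (rule vec_eq_iff[THEN iffD2], rule allI)
      fix k
      have "(\<Sum>i\<in>UNIV. Re (z $ i) *\<^sub>R axis i 1 + Im (z $ i) *\<^sub>R axis i \<i>) $ k
          = (\<Sum>i\<in>UNIV. if i = k then Re (z $ k) *\<^sub>R 1 + Im (z $ k) *\<^sub>R \<i> else 0)"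
        unfolding sum_component by (intro sum.cong) (auto simp: axis_def)
      also have "\<dots> = z $ k" by (simp add: complex_eq_iff)
      finally show "z $ k = (\<Sum>i\<in>UNIV. Re (z $ i) *\<^sub>R axis i 1 + Im (z $ i) *\<^sub>R axis i \<i>) $ k" ..
    qed
    then have "f z = f (\<Sum>i\<in>UNIV. Re (z $ i) *\<^sub>R axis i 1 + Im (z $ i) *\<^sub>R axis i \<i>)" by simp
    also have "\<dots> = (\<Sum>i\<in>UNIV. Re (z $ i) * A i + Im (z $ i) * B i)"
      by (simp add: sum add scaleR A_def B_def)
    finally have "complex_of_real (f z) = (\<Sum>i\<in>UNIV. of_real (Re (z $ i) * A i + Im (z $ i) * B i))"
      by simp
    also have "\<dots> = (\<Sum>i\<in>UNIV. (of_real (A i) / 2 + of_real (B i) / (2 * \<i>)) * z $ i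
      + (of_real (A i) / 2 - of_real (B i) / (2 * \<i>)) * cnj (z $ i))"
      by (intro sum.cong refl) (simp add: complex_eq_iff)
    finally show ?thesis .
  qed
  then show ?thesis
    by (simp only:) (intro compact_hankel_sum H.compact_hankel_add H.compact_hankel_mult H.compact_hankel_const
        compact_hankel_coord compact_hankel_cnj_coord)
qed

lemma compact_hankel_polynomial:
  assumes "real_polynomial_function g" shows "H.compact_hankel (\<lambda>z. of_real (g z))"
  using assms
  by (induction g rule: real_polynomial_function.induct)
     (auto intro: compact_hankel_linear H.compact_hankel_const H.compact_hankel_add H.compact_hankel_mult)

lemma compact_hankel_continuous:
  assumes \<phi>: "continuous_on S \<phi>" shows "H.compact_hankel \<phi>"
proof (rule H.compact_hankel_limit[OF continuous_bounded_symbol[OF \<phi>]])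
  fix e :: real assume "e > 0"
  then have e: "e / 2 > 0" by simp
  \<comment> \<open>The approximation theorem used is for real functions, so real and imaginary
    parts are treated separately, with error \<open>e / 2\<close> each.\<close>
  obtain g where g: "real_polynomial_function g" "\<And>z. z \<in> S \<Longrightarrow> \<bar>Re (\<phi> z) - g z\<bar> < e / 2"
    using Stone_Weierstrass_real_polynomial_function[OF compact_frontier_Omega continuous_on_Re[OF \<phi>] e] by blast
  obtain h where h: "real_polynomial_function h" "\<And>z. z \<in> S \<Longrightarrow> \<bar>Im (\<phi> z) - h z\<bar> < e / 2"
    using Stone_Weierstrass_real_polynomial_function[OF compact_frontier_Omega continuous_on_Im[OF \<phi>] e] by blast
  let ?\<psi> = "\<lambda>z. of_real (g z) + \<i> * of_real (h z)"
  have "H.compact_hankel ?\<psi>"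
    by (intro H.compact_hankel_add H.compact_hankel_mult H.compact_hankel_const compact_hankel_polynomial g h)
  moreover have "cmod (\<phi> z - ?\<psi> z) \<le> e" if "z \<in> space \<sigma>" for z
    using cmod_le[of "\<phi> z - ?\<psi> z"] g(2)[of z] h(2)[of z] that by (simp add: space_sigma)
  ultimately show "\<exists>\<psi>. H.compact_hankel \<psi> \<and> (\<forall>x\<in>space \<sigma>. cmod (\<phi> x - \<psi> x) \<le> e)" by blast
qed

end

theorem corollary3p6:
  fixes p :: "'n::finite \<Rightarrow> nat list"
  assumes "CARD('n) \<ge> 3"
    and "admissible p"
  shows "(\<forall>\<phi> \<psi> :: complex ^ 'n \<Rightarrow> complex.
            continuous_on (frontier (Omega p)) \<phi> \<and> continuous_on (frontier (Omega p)) \<psi> \<longrightarrow>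
            compact_operator_on (sigma_p p) (hardy p)
              (\<lambda>f z. toeplitz p \<phi> (toeplitz p \<psi> f) z - toeplitz p \<psi> (toeplitz p \<phi> f) z)) \<and>
         essentially_normal_on (sigma_p p) (hardy p) coord_mult"
proof -
  interpret admissible_domain p by unfold_locales (rule assms(2))
  have "compact_operator_on \<sigma> (hardy p)
      (\<lambda>f z. toeplitz p \<phi> (toeplitz p \<psi> f) z - toeplitz p \<psi> (toeplitz p \<phi> f) z)"
    if "continuous_on S \<phi>" "continuous_on S \<psi>" for \<phi> \<psi>
    unfolding toeplitz_def
    by (rule H.compact_toeplitz_commutator[OF compact_hankel_continuous[OF that(1)] compact_hankel_continuous[OF that(2)]])
  moreover have "essentially_normal_on \<sigma> (hardy p) coord_mult"
  proof -
    have "essentially_normal_on \<sigma> (hardy p) (\<lambda>i f z. z $ i * f z)"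
      by (intro H.essentially_normal_multipliers hardy_coord compact_hankel_cnj_coord
          continuous_bounded_symbol continuous_intros)
    moreover have "coord_mult = (\<lambda>(i :: 'n) f z. z $ i * f z)" by (simp add: fun_eq_iff coord_mult_def)
    ultimately show ?thesis by simp
  qed
  ultimately show ?thesis by blast
qed

end
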